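(* Let $\beta>2$ and $\phi(z)=\lambda|z|^{2}$ on $\mathbb{C}$ for some $\lambda>0$, and consider the $N$-particle Coulomb gas in $\mathbb{C}$ at inverse temperature $\beta$ with exterior potential $V=N\phi$. Then there exists no strictly positive continuous function $f$ on $\mathbb{R}$ such that for every $u\in H^1(\mathbb{C})$, with $U_N:=\frac1N\sum_{i=1}^N u(z_i)$, $$\frac{1}{\beta N^{2}}\log\mathbb{E}\left(e^{-\beta N^{2}U_N}\right)\leq-\mathcal{F}(\phi+u)+\mathcal{F}(\phi)+N^{-1}f\left(E_0(\mu_{\phi+u})\right)$$ for all sufficiently large $N$.
   Context: $d\lambda$ is Lebesgue measure on $\mathbb{C}=\mathbb{R}^2$, $\psi_0(z):=\log(1+|z|^2)$. The $N$-particle Coulomb gas at inverse temperature $\beta$ with exterior potential $V$ is $\mathbb{C}^N$ with the probability measure proportional to $\prod_{i<j}|z_i-z_j|^{2\beta}\prod_ie^{-\beta V(z_i)}d\lambda^{\otimes N}$; $\mathbb{E}$ is its expectation. $H^1(\mathbb{C})$ is the space of $u\in L^2_{loc}(\mathbb{C})$ with distributional gradient $\nabla u\in L^2(\mathbb{C},d\lambda)$; convergence in the $H^1$-topology means convergence in $L^2_{loc}$ together with $L^2$-convergence of gradients. $E_0(\mu):=-\frac12\int\log|z-w|^2\mu\otimes\mu$ for probability measures with $\int\psi_0\mu<\infty$. For a probability measure $\mu$ on $\mathbb{C}$, $E_\phi(\mu):=-\frac12\int(\log|z-w|^2-\psi_0(z)-\psi_0(w))\mu\otimes\mu+\int(\phi-\psi_0)\mu$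 (equal to $E_0(\mu)+\int\phi\mu$ if $\mu$ has compact support). If $E_\phi(\mu)<\infty$ and $u\in H^1(\mathbb{C})$, $\int u\,\mu$ denotes the value at $u$ of the unique extension of $v\mapsto\int v\mu$ from $C_c^\infty(\mathbb{C})$ to $H^1(\mathbb{C})$ continuous for the $H^1$-topology. $\mathcal{F}(\phi+u):=\inf_\mu(E_\phi(\mu)+\int u\mu)$ over $\mu$ with $E_\phi(\mu)<\infty$, with unique minimizer $\mu_{\phi+u}$ (equilibrium measure). *)

theory Defs
  imports "HOL-Probability.Probability"
begin

primrec C_diff :: "nat \<Rightarrow> (complex \<Rightarrow> real) \<Rightarrow> bool" where
  "C_diff 0 v \<longleftrightarrow> continuous_on UNIV v"
| "C_diff (Suc k) v \<longleftrightarrow>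
     (\<forall>z. v differentiable (at z)) \<and> (\<forall>b. C_diff k (\<lambda>z. frechet_derivative v (at z) b))"

definition test_functions :: "(complex \<Rightarrow> real) set" where
  "test_functions = {v. (\<forall>k. C_diff k v) \<and> compact (closure {z. v z \<noteq> 0})}"

text \<open>A gradient is encoded as a complex number via \<open>\<complex> = \<real>\<^sup>2\<close>, so that \<open>g z \<bullet> b\<close> is the
  derivative in direction \<open>b\<close>. Elements of \<open>L\<^sup>2\<close> and \<open>L\<^sup>2\<^sub>l\<^sub>o\<^sub>c\<close> are represented by Borel functions;
  every almost-everywhere class has such a representative.\<close>

definition L2loc :: "(complex \<Rightarrow> real) set" where
  "L2loc = {u \<in> borel_measurable borel.
     \<forall>K. compact K \<longrightarrow> set_integrable lborel K (\<lambda>z. (u z)\<^sup>2)}"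

definition L2_weak_gradient :: "(complex \<Rightarrow> real) \<Rightarrow> (complex \<Rightarrow> complex) \<Rightarrow> bool" where
  "L2_weak_gradient u g \<longleftrightarrow>
     g \<in> borel_measurable borel \<and> integrable lborel (\<lambda>z. (norm (g z))\<^sup>2) \<and>
     (\<forall>v\<in>test_functions. \<forall>b\<in>Basis.
        (LINT z|lborel. u z * frechet_derivative v (at z) b) = - (LINT z|lborel. (g z \<bullet> b) * v z))"

definition H1 :: "(complex \<Rightarrow> real) set" where
  "H1 = {u \<in> L2loc. \<exists>g. L2_weak_gradient u g}"

text \<open>Determined only up to null sets, which is harmless under the integral below.\<close>

definition weak_gradient :: "(complex \<Rightarrow> real) \<Rightarrow> complex \<Rightarrow> complex" where
  "weak_gradient u = (SOME g. L2_weak_gradient u g)"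

definition H1_tendsto :: "(nat \<Rightarrow> complex \<Rightarrow> real) \<Rightarrow> (complex \<Rightarrow> real) \<Rightarrow> bool" where
  "H1_tendsto X u \<longleftrightarrow>
     (\<forall>K. compact K \<longrightarrow> (\<lambda>n. LINT z:K|lborel. (X n z - u z)\<^sup>2) \<longlonglongrightarrow> 0) \<and>
     (\<lambda>n. LINT z|lborel. (norm (weak_gradient (X n) z - weak_gradient u z))\<^sup>2) \<longlonglongrightarrow> 0"

text \<open>The difference of the integrals of the positive and the negative part (\<open>e2ennreal\<close> sends negative
  numbers to \<open>0\<close>). It is the usual integral with values in the extended reals whenever one of the
  two parts is finite, which is the case wherever it is relevant below.\<close>

definition ereal_integral :: "'a measure \<Rightarrow> ('a \<Rightarrow> ereal) \<Rightarrow> ereal" where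
  "ereal_integral M f =
     enn2ereal (\<integral>\<^sup>+ x. e2ennreal (f x) \<partial>M) - enn2ereal (\<integral>\<^sup>+ x. e2ennreal (- f x) \<partial>M)"

text \<open>The logarithm with \<open>log 0 = -\<infinity>\<close> and \<open>log \<infinity> = \<infinity>\<close>; note that \<open>ln 0 = 0\<close> on the reals.\<close>

definition elog :: "ennreal \<Rightarrow> ereal" where
  "elog x = (if x = 0 then - \<infinity> else if x = \<infinity> then \<infinity> else ereal (ln (enn2real x)))"

definition psi0 :: "complex \<Rightarrow> real" where
  "psi0 z = ln (1 + (cmod z)\<^sup>2)"

definition prob_measures :: "complex measure set" where
  "prob_measures = {\<mu>. prob_space \<mu> \<and> sets \<mu> = sets borel}"

text \<open>Meaningful if \<open>\<psi>\<^sub>0\<close> is \<open>\<mu>\<close>-integrable.\<close>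

definition E0 :: "complex measure \<Rightarrow> ereal" where
  "E0 \<mu> = ereal (- 1/2) *
     ereal_integral (\<mu> \<Otimes>\<^sub>M \<mu>) (\<lambda>(z, w). elog (ennreal ((cmod (z - w))\<^sup>2)))"

text \<open>The first integrand is nonpositive, as \<open>|z - w|\<^sup>2 \<le> (1 + |z|\<^sup>2) (1 + |w|\<^sup>2)\<close>.\<close>

definition energy :: "(complex \<Rightarrow> real) \<Rightarrow> complex measure \<Rightarrow> ereal" where
  "energy \<phi> \<mu> =
     ereal (- 1/2) * ereal_integral (\<mu> \<Otimes>\<^sub>M \<mu>)
       (\<lambda>(z, w). elog (ennreal ((cmod (z - w))\<^sup>2)) - ereal (psi0 z) - ereal (psi0 w))
     + ereal_integral \<mu> (\<lambda>z. ereal (\<phi> z - psi0 z))"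

definition finite_energy :: "(complex \<Rightarrow> real) \<Rightarrow> complex measure set" where
  "finite_energy \<phi> = {\<mu> \<in> prob_measures. energy \<phi> \<mu> < \<infinity>}"

text \<open>The topology of \<open>H\<^sup>1\<close> is given by countably many seminorms, hence continuity is sequential
  continuity. Functionals live on the whole function type, but only their restriction to \<open>H\<^sup>1\<close> is
  constrained; therefore it is the value at \<open>u\<close> that is unique.\<close>

definition continuous_extension :: "complex measure \<Rightarrow> ((complex \<Rightarrow> real) \<Rightarrow> real) \<Rightarrow> bool" where
  "continuous_extension \<mu> L \<longleftrightarrow>
     (\<forall>v\<in>test_functions. L v = (LINT z|\<mu>. v z)) \<and>
     (\<forall>X u. (\<forall>n. X n \<in> H1) \<and> u \<in> H1 \<and> H1_tendsto X u \<longrightarrow> (\<lambda>n. L (X n)) \<longlonglongrightarrow> L u)"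

definition pairing :: "(complex \<Rightarrow> real) \<Rightarrow> complex measure \<Rightarrow> real" where
  "pairing u \<mu> = (THE c. \<exists>L. continuous_extension \<mu> L \<and> L u = c)"

text \<open>\<open>perturbed_energy \<phi> u\<close>, \<open>free_energy \<phi> u\<close> and \<open>equilibrium_measure \<phi> u\<close> belong to the potential
  \<open>\<phi> + u\<close>, where \<open>u \<in> H\<^sup>1\<close>.\<close>

definition perturbed_energy ::
  "(complex \<Rightarrow> real) \<Rightarrow> (complex \<Rightarrow> real) \<Rightarrow> complex measure \<Rightarrow> ereal" where
  "perturbed_energy \<phi> u \<mu> = energy \<phi> \<mu> + ereal (pairing u \<mu>)"

definition free_energy :: "(complex \<Rightarrow> real) \<Rightarrow> (complex \<Rightarrow> real) \<Rightarrow> ereal" where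
  "free_energy \<phi> u = (INF \<mu>\<in>finite_energy \<phi>. perturbed_energy \<phi> u \<mu>)"

definition equilibrium_measure ::
  "(complex \<Rightarrow> real) \<Rightarrow> (complex \<Rightarrow> real) \<Rightarrow> complex measure" where
  "equilibrium_measure \<phi> u =
     (THE \<mu>. \<mu> \<in> finite_energy \<phi> \<and> perturbed_energy \<phi> u \<mu> = free_energy \<phi> u)"

definition gas_weight :: "nat \<Rightarrow> real \<Rightarrow> (complex \<Rightarrow> real) \<Rightarrow> (nat \<Rightarrow> complex) \<Rightarrow> real" where
  "gas_weight N \<beta> V z =
     (\<Prod>j<N. \<Prod>i<j. cmod (z i - z j) powr (2 * \<beta>)) * (\<Prod>i<N. exp (- \<beta> * V (z i)))"

definition partition_function :: "nat \<Rightarrow> real \<Rightarrow> (complex \<Rightarrow> real) \<Rightarrow> ennreal" where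
  "partition_function N \<beta> V =
     (\<integral>\<^sup>+ z. ennreal (gas_weight N \<beta> V z) \<partial>(\<Pi>\<^sub>M i\<in>{..<N}. lborel))"

definition coulomb_gas :: "nat \<Rightarrow> real \<Rightarrow> (complex \<Rightarrow> real) \<Rightarrow> (nat \<Rightarrow> complex) measure" where
  "coulomb_gas N \<beta> V =
     density (\<Pi>\<^sub>M i\<in>{..<N}. lborel)
       (\<lambda>z. ennreal (gas_weight N \<beta> V z) / partition_function N \<beta> V)"

definition linear_statistic :: "nat \<Rightarrow> (complex \<Rightarrow> real) \<Rightarrow> (nat \<Rightarrow> complex) \<Rightarrow> real" where
  "linear_statistic N u z = (1 / real N) * (\<Sum>i<N. u (z i))"

end

theory Submission
  imports Defs "Jordan_Normal_Form.Determinant"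
begin

text \<open>A single \<open>u\<close> contradicts the inequality for every value of its error term. Up to a smooth
  correction, \<open>u = max 0 (1 - \<phi>)\<close>, so that \<open>\<phi> + u = max \<phi> 1\<close> has as equilibrium measure the uniform
  measure on the circle \<open>\<phi> = 1\<close>, which has finite energy but infinite entropy. On an annulus of width
  of order \<open>1 / N\<close> inside that circle the mean of the squared Vandermonde determinant is computed
  exactly, and the power mean inequality bounds the gas integral for \<open>\<phi> + u\<close> from below. Hadamard's
  inequality bounds the partition function for \<open>\<phi>\<close> from above. The logarithm of the quotient is
  \<open>\<beta> N\<^sup>2 (F \<phi> - F (\<phi> + u)) + (\<beta> / 2 - 1) N log N + O(N)\<close>, and \<open>\<beta> > 2\<close> makes the second term
  larger than any multiple of \<open>N\<close>. The free energy of \<open>\<phi> + u\<close> is bounded by applying Hadamard's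
  inequality to \<open>N\<close> independent points with law \<open>\<mu>\<close> and letting \<open>N\<close> tend to infinity, that of \<open>\<phi>\<close>
  by the energy of the uniform measure on the disc.\<close>

section \<open>Hadamard's inequality and the Vandermonde determinant\<close>

text \<open>The N log N term is a contest between self-energy and entropy. A continuous measure
  counts the interaction of each particle with its own cell, which the pair sum of N points omits.
  Cells have diameter of order N^(-1/2) in a disc but 1/N on a circle, so the omitted part adds
  (beta / 2) N log N to the logarithm of the weight for the disc and beta N log N for the circle.
  Confining N particles to area of order 1/N costs a factor of order N^(-N). The balance is beta -
  beta / 2 - 1.

  Everything else may lose factors exponential in N, which explains the choices below. An annulus of
  relative width 1 / (N + 1) reduces each of the N moments by at most a factor e, and lying inside
  the circle it sees the constant potential max phi 1. The exact second moment needs beta = 1;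
  convexity carries its lower bound to larger beta. For the partition function the upper bound for
  larger beta comes from a kernel \<open>K\<close> with values in [0, 1], for which
  \<open>K powr b\<close> is at most \<open>K\<close>.\<close>

abbreviation vandermonde_square :: "nat \<Rightarrow> (nat \<Rightarrow> complex) \<Rightarrow> real" where
  "vandermonde_square n z \<equiv> \<Prod>j<n. \<Prod>i<j. (cmod (z i - z j))^2"

lemma cmod_vandermonde_det:
  "cmod (det (mat n n (\<lambda>(i, j). z i ^ j))) = (\<Prod>j<n. \<Prod>i<j. cmod (z i - z j))"
proof (induction n)
  case 0
  show ?case by (simp add: det_dim_zero)
next
  case (Suc n)
  let ?V = "mat (Suc n) (Suc n) (\<lambda>(i, j). z i ^ j)"
  \<comment> \<open>Right multiplication by \<open>E\<close> subtracts \<open>z n\<close> times each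
    column from the next one. The last row becomes (1, 0, ..., 0), and row i of the remaining minor
    contains the factor \<open>z i - z n\<close>.\<close>
  define E where "E = mat (Suc n) (Suc n) (\<lambda>(i, j). if i = j then 1 else if Suc i = j then - z n else 0)"
  define W where "W = mat (Suc n) (Suc n) (\<lambda>(i, j). if j = 0 then 1 else z i ^ (j - 1) * (z i - z n))"
  have VE: "?V * E = W"
  proof (rule eq_matI)
    fix i j assume "i < dim_row W" "j < dim_col W"
    then have i: "i < Suc n" and j: "j < Suc n" by (auto simp: W_def)
    have "(?V * E) $$ (i, j) = (\<Sum>k\<in>{0..<Suc n}. z i ^ k * (if k = j then 1 else if Suc k = j then - z n else 0))"
      using i j by (simp add: E_def scalar_prod_def del: sum.op_ivl_Suc)
    also have "\<dots> = (\<Sum>k\<in>{0..<Suc n}. (if k = j then z i ^ k else 0) + (if Suc k = j then - z n * z i ^ k else 0))"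
      by (intro sum.cong) auto
    also have "\<dots> = z i ^ j + (\<Sum>k\<in>{0..<Suc n}. if Suc k = j then - z n * z i ^ k else 0)"
      using j by (simp add: sum.distrib del: sum.op_ivl_Suc)
    also have "\<dots> = W $$ (i, j)"
    proof (cases j)
      case 0
      then show ?thesis using i j by (simp add: W_def)
    next
      case (Suc j')
      have "(\<Sum>k\<in>{0..<Suc n}. if Suc k = j then - z n * z i ^ k else 0) = - z n * z i ^ j'"
        using j Suc by (simp add: sum.delta del: sum.op_ivl_Suc)
      then show ?thesis using i j Suc by (simp add: W_def algebra_simps)
    qed
    finally show "(?V * E) $$ (i, j) = W $$ (i, j)" .
  qed (auto simp: W_def E_def)
  have "det E = prod_list (diag_mat E)"
    by (rule det_upper_triangular[of _ "Suc n"]) (auto simp: E_def)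
  also have "diag_mat E = map (\<lambda>_. 1) [0..<Suc n]"
    by (auto simp: diag_mat_def E_def)
  also have "prod_list \<dots> = 1"
    unfolding map_replicate_const by simp
  finally have "det ?V = det W"
    using det_mult[of ?V "Suc n" E] VE by (simp add: E_def)
  also have "\<dots> = (\<Sum>j<Suc n. W $$ (n, j) * cofactor W n j)"
    by (rule laplace_expansion_row) (auto simp: W_def)
  also have "\<dots> = (\<Sum>j<Suc n. if j = 0 then cofactor W n 0 else 0)"
    by (intro sum.cong) (auto simp: W_def)
  also have "\<dots> = cofactor W n 0"
    by (simp add: sum.delta)
  also have "\<dots> = (-1) ^ n * det (mat_delete W n 0)"
    by (simp add: cofactor_def)
  also have "mat_delete W n 0 = mat n n (\<lambda>(i, j). (z i - z n) * z i ^ j)"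
    by (rule eq_matI) (auto simp: mat_delete_def W_def)
  also have "\<dots> = mat\<^sub>r n n (\<lambda>i. (z i - z n) \<cdot>\<^sub>v row (mat n n (\<lambda>(i, j). z i ^ j)) i)"
    by (rule eq_matI) auto
  also have "det \<dots> = prod (\<lambda>i. z i - z n) {0..<n} * det (mat\<^sub>r n n (row (mat n n (\<lambda>(i, j). z i ^ j))))"
    by (subst det_rows_mul) auto
  also have "mat\<^sub>r n n (row (mat n n (\<lambda>(i, j). z i ^ j))) = mat n n (\<lambda>(i, j). z i ^ j)"
    by (rule eq_matI) auto
  finally show ?case
    using Suc.IH by (simp add: norm_mult norm_power prod_norm atLeast0LessThan)
qed

definition cdot :: "nat \<Rightarrow> (nat \<Rightarrow> complex) \<Rightarrow> (nat \<Rightarrow> complex) \<Rightarrow> complex" where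
  "cdot m v w = (\<Sum>k<m. v k * cnj (w k))"

lemma cdot_self: "cdot m v v = complex_of_real (\<Sum>k<m. (cmod (v k))^2)"
  by (simp add: cdot_def flip: complex_norm_square)

lemma cdot_cnj: "cnj (cdot m v w) = cdot m w v"
  by (simp add: cdot_def mult.commute)

lemma cdot_diff_left: "cdot m (\<lambda>k. v k - c * w k) u = cdot m v u - c * cdot m w u"
  by (simp add: cdot_def sum_subtractf sum_distrib_left left_diff_distrib mult.assoc)

lemma cdot_diff_right: "cdot m u (\<lambda>k. v k - c * w k) = cdot m u v - cnj c * cdot m u w"
  by (simp add: cdot_def sum_subtractf sum_distrib_left right_diff_distrib algebra_simps)

text \<open>Induction on the number of vectors: the Schur complement of the entry \<open>(0, 0)\<close> of a Gram
  matrix is the Gram matrix of the components orthogonal to the first vector.\<close>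

lemma gram_det_bound:
  "\<exists>r. det (mat n n (\<lambda>(i, j). cdot m (v i) (v j))) = complex_of_real r \<and>
     0 \<le> r \<and> r \<le> (\<Prod>i<n. \<Sum>k<m. (cmod (v i k))^2)"
proof (induction n arbitrary: v)
  case 0
  show ?case by (intro exI[of _ 1]) (simp add: det_dim_zero)
next
  case (Suc n)
  let ?nr = "\<lambda>v. \<Sum>k<m. (cmod (v k))^2"
  have nr0: "0 \<le> ?nr w" for w :: "nat \<Rightarrow> complex" by (intro sum_nonneg) auto
  define G where "G = mat (Suc n) (Suc n) (\<lambda>(i, j). cdot m (v i) (v j))"
  have Gc: "G \<in> carrier_mat (Suc n) (Suc n)" by (simp add: G_def)
  show ?case
  proof (cases "?nr (v 0) = 0")
    case True
    then have "v 0 k = 0" if "k < m" for k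
      using that by (subst (asm) sum_nonneg_eq_0_iff) auto
    then have "cdot m (v 0) w = 0" for w by (simp add: cdot_def)
    then have "det G = 0"
      by (subst laplace_expansion_row[OF Gc, of 0]) (auto simp: G_def intro!: sum.neutral)
    then show ?thesis
      unfolding G_def by (intro exI[of _ 0] conjI prod_nonneg ballI nr0) simp_all
  next
    case False
    define a where "a = cdot m (v 0) (v 0)"
    have a: "a = complex_of_real (?nr (v 0))" by (simp add: a_def cdot_self)
    have a0: "a \<noteq> 0" using False unfolding a by (simp only: of_real_eq_0_iff not_False_eq_True)
    define c where "c i = cdot m (v i) (v 0) / a" for i
    define u where "u i k = v i k - c i * v 0 k" for i k
    have u_alt: "u i = (\<lambda>k. v i k - c i * v 0 k)" for i by (simp add: u_def fun_eq_iff)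
    have orth: "cdot m (u i) (v 0) = 0" for i
      unfolding u_alt cdot_diff_left c_def using a0 by (simp flip: a_def)
    have orth': "cdot m (v 0) (u i) = 0" for i
      using orth[of i] cdot_cnj[of m "u i" "v 0"] by simp
    have uu: "cdot m (u i) (u j) = cdot m (v i) (v j) - c i * cdot m (v 0) (v j)" for i j
    proof -
      have "cdot m (u i) (u j) = cdot m (u i) (v j)"
        unfolding u_alt[of j] cdot_diff_right by (simp add: orth)
      then show ?thesis by (simp add: u_alt cdot_diff_left)
    qed
    define E where "E = mat (Suc n) (Suc n) (\<lambda>(i, j). if i = j then 1 else if j = 0 then - c i else 0)"
    have Ec: "E \<in> carrier_mat (Suc n) (Suc n)" by (simp add: E_def)
    have EG: "(E * G) $$ (i, j) = (if i = 0 then cdot m (v 0) (v j) else cdot m (v i) (v j) - c i * cdot m (v 0) (v j))"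
      if "i < Suc n" "j < Suc n" for i j
    proof -
      have "(E * G) $$ (i, j) = (\<Sum>k\<in>{0..<Suc n}. (if i = k then 1 else if k = 0 then - c i else 0) * cdot m (v k) (v j))"
        using that by (simp add: E_def G_def scalar_prod_def del: sum.op_ivl_Suc)
      also have "\<dots> = (\<Sum>k\<in>{0..<Suc n}. (if k = i then cdot m (v k) (v j) else 0)
          + (if k = 0 then (if i = 0 then 0 else - c i * cdot m (v k) (v j)) else 0))"
        by (intro sum.cong) auto
      also have "\<dots> = (if i = 0 then cdot m (v 0) (v j) else cdot m (v i) (v j) - c i * cdot m (v 0) (v j))"
        using that by (simp add: sum.distrib sum.delta del: sum.op_ivl_Suc)
      finally show ?thesis .
    qed
    have "det E = prod_list (diag_mat E)"
      by (rule det_lower_triangular[of "Suc n"]) (auto simp: E_def)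
    also have "diag_mat E = map (\<lambda>_. 1) [0..<Suc n]"
      by (auto simp: diag_mat_def E_def)
    also have "prod_list \<dots> = 1"
      unfolding map_replicate_const by simp
    finally have "det G = det (E * G)"
      using det_mult[OF Ec Gc] by simp
    also have "\<dots> = (\<Sum>i<Suc n. (E * G) $$ (i, 0) * cofactor (E * G) i 0)"
      by (rule laplace_expansion_column[of _ "Suc n"]) (use Ec Gc in auto)
    also have "\<dots> = (\<Sum>i<Suc n. if i = 0 then a * cofactor (E * G) 0 0 else 0)"
      by (intro sum.cong refl, subst EG) (use a0 in \<open>auto simp: c_def a_def\<close>)
    also have "\<dots> = a * cofactor (E * G) 0 0" by (simp add: sum.delta)
    also have "cofactor (E * G) 0 0 = det (mat_delete (E * G) 0 0)" by (simp add: cofactor_def)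
    also have "mat_delete (E * G) 0 0 = mat n n (\<lambda>(i, j). cdot m (u (Suc i)) (u (Suc j)))"
    proof (rule eq_matI)
      fix i j assume ij: "i < dim_row (mat n n (\<lambda>(i, j). cdot m (u (Suc i)) (u (Suc j))))"
        "j < dim_col (mat n n (\<lambda>(i, j). cdot m (u (Suc i)) (u (Suc j))))"
      then have "mat_delete (E * G) 0 0 $$ (i, j) = (E * G) $$ (Suc i, Suc j)"
        using Ec Gc by (simp add: mat_delete_def)
      also have "\<dots> = cdot m (u (Suc i)) (u (Suc j))"
        using ij by (subst EG) (auto simp: uu)
      finally show "mat_delete (E * G) 0 0 $$ (i, j) = mat n n (\<lambda>(i, j). cdot m (u (Suc i)) (u (Suc j))) $$ (i, j)"
        using ij by simp
    qed (use Ec Gc in \<open>auto simp: mat_delete_def\<close>)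
    finally have detG: "det G = a * det (mat n n (\<lambda>(i, j). cdot m (u (Suc i)) (u (Suc j))))" .
    obtain r where r: "det (mat n n (\<lambda>(i, j). cdot m (u (Suc i)) (u (Suc j)))) = complex_of_real r"
      "0 \<le> r" "r \<le> (\<Prod>i<n. ?nr (u (Suc i)))"
      using Suc.IH[of "\<lambda>i. u (Suc i)"] by auto
    have le: "?nr (u i) \<le> ?nr (v i)" for i
    proof -
      have "cdot m (u i) (u i) = cdot m (v i) (v i) - a * (c i * cnj (c i))"
        unfolding uu using a0 cdot_cnj[of m "v i" "v 0"] a
        by (simp add: c_def)
      then have "complex_of_real (?nr (u i)) = complex_of_real (?nr (v i) - ?nr (v 0) * (cmod (c i))^2)"
        unfolding cdot_self a complex_norm_square[symmetric] by simp
      then have "?nr (u i) = ?nr (v i) - ?nr (v 0) * (cmod (c i))^2"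
        by (simp only: of_real_eq_iff)
      then show ?thesis using nr0[of "v 0"] by simp
    qed
    have "?nr (v 0) * r \<le> ?nr (v 0) * (\<Prod>i<n. ?nr (v (Suc i)))"
      by (intro mult_left_mono order_trans[OF r(3)] prod_mono conjI nr0 le)
    also have "\<dots> = (\<Prod>i<Suc n. ?nr (v i))" by (simp only: prod.lessThan_Suc_shift)
    finally show ?thesis
      using detG r(1,2) nr0[of "v 0"] a
      by (intro exI[of _ "?nr (v 0) * r"]) (auto simp: G_def simp del: of_real_sum)
  qed
qed

text \<open>\<open>B\<close> is the conjugate transpose of \<open>A\<close>, so \<open>A * B\<close>
  is the Gram matrix of the rows of \<open>A\<close> and has determinant |det A|^2.\<close>

theorem hadamard_inequality:
  fixes A :: "complex mat"
  assumes A: "A \<in> carrier_mat n n"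
  shows "(cmod (det A))^2 \<le> (\<Prod>i<n. \<Sum>j<n. (cmod (A $$ (i, j)))^2)"
proof -
  define B where "B = mat n n (\<lambda>(i, j). cnj (A $$ (j, i)))"
  have Bc: "B \<in> carrier_mat n n" by (simp add: B_def)
  have "B = transpose_mat (map_mat cnj A)"
    using A by (intro eq_matI) (auto simp: B_def)
  moreover have "det (transpose_mat (map_mat cnj A)) = det (map_mat cnj A)"
    by (rule det_transpose[of _ n]) (use A in auto)
  moreover have "det (map_mat cnj A) = cnj (det A)"
    using A by (subst (1 2) det_def') (auto intro!: sum.cong prod.cong)
  ultimately have "det (A * B) = complex_of_real ((cmod (det A))^2)"
    using det_mult[OF A Bc] unfolding complex_norm_square by metis
  moreover have "A * B = mat n n (\<lambda>(i, j). cdot n (\<lambda>k. A $$ (i, k)) (\<lambda>k. A $$ (j, k)))"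
    using A by (intro eq_matI) (auto simp: B_def scalar_prod_def cdot_def atLeast0LessThan)
  ultimately show ?thesis
    using gram_det_bound[of n n "\<lambda>i k. A $$ (i, k)"] by (auto simp del: of_real_power)
qed

text \<open>Hadamard's inequality after dividing the column of k-th powers by
  \<open>sqrt (h k)\<close>. The freedom in \<open>h\<close> is exploited twice: k! / c^k suits the
  Gaussian weight, 1 / l^k the circle.\<close>

lemma weighted_vandermonde_bound:
  assumes h: "\<And>k. k < n \<Longrightarrow> h k > 0"
  shows "vandermonde_square n z
    \<le> (\<Prod>i<n. \<Sum>k<n. (cmod (z i))\<^sup>2 ^ k / h k) * (\<Prod>k<n. h k)"
proof -
  define A where "A = mat n n (\<lambda>(i, j). z i ^ j)"
  \<comment> \<open>Transposed, so that the weights scale rows.\<close>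
  define B where "B = mat n n (\<lambda>(j, i). complex_of_real (1 / sqrt (h j)) * z i ^ j)"
  have AT: "transpose_mat A = mat n n (\<lambda>(j, i). z i ^ j)"
    by (intro eq_matI) (auto simp: A_def)
  have "B = mat\<^sub>r n n (\<lambda>j. complex_of_real (1 / sqrt (h j)) \<cdot>\<^sub>v row (transpose_mat A) j)"
    by (intro eq_matI) (auto simp: B_def AT)
  then have "det B = (\<Prod>j\<in>{0..<n}. complex_of_real (1 / sqrt (h j))) * det (mat\<^sub>r n n (row (transpose_mat A)))"
    by (simp only:, subst det_rows_mul) (auto simp: A_def)
  also have "mat\<^sub>r n n (row (transpose_mat A)) = transpose_mat A"
    by (intro eq_matI) (auto simp: A_def)
  also have "det (transpose_mat A) = det A"
    by (rule det_transpose[of _ n]) (auto simp: A_def)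
  finally have "cmod (det B) = (\<Prod>j<n. 1 / sqrt (h j)) * cmod (det A)"
    using h by (simp add: norm_mult atLeast0LessThan prod_norm[symmetric] norm_divide less_imp_le)
  then have "(cmod (det B))^2 * (\<Prod>j<n. h j) = (cmod (det A))^2 * (\<Prod>j<n. (1 / sqrt (h j))^2 * h j)"
    by (simp add: power_mult_distrib prod_power_distrib prod.distrib)
  also have "(\<Prod>j<n. (1 / sqrt (h j))^2 * h j) = 1"
    using h by (intro prod.neutral) (auto simp: power_divide less_imp_le less_imp_neq[symmetric])
  finally have "(cmod (det A))^2 = (cmod (det B))^2 * (\<Prod>j<n. h j)"
    by simp
  moreover have "(cmod (det (transpose_mat B)))^2 \<le> (\<Prod>i<n. \<Sum>j<n. (cmod (transpose_mat B $$ (i, j)))^2)"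
    by (rule hadamard_inequality) (auto simp: B_def)
  moreover have "det (transpose_mat B) = det B"
    by (rule det_transpose[of _ n]) (auto simp: B_def)
  moreover have "(\<Prod>i<n. \<Sum>j<n. (cmod (transpose_mat B $$ (i, j)))^2) = (\<Prod>i<n. \<Sum>k<n. (cmod (z i))\<^sup>2 ^ k / h k)"
    using h by (intro prod.cong sum.cong)
      (auto simp: B_def norm_mult norm_power norm_divide power_mult_distrib power_divide less_imp_le mult.commute simp flip: power_mult)
  moreover have "vandermonde_square n z = (cmod (det A))^2"
    unfolding A_def cmod_vandermonde_det by (simp add: prod_power_distrib)
  ultimately show ?thesis
    using h by (auto intro!: mult_right_mono prod_nonneg simp: less_imp_le)
qed

section \<open>Lebesgue measure on the complex plane\<close>

lemma lborel_distr_uminus_euclidean: "distr lborel borel uminus = (lborel :: 'a::euclidean_space measure)"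
  using lborel_affine[of "-1" "0::'a"] by (simp add: density_1)

text \<open>Uniqueness of Haar measure. Fubini and the substitutions y -> x + y and x -> x - y turn
  M(A) * lborel(B) into lborel(A) * M(B); on the unit ball \<open>B\<close> the two measures agree,
  and this common factor cancels.\<close>

lemma translation_invariant_imp_lborel:
  fixes M :: "'a::euclidean_space measure"
  assumes sets_M[measurable_cong]: "sets M = sets borel" and "sigma_finite_measure M"
    and inv: "\<And>c. distr M borel ((+) c) = M"
    and ball: "emeasure M (ball 0 1) = emeasure lborel (ball (0::'a) 1)"
  shows "M = lborel"
proof (rule measure_eqI)
  interpret M: sigma_finite_measure M by fact
  interpret P: pair_sigma_finite M "lborel :: 'a measure" ..
  fix A assume "A \<in> sets M"
  then have A[measurable]: "A \<in> sets borel" by (simp add: sets_M)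
  define B where "B = ball (0::'a) 1"
  have [measurable]: "B \<in> sets borel" by (simp add: B_def)
  have tr: "(\<integral>\<^sup>+ y. f y \<partial>lborel) = (\<integral>\<^sup>+ y. f (x
      + y) \<partial>lborel)" if [measurable]: "f \<in> borel_measurable borel"
    for f :: "'a \<Rightarrow> ennreal" and x
    by (subst lborel_distr_plus[of x, symmetric], subst nn_integral_distr) auto
  have re: "(\<integral>\<^sup>+ y. f y \<partial>lborel)
      = (\<integral>\<^sup>+ y. f (- y) \<partial>lborel)" if [measurable]: "f \<in> borel_measurable borel"
    for f :: "'a \<Rightarrow> ennreal"
    by (subst lborel_distr_uminus_euclidean[symmetric], subst nn_integral_distr) auto
  have trM: "(\<integral>\<^sup>+ y. f y \<partial>M) = (\<integral>\<^sup>+ y. f (x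
      + y) \<partial>M)" if [measurable]: "f \<in> borel_measurable borel"
    for f :: "'a \<Rightarrow> ennreal" and x
    by (subst inv[of x, symmetric], subst nn_integral_distr) auto
  have "emeasure M A * emeasure lborel B = (\<integral>\<^sup>+ x. indicator A x * (\<integral>\<^sup>+ y. indicator B y \<partial>lborel) \<partial>M)"
    by (simp add: nn_integral_multc)
  also have "\<dots> = (\<integral>\<^sup>+ x. \<integral>\<^sup>+ y. indicator A x * indicator B (x + y) \<partial>lborel \<partial>M)"
    by (intro nn_integral_cong, subst tr, simp, subst nn_integral_cmult) auto
  also have "\<dots> = (\<integral>\<^sup>+ y. \<integral>\<^sup>+ x. indicator A x * indicator B (x + y) \<partial>M \<partial>lborel)"
    by (rule P.Fubini'[symmetric]) measurable
  also have "\<dots> = (\<integral>\<^sup>+ y. \<integral>\<^sup>+ x. indicator A (x - y) * indicator B x \<partial>M \<partial>lborel)"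
  proof (rule nn_integral_cong)
    fix y :: 'a
    show "(\<integral>\<^sup>+ x. indicator A x * indicator B (x + y) \<partial>M)
        = (\<integral>\<^sup>+ x. indicator A (x - y) * indicator B x \<partial>M :: ennreal)"
      by (subst trM[of _ "- y"]) auto
  qed
  also have "\<dots> = (\<integral>\<^sup>+ x. \<integral>\<^sup>+ y. indicator A (x - y) * indicator B x \<partial>lborel \<partial>M)"
    by (rule P.Fubini') measurable
  also have "\<dots> = (\<integral>\<^sup>+ x. emeasure lborel A * indicator B x \<partial>M)"
  proof (intro nn_integral_cong)
    fix x :: 'a
    have "(\<integral>\<^sup>+ y. indicator A (x - y) \<partial>lborel) = (\<integral>\<^sup>+ y. indicator A (x + y) \<partial>(lborel::'a measure))"
      by (subst re) auto
    also have "\<dots> = emeasure lborel A" by (subst tr[symmetric]) auto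
    finally show "(\<integral>\<^sup>+ y. indicator A (x - y) * indicator B x \<partial>lborel) = emeasure lborel A * indicator B x"
      by (simp add: nn_integral_multc)
  qed
  also have "\<dots> = emeasure lborel A * emeasure lborel B"
    by (subst nn_integral_cmult_indicator) (auto simp: sets_M B_def ball)
  finally have "emeasure M A * emeasure lborel B = emeasure lborel A * emeasure lborel B" .
  moreover have "emeasure lborel B \<noteq> 0" "emeasure lborel B \<noteq> \<infinity>"
    using emeasure_ball[of 1 "0::'a"] by (auto simp: B_def unit_ball_vol_pos ennreal_eq_0_iff not_le)
  ultimately show "emeasure M A = emeasure lborel A"
    using ennreal_mult_cancel_left[of "emeasure lborel B" "emeasure M A" "emeasure lborel A"]
    by (auto simp: mult.commute)
qed (simp add: sets_M)

text \<open>The rotated measure is again translation invariant and gives the unit ball the same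
  mass.\<close>

lemma lborel_distr_rotation:
  assumes "cmod \<zeta> = 1"
  shows "distr lborel borel ((*) \<zeta>) = lborel"
proof (rule translation_invariant_imp_lborel)
  have z0: "\<zeta> \<noteq> 0" using assms by auto
  have "distr (distr lborel borel ((*) \<zeta>)) borel ((*) (inverse \<zeta>)) = lborel"
    using z0 by (subst distr_distr) (auto simp: o_def mult.assoc[symmetric] distr_id2)
  then show "sigma_finite_measure (distr lborel borel ((*) \<zeta>))"
    using sigma_finite_measure_distr[of "distr lborel borel ((*) \<zeta>)" borel "(*) (inverse \<zeta>)"] sigma_finite_lborel
    by simp
  fix c :: complex
  have "distr (distr lborel borel ((*) \<zeta>)) borel ((+) c)
      = distr (distr lborel borel ((+) (c / \<zeta>))) borel ((*) \<zeta>)"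
    using z0 by (simp add: distr_distr o_def distrib_left)
  then show "distr (distr lborel borel ((*) \<zeta>)) borel ((+) c) = distr lborel borel ((*) \<zeta>)"
    by (simp add: lborel_distr_plus)
next
  have "(*) \<zeta> -` ball 0 1 = ball 0 1" using assms by (auto simp: norm_mult)
  then show "emeasure (distr lborel borel ((*) \<zeta>)) (ball 0 1) = emeasure lborel (ball (0::complex) 1)"
    by (subst emeasure_distr) auto
qed simp

text \<open>The disc |z|^2 < t has area pi * t, so |z|^2 is distributed as pi times Lebesgue measure
  on the half-line.\<close>

lemma nn_integral_radial:
  fixes g :: "real \<Rightarrow> ennreal"
  assumes [measurable]: "g \<in> borel_measurable borel"
  shows "(\<integral>\<^sup>+ z. g ((cmod z)^2) \<partial>lborel) = ennreal pi * (\<integral>\<^sup>+ x. g x * indicator {0..} x \<partial>lborel)"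
proof -
  \<comment> \<open>The sign is reversed because the measures are compared on the half-lines
    \<open>{x<..}\<close>, which have finite mass only after this reflection.\<close>
  define M where "M = distr lborel borel (\<lambda>z. - (cmod z)\<^sup>2)"
  define D where "D = density lborel (\<lambda>x::real. ennreal pi * indicator {..0} x)"
  have M: "emeasure M {x<..} = ennreal pi * ennreal (- x)" for x
  proof (cases "x < 0")
    case True
    have "(cmod z)^2 < - x \<longleftrightarrow> cmod z < sqrt (- x)" for z
      using real_sqrt_less_iff[of "(cmod z)^2" "- x"] by simp
    then have "(\<lambda>z. - (cmod z)\<^sup>2) -` {x<..} = ball 0 (sqrt (- x))"
      by (auto simp: less_minus_iff minus_less_iff)
    then have "emeasure M {x<..} = emeasure lborel (ball (0::complex) (sqrt (- x)))"
      unfolding M_def by (subst emeasure_distr) auto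
    also have "\<dots> = ennreal (pi * - x)"
      using True by (subst emeasure_ball) (auto simp: unit_ball_vol_2)
    finally show ?thesis using True by (simp add: ennreal_mult'[symmetric])
  next
    case False
    have "\<not> x < - (cmod z)\<^sup>2" for z
      using False zero_le_power2[of "cmod z"] by linarith
    then have "(\<lambda>z. - (cmod z)\<^sup>2) -` {x<..} = {}" by auto
    then have "emeasure M {x<..} = 0" unfolding M_def by (subst emeasure_distr) auto
    then show ?thesis using False by (simp add: ennreal_neg)
  qed
  have D: "emeasure D {x<..} = ennreal pi * ennreal (- x)" for x
  proof -
    have "emeasure D {x<..} = (\<integral>\<^sup>+ y. ennreal pi * indicator {x<..0} y \<partial>lborel)"
      unfolding D_def by (subst emeasure_density) (auto intro!: nn_integral_cong split: split_indicator)
    also have "\<dots> = ennreal pi * emeasure lborel {x<..0}" by (simp add: nn_integral_cmult)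
    also have "emeasure lborel {x<..0} = ennreal (- x)"
      by (cases "x \<le> 0") (auto simp: ennreal_neg)
    finally show ?thesis .
  qed
  have "M = D"
    by (rule measure_eqI_lessThan) (auto simp: M D, auto simp: M_def D_def ennreal_mult_less_top)
  have "(\<integral>\<^sup>+ z. g ((cmod z)^2) \<partial>lborel) = (\<integral>\<^sup>+ x. g (- x) \<partial>M)"
    unfolding M_def by (subst nn_integral_distr) auto
  also have "\<dots> = (\<integral>\<^sup>+ x. (ennreal pi * indicator {..0} x) * g (- x) \<partial>lborel)"
    unfolding \<open>M = D\<close> D_def by (subst nn_integral_density) auto
  also have "\<dots> = (\<integral>\<^sup>+ x. ennreal pi * (g x * indicator {0..} x) \<partial>lborel)"
    by (subst (1) lborel_distr_uminus[symmetric], subst nn_integral_distr)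
      (auto intro!: nn_integral_cong split: split_indicator)
  also have "\<dots> = ennreal pi * (\<integral>\<^sup>+ x. g x * indicator {0..} x \<partial>lborel)"
    by (rule nn_integral_cmult) auto
  finally show ?thesis .
qed

lemma emeasure_radial_set:
  assumes [measurable]: "T \<in> sets borel" and T: "T \<subseteq> {0..}"
  shows "emeasure lborel {z. (cmod z)^2 \<in> T} = ennreal pi * emeasure lborel T"
proof -
  have [measurable]: "{z. (cmod z)^2 \<in> T} \<in> sets borel" by measurable
  have "emeasure lborel {z. (cmod z)^2 \<in> T} = (\<integral>\<^sup>+ z. indicator {z. (cmod z)^2 \<in> T} z \<partial>lborel)" by simp
  also have "\<dots> = (\<integral>\<^sup>+ z. indicator T ((cmod z)^2) \<partial>(lborel :: complex measure))"
    by (intro nn_integral_cong) (simp add: indicator_def)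
  also have "\<dots> = ennreal pi * (\<integral>\<^sup>+ x. indicator T x * indicator {0..} x \<partial>lborel)"
    by (rule nn_integral_radial) simp
  also have "(\<integral>\<^sup>+ x. indicator T x * indicator {0..} x \<partial>lborel)
      = (\<integral>\<^sup>+ x. indicator T x \<partial>(lborel :: real measure))"
    using T by (intro nn_integral_cong) (auto simp: indicator_def)
  finally show ?thesis by simp
qed

section \<open>The Vandermonde determinant of random points\<close>

definition rotation_invariant :: "complex measure \<Rightarrow> bool" where
  "rotation_invariant M \<longleftrightarrow> (\<forall>\<zeta>. cmod \<zeta> = 1 \<longrightarrow> distr M borel ((*) \<zeta>) = M)"

lemma rotation_invariant_uniform_measure:
  assumes [measurable]: "T \<in> sets borel"
  shows "rotation_invariant (uniform_measure lborel {z. (cmod z)^2 \<in> T})"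
  unfolding rotation_invariant_def
proof (intro allI impI measure_eqI)
  fix \<zeta> :: complex and A
  let ?S = "{z. (cmod z)^2 \<in> T}" and ?r = "(*) \<zeta>"
  assume \<zeta>: "cmod \<zeta> = 1" and "A \<in> sets (distr (uniform_measure lborel ?S) borel ?r)"
  then have [measurable]: "A \<in> sets borel" by simp
  have [measurable]: "?r -` A \<in> sets borel"
    using measurable_sets_borel[of ?r borel A] by simp
  have "?S \<inter> ?r -` A = ?r -` (?S \<inter> A)"
    using \<zeta> by (auto simp: norm_mult)
  then have "emeasure lborel (?S \<inter> ?r -` A) = emeasure (distr lborel borel ?r) (?S \<inter> A)"
    by (simp add: emeasure_distr)
  also have "\<dots> = emeasure lborel (?S \<inter> A)"
    by (simp add: lborel_distr_rotation[OF \<zeta>])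
  finally show "emeasure (distr (uniform_measure lborel ?S) borel ?r) A = emeasure (uniform_measure lborel ?S) A"
    by (simp add: emeasure_distr)
qed simp

lemma rotation_invariant_moment:
  assumes M: "rotation_invariant M" "sets M = sets borel" and jk: "j \<noteq> k"
  shows "(LINT z|M. z ^ j * cnj z ^ k) = 0"
proof -
  have [measurable_cong]: "sets M = sets borel" by fact
  \<comment> \<open>Rotation by this angle multiplies the integrand by cis ((j - k) t) = -1, so the
    moment equals its negative.\<close>
  define t where "t = pi / (real j - real k)"
  define \<zeta> where "\<zeta> = cis t"
  have "\<zeta> ^ j * cnj \<zeta> ^ k = cis (real j * t) * cis (real k * (- t))"
    unfolding \<zeta>_def cis_cnj[of t] Complex.DeMoivre ..
  then have "\<zeta> ^ j * cnj \<zeta> ^ k = cis (real j * t - real k * t)"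
    by (simp add: cis_mult)
  also have "real j * t - real k * t = pi"
    unfolding left_diff_distrib[symmetric] using jk by (simp add: t_def)
  finally have z: "\<zeta> ^ j * cnj \<zeta> ^ k = - 1" by simp
  have "(LINT z|M. z ^ j * cnj z ^ k) = (LINT z|distr M borel ((*) \<zeta>). z ^ j * cnj z ^ k)"
    using M by (simp add: rotation_invariant_def \<zeta>_def)
  also have "\<dots> = (LINT z|M. (\<zeta> ^ j * cnj \<zeta> ^ k) * (z ^ j * cnj z ^ k))"
    by (subst integral_distr) (auto simp: power_mult_distrib mult_ac borel_measurable_continuous_onI continuous_intros)
  also have "\<dots> = - (LINT z|M. z ^ j * cnj z ^ k)"
    unfolding z by simp
  finally show ?thesis by (simp add: equation_minus_iff)
qed

text \<open>Distinct monomials are orthogonal under a rotation invariant law. Of the double Leibniz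
  expansion of det * cnj det only the terms with \<open>p = q\<close> survive, and each of these n!
  terms has the same mean.\<close>

lemma vandermonde_second_moment:
  fixes M :: "complex measure"
  assumes "prob_space M" and sets_M[measurable_cong]: "sets M = sets borel"
    and bdd: "AE z in M. cmod z \<le> R" and inv: "rotation_invariant M"
  shows "has_bochner_integral (\<Pi>\<^sub>M i\<in>{..<n}. M) (\<lambda>z. vandermonde_square n z)
    (fact n * (\<Prod>k<n. LINT z|M. (cmod z)\<^sup>2 ^ k))"
proof -
  let ?h = "\<Prod>k<n. LINT z|M. (cmod z)\<^sup>2 ^ k"
  let ?PM = "\<Pi>\<^sub>M i\<in>{..<n}. M"
  interpret prob_space M by fact
  interpret P: product_prob_space "\<lambda>_. M" "{..<n}" ..
  let ?P = "{p. p permutes {0..<n}}"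
  let ?m = "\<lambda>j k z. z ^ j * cnj z ^ k :: complex"
  let ?t = "\<lambda>p q z. of_int (sign p * sign q) * (\<Prod>i<n. ?m (p i) (q i) (z i))"
  have int: "integrable M (?m j k)" for j k
  proof (rule integrable_const_bound)
    show "AE z in M. norm (?m j k z) \<le> R ^ j * R ^ k"
      using bdd
    proof eventually_elim
      case (elim z)
      then have "0 \<le> R" using norm_ge_zero order_trans by blast
      then show ?case using elim by (auto simp: norm_mult norm_power intro!: mult_mono power_mono)
    qed
    have "?m j k \<in> borel_measurable borel"
      by (intro borel_measurable_continuous_onI continuous_intros)
    then show "?m j k \<in> borel_measurable M"
      by (simp add: measurable_cong_sets[OF sets_M refl])
  qed
  have moment: "(LINT z|M. ?m j k z) = (if j = k then complex_of_real (LINT z|M. (cmod z)\<^sup>2 ^ k) else 0)" for j k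
  proof (cases "j = k")
    case True
    have "?m k k z = complex_of_real ((cmod z)\<^sup>2 ^ k)" for z
      unfolding of_real_power[of _ k] complex_norm_square power_mult_distrib by simp
    then show ?thesis using True by (simp del: of_real_power)
  qed (simp add: rotation_invariant_moment[OF inv sets_M])
  have eq: "complex_of_real (vandermonde_square n z) = (\<Sum>p\<in>?P. \<Sum>q\<in>?P. ?t p q z)" for z
  proof -
    define A where "A = mat n n (\<lambda>(i, j). z i ^ j)"
    have dA: "det A = (\<Sum>p\<in>?P. of_int (sign p) * (\<Prod>i<n. z i ^ p i))"
      by (subst det_def'[of A n])
        (auto simp: A_def atLeast0LessThan permutes_in_image intro!: sum.cong prod.cong dest: permutes_in_image)
    have "vandermonde_square n z = (cmod (det A))^2"
      unfolding A_def cmod_vandermonde_det by (simp add: prod_power_distrib)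
    then have "complex_of_real (vandermonde_square n z) = det A * cnj (det A)"
      by (simp only: complex_norm_square)
    also have "\<dots> = (\<Sum>p\<in>?P. \<Sum>q\<in>?P. ?t p q z)"
      unfolding dA by (simp add: sum_product prod.distrib mult_ac)
    finally show ?thesis .
  qed
  have t: "has_bochner_integral ?PM (?t p q)
      (if p = q then complex_of_real ?h else 0)"
    if p: "p \<in> ?P" and q: "q \<in> ?P" for p q
  proof -
    have "has_bochner_integral ?PM (\<lambda>z. \<Prod>i<n. ?m (p i) (q i) (z i)) (\<Prod>i<n. LINT z|M. ?m (p i) (q i) z)"
      using P.product_integrable_prod[of "{..<n}" "\<lambda>i. ?m (p i) (q i)"] P.product_integral_prod[of "{..<n}" "\<lambda>i. ?m (p i) (q i)"] int
      by (simp add: has_bochner_integral_iff)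
    then have "has_bochner_integral ?PM (?t p q) (of_int (sign p * sign q) * (\<Prod>i<n. LINT z|M. ?m (p i) (q i) z))"
      by (rule has_bochner_integral_mult_right)
    moreover have "of_int (sign p * sign q) * (\<Prod>i<n. LINT z|M. ?m (p i) (q i) z)
        = (if p = q then complex_of_real ?h else 0)"
    proof (cases "p = q")
      case True
      have "sign q * sign q = (1::int)" by (simp add: sign_def)
      moreover have "(\<Prod>i<n. complex_of_real (LINT z|M. (cmod z)\<^sup>2 ^ q i))
          = (\<Prod>k<n. complex_of_real (LINT z|M. (cmod z)\<^sup>2 ^ k))"
        using prod.permute[of q "{0..<n}" "\<lambda>k. complex_of_real (LINT z|M. (cmod z)\<^sup>2 ^ k)"] q by (simp add: o_def atLeast0LessThan)
      ultimately show ?thesis using True by (simp add: moment del: of_real_power)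
    next
      case False
      then obtain i where i: "p i \<noteq> q i" by auto
      have "i < n"
      proof (rule ccontr)
        assume "\<not> i < n"
        then have "p i = i" "q i = i" using p q by (auto intro: permutes_not_in)
        then show False using i by simp
      qed
      then have "(\<Prod>i<n. LINT z|M. ?m (p i) (q i) z) = 0"
        using i by (intro prod_zero) (auto simp: moment)
      then show ?thesis using False by simp
    qed
    ultimately show ?thesis by simp
  qed
  have "has_bochner_integral ?PM (\<lambda>z. \<Sum>p\<in>?P. \<Sum>q\<in>?P. ?t p q z)
     (\<Sum>p\<in>?P. \<Sum>q\<in>?P. if p = q then complex_of_real ?h else 0)"
    by (intro has_bochner_integral_sum t) auto
  also have "(\<Sum>p\<in>?P. \<Sum>q\<in>?P. if p = q then complex_of_real ?h else 0)
      = complex_of_real (fact n * ?h)"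
    using card_permutations[of "{0..<n}" n]
    by (simp add: sum.delta finite_permutations)
  finally have "has_bochner_integral ?PM
     (\<lambda>z. complex_of_real (vandermonde_square n z)) (complex_of_real (fact n * ?h))"
    unfolding eq .
  from has_bochner_integral_bounded_linear[OF bounded_linear_Re this] show ?thesis
    unfolding Re_complex_of_real .
qed

text \<open>Converts a mean over independent uniform points into an integral against Lebesgue
  measure, the form in which the gas weight is integrated.\<close>

lemma PiM_uniform_measure:
  fixes S :: "complex set"
  assumes S[measurable]: "S \<in> sets borel" and pos: "emeasure lborel S \<noteq> 0" and fin: "emeasure lborel S \<noteq> \<infinity>" and I: "finite I"
  shows "(\<Pi>\<^sub>M i\<in>I. uniform_measure lborel S)
    = density (\<Pi>\<^sub>M i\<in>I. lborel) (\<lambda>z. \<Prod>i\<in>I. indicator S (z i) / emeasure lborel S)"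
proof -
  let ?w = "\<lambda>z. \<Prod>i\<in>I. indicator S (z i) / emeasure lborel S"
  interpret U: prob_space "uniform_measure lborel S"
    using pos fin by (intro prob_space_uniform_measure) auto
  interpret UP: product_sigma_finite "\<lambda>_. uniform_measure lborel S" ..
  interpret LP: product_sigma_finite "\<lambda>_. lborel :: complex measure" ..
  show ?thesis
  proof (rule UP.PiM_eqI[symmetric, OF I])
    show "sets (density (\<Pi>\<^sub>M i\<in>I. lborel) ?w)
      = sets (\<Pi>\<^sub>M i\<in>I. uniform_measure lborel S)"
      unfolding sets_density by (intro sets_PiM_cong) auto
    fix A assume A: "\<And>i. i \<in> I \<Longrightarrow> A i \<in> sets (uniform_measure lborel S)"
    then have [measurable]: "i \<in> I \<Longrightarrow> A i \<in> sets borel" for i by auto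
    have "emeasure (density (\<Pi>\<^sub>M i\<in>I. lborel) ?w) (Pi\<^sub>E I A)
      = (\<integral>\<^sup>+ z. ?w z * indicator (Pi\<^sub>E I A) z \<partial>(\<Pi>\<^sub>M i\<in>I. lborel))"
      using I by (subst emeasure_density) (auto intro!: sets_PiM_I_finite)
    also have "\<dots> = (\<integral>\<^sup>+ z. (\<Prod>i\<in>I. indicator (S \<inter> A i) (z i) / emeasure lborel S) \<partial>(\<Pi>\<^sub>M i\<in>I. lborel))"
    proof (rule nn_integral_cong)
      fix z :: "'a \<Rightarrow> complex" assume "z \<in> space (\<Pi>\<^sub>M i\<in>I. lborel)"
      then have z: "z \<in> Pi\<^sub>E I (\<lambda>_. UNIV)" by (simp add: space_PiM)
      have "indicator (Pi\<^sub>E I A) z = (\<Prod>i\<in>I. indicator (A i) (z i) :: ennreal)"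
      proof (cases "z \<in> Pi\<^sub>E I A")
        case False
        then obtain i where "i \<in> I" "z i \<notin> A i" using z by (auto simp: PiE_def)
        then have "(\<Prod>i\<in>I. indicator (A i) (z i) :: ennreal) = 0"
          by (intro prod_zero I bexI[of _ i]) auto
        then show ?thesis using False by simp
      qed (auto simp: PiE_def Pi_def)
      then show "?w z * indicator (Pi\<^sub>E I A) z
        = (\<Prod>i\<in>I. indicator (S \<inter> A i) (z i) / emeasure lborel S)"
        by (auto simp: prod.distrib[symmetric] indicator_inter_arith ennreal_times_divide mult.commute intro!: prod.cong)
    qed
    also have "\<dots> = (\<Prod>i\<in>I. \<integral>\<^sup>+ z. indicator (S \<inter> A i) z / emeasure lborel S \<partial>lborel)"
      using I by (subst LP.product_nn_integral_prod) auto
    also have "\<dots> = (\<Prod>i\<in>I. emeasure (uniform_measure lborel S) (A i))"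
      by (intro prod.cong) (auto simp: nn_integral_divide)
    finally show "emeasure (density (\<Pi>\<^sub>M i\<in>I. lborel) ?w) (Pi\<^sub>E I A)
      = (\<Prod>i\<in>I. emeasure (uniform_measure lborel S) (A i))" .
  qed
qed

text \<open>The tangent of x^b at t, arranged so that both sides are nonnegative and can be
  integrated in \<open>ennreal\<close>.\<close>

lemma powr_above_tangent:
  fixes x t b :: real
  assumes "b \<ge> 1" "x \<ge> 0" "t > 0"
  shows "b * t powr (b - 1) * x \<le> x powr b + (b - 1) * t powr b"
proof (cases "x = 0")
  case True
  then show ?thesis using assms by simp
next
  case False
  then have x: "x > 0" using assms by simp
  have "x powr b - t powr b \<ge> (b * t powr (b - 1)) * (x - t)"
  proof (rule convex_on_imp_above_tangent[where A = "{0<..}"])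
    show "convex_on {0<..} (\<lambda>x. x powr b)" using assms by (intro powr_convex) auto
    show "((\<lambda>x. x powr b) has_real_derivative b * t powr (b - 1)) (at t within {0<..})"
      by (rule has_field_derivative_at_within[OF has_real_derivative_powr[OF assms(3)]])
    show "t \<in> interior {0<..}" using assms by (subst interior_open) auto
  qed (use x in auto)
  moreover have "b * t powr (b - 1) * (x - t) = b * t powr (b - 1) * x - b * t powr b"
    using assms by (simp add: powr_diff right_diff_distrib)
  moreover have "(b - 1) * t powr b = b * t powr b - t powr b"
    by (simp add: left_diff_distrib)
  ultimately show ?thesis by linarith
qed

text \<open>Jensen's inequality by integrating the tangent at the mean. The right-hand side may be
  infinite; only the finite constant term of the tangent is cancelled.\<close>

lemma (in prob_space) power_mean_le_nn_integral:
  fixes X :: "'a \<Rightarrow> real"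
  assumes X: "integrable M X" "\<And>x. X x \<ge> 0" and b: "b \<ge> 1"
  shows "ennreal (expectation X powr b) \<le> (\<integral>\<^sup>+ x. ennreal (X x powr b) \<partial>M)"
proof (cases "expectation X = 0")
  case False
  have [measurable]: "X \<in> borel_measurable M" using X by auto
  define t where "t = expectation X"
  have t: "t > 0" using False X unfolding t_def by (simp add: less_le)
  have "ennreal (t powr b) + ennreal ((b - 1) * t powr b) = ennreal (b * t powr (b - 1)) * ennreal t"
    using t b by (simp add: ennreal_plus[symmetric] ennreal_mult'[symmetric] powr_diff algebra_simps del: ennreal_plus)
  also have "ennreal t = (\<integral>\<^sup>+ x. ennreal (X x) \<partial>M)"
    unfolding t_def using X by (intro nn_integral_eq_integral[symmetric]) auto
  also have "ennreal (b * t powr (b - 1)) * (\<integral>\<^sup>+ x. ennreal (X x) \<partial>M)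
      = (\<integral>\<^sup>+ x. ennreal (b * t powr (b - 1) * X x) \<partial>M)"
    using b by (subst nn_integral_cmult[symmetric]) (auto simp: ennreal_mult'[symmetric])
  also have "\<dots> \<le> (\<integral>\<^sup>+ x. ennreal (X x powr b) + ennreal ((b - 1) * t powr b) \<partial>M)"
    using powr_above_tangent[OF b X(2) t] b
    by (intro nn_integral_mono) (auto simp: ennreal_plus[symmetric] simp del: ennreal_plus intro!: ennreal_leI)
  also have "\<dots> = (\<integral>\<^sup>+ x. ennreal (X x powr b) \<partial>M) + ennreal ((b - 1) * t powr b)"
    by (subst nn_integral_add) (auto simp: emeasure_space_1)
  finally show ?thesis
    unfolding t_def[symmetric] by (simp add: ennreal_add_left_cancel_le add.commute)
qed simp

section \<open>Bounds for the gas integrals\<close>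

abbreviation lborel_power :: "nat \<Rightarrow> (nat \<Rightarrow> complex) measure" where
  "lborel_power N \<equiv> \<Pi>\<^sub>M i\<in>{..<N}. lborel"

lemma gas_weight_measurable [measurable]:
  assumes [measurable]: "V \<in> borel_measurable borel"
  shows "gas_weight N b V \<in> borel_measurable (lborel_power N)"
proof -
  have [measurable]: "(\<lambda>z. z i) \<in> borel_measurable (lborel_power N)" if "i < N" for i
  proof -
    have "i \<in> {..<N}" using that by simp
    then show ?thesis by measurable
  qed
  have "(\<lambda>z. cmod (z i - z j) powr (2 * b)) \<in> borel_measurable (lborel_power N)" if "j < N" "i < j" for i j
    using that by (intro powr_real_measurable borel_measurable_norm borel_measurable_diff) auto
  moreover have "(\<lambda>z. exp (- b * V (z i))) \<in> borel_measurable (lborel_power N)" if "i < N" for i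
    using that by measurable
  ultimately show ?thesis
    unfolding gas_weight_def by (intro borel_measurable_times borel_measurable_prod) auto
qed

lemma prod_powr_eq_vandermonde_powr:
  "(\<Prod>j<N. \<Prod>i<j. cmod (z i - z j) powr (2 * b)) = (vandermonde_square N z) powr b"
proof -
  have "cmod w powr (2 * b) = ((cmod w)^2) powr b" for w
    by (cases "w = 0") (simp_all add: powr_powr[symmetric] powr_numeral)
  then show ?thesis by (simp add: prod_powr_distrib prod_nonneg)
qed

text \<open>As a function of x = |z|^2 each summand is 1 / c times an Erlang density, so it
  contributes pi / c.\<close>

lemma nn_integral_poisson_kernel:
  assumes c: "c > 0"
  shows "(\<integral>\<^sup>+ z. ennreal (\<Sum>k<N. (c * (cmod z)^2) ^ k / fact k * exp (- c * (cmod z)^2)) \<partial>lborel) = ennreal (pi * N / c)"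
proof -
  let ?g = "\<lambda>x. ennreal (\<Sum>k<N. (c * x) ^ k / fact k * exp (- c * x))"
  have one: "(\<integral>\<^sup>+ x. ennreal (erlang_density k c x) \<partial>lborel) = 1" for k
    using prob_space.emeasure_space_1[OF prob_space_erlang_density[OF c, of k]]
    by (simp add: emeasure_density)
  have "(\<integral>\<^sup>+ z. ?g ((cmod z)^2) \<partial>lborel) = ennreal pi * (\<integral>\<^sup>+ x. ?g x * indicator {0..} x \<partial>lborel)"
    by (rule nn_integral_radial) simp
  also have "(\<integral>\<^sup>+ x. ?g x * indicator {0..} x \<partial>lborel)
      = (\<integral>\<^sup>+ x. ennreal (1 / c) * (\<Sum>k<N. ennreal (erlang_density k c x)) \<partial>lborel)"
  proof (rule nn_integral_cong)
    fix x :: real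
    have "(\<Sum>k<N. (c * x) ^ k / fact k * exp (- c * x)) = 1 / c * (\<Sum>k<N. erlang_density k c x)" if "x \<ge> 0"
      using that c unfolding sum_distrib_left
      by (intro sum.cong) (auto simp: erlang_density_def power_mult_distrib field_simps)
    moreover have "erlang_density k c x = 0" if "\<not> x \<ge> 0" for k
      using that by (simp add: erlang_density_def)
    ultimately show "?g x * indicator {0..} x = ennreal (1 / c) * (\<Sum>k<N. ennreal (erlang_density k c x))"
      using c by (cases "x \<ge> 0")
        (simp_all add: ennreal_mult'[symmetric] sum_nonneg)
  qed
  also have "\<dots> = ennreal (1 / c) * ennreal N"
    by (subst nn_integral_cmult) (auto simp: nn_integral_sum one ennreal_of_nat_eq_real_of_nat)
  finally show ?thesis
    using c by (simp add: ennreal_mult'[symmetric])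
qed

text \<open>Hadamard's inequality, weighted by the squared norms of the monomials in the Gaussian
  \<open>L\<^sup>2\<close> space up to the factor \<open>\<pi> / c\<close>.\<close>

lemma partition_function_upper_bound:
  assumes b: "b \<ge> 1" and l: "l > 0" and N: "N > 0"
  shows "partition_function N b (\<lambda>w. real N * (l * (cmod w)^2))
    \<le> ennreal ((\<Prod>k<N. fact k / (real N * l) ^ k) powr b * (pi / l) ^ N)"
proof -
  interpret LP: product_sigma_finite "\<lambda>_. lborel :: complex measure" ..
  define c where "c = real N * l"
  have c: "c > 0" using l N by (simp add: c_def)
  \<comment> \<open>The probability that a Poisson variable of mean c |z|^2 is below N. Hence
    \<open>K\<close> is at most 1, so \<open>K powr b\<close> is at most \<open>K\<close>, which
    reduces the exponent b to 1.\<close>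
  define K where "K z = (\<Sum>k<N. (c * (cmod z)^2) ^ k / fact k * exp (- c * (cmod z)^2))" for z
  define H where "H = (\<Prod>k<N. fact k / c ^ k)"
  have H: "H > 0" unfolding H_def using c by (intro prod_pos) auto
  have Keq: "(\<Sum>k<N. (cmod z)\<^sup>2 ^ k / (fact k / c ^ k)) * exp (- c * (cmod z)^2) = K z" for z
    unfolding K_def sum_distrib_right by (intro sum.cong) (auto simp: power_mult_distrib)
  have K0: "0 \<le> K z" for z unfolding K_def using c by (intro sum_nonneg) auto
  have K1: "K z \<le> 1" for z
  proof -
    let ?x = "c * (cmod z)^2"
    have "(\<Sum>k<N. ?x ^ k / fact k) \<le> (\<Sum>k. ?x ^ k / fact k)"
      using c summable_exp[of ?x] by (intro sum_le_suminf) (auto simp: divide_inverse mult.commute)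
    also have "\<dots> = exp ?x" by (simp add: exp_def divide_inverse mult.commute)
    finally have "(\<Sum>k<N. ?x ^ k / fact k) * exp (- ?x) \<le> exp ?x * exp (- ?x)"
      by (intro mult_right_mono) auto
    then show ?thesis unfolding K_def by (simp add: sum_distrib_right exp_minus)
  qed
  have weight: "gas_weight N b (\<lambda>w. real N * (l * (cmod w)^2)) z \<le> H powr b * (\<Prod>i<N. K (z i))" for z
  proof -
    have "gas_weight N b (\<lambda>w. real N * (l * (cmod w)^2)) z
      = (vandermonde_square N z) powr b * (\<Prod>i<N. exp (- c * (cmod (z i))^2) powr b)"
      unfolding gas_weight_def prod_powr_eq_vandermonde_powr
      by (simp add: exp_powr_real c_def mult_ac)
    also have "\<dots> \<le> ((\<Prod>i<N. \<Sum>k<N. (cmod (z i))\<^sup>2 ^ k / (fact k / c ^ k)) * H) powr b * (\<Prod>i<N. exp (- c * (cmod (z i))^2) powr b)"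
      unfolding H_def using b c
      by (intro mult_right_mono powr_mono2 weighted_vandermonde_bound prod_nonneg) (auto intro!: prod_nonneg)
    also have "\<dots> = H powr b * (\<Prod>i<N. ((\<Sum>k<N. (cmod (z i))\<^sup>2 ^ k / (fact k / c ^ k)) * exp (- c * (cmod (z i))^2)) powr b)"
      using H c by (simp add: powr_mult prod_nonneg sum_nonneg prod_powr_distrib prod.distrib)
    also have "\<dots> = H powr b * (\<Prod>i<N. K (z i) powr b)"
      unfolding Keq ..
    also have "\<dots> \<le> H powr b * (\<Prod>i<N. K (z i))"
    proof (intro mult_left_mono prod_mono conjI)
      fix i
      show "K (z i) powr b \<le> K (z i)"
        using K0[of "z i"] K1[of "z i"] b powr_mono'[of 1 b "K (z i)"] by (cases "K (z i) = 0") auto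
    qed auto
    finally show ?thesis .
  qed
  have "partition_function N b (\<lambda>w. real N * (l * (cmod w)^2))
      \<le> (\<integral>\<^sup>+ z. ennreal (H powr b) * (\<Prod>i<N. ennreal (K (z i))) \<partial>lborel_power N)"
    unfolding partition_function_def using weight K0
    by (intro nn_integral_mono) (auto simp: prod_ennreal ennreal_mult'[symmetric] intro!: ennreal_leI)
  also have "\<dots> = ennreal (H powr b) * (\<integral>\<^sup>+ z. (\<Prod>i<N. ennreal (K (z i))) \<partial>lborel_power N)"
    by (intro nn_integral_cmult borel_measurable_prod) (auto simp: K_def)
  also have "(\<integral>\<^sup>+ z. (\<Prod>i<N. ennreal (K (z i))) \<partial>lborel_power N)
      = (\<integral>\<^sup>+ z. ennreal (K z) \<partial>lborel) ^ N"
    by (subst LP.product_nn_integral_prod) (auto simp: K_def)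
  also have "(\<integral>\<^sup>+ z. ennreal (K z) \<partial>lborel) = ennreal (pi / l)"
    unfolding K_def nn_integral_poisson_kernel[OF c] using N l by (simp add: c_def)
  finally show ?thesis
    using l by (simp add: H_def c_def ennreal_mult'[symmetric] ennreal_power)
qed

text \<open>The power mean inequality on the \<open>N\<close>-fold product of an annulus of width of order \<open>1 / N\<close>
  reduces the bound to the exactly computable case \<open>b = 1\<close>.\<close>

lemma gas_numerator_lower_bound:
  assumes b: "b \<ge> 1" and l: "l > 0" and N: "N > 0" and u[measurable]: "u \<in> borel_measurable borel"
    and a: "\<And>z. real N / (real N + 1) \<le> l * (cmod z)^2 \<Longrightarrow> l * (cmod z)^2
        \<le> 1 \<Longrightarrow> l * (cmod z)^2 + u z \<le> a"
  shows "ennreal (exp (- b * (real N)^2 * a) * (pi / (l * (real N + 1))) ^ N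
      * (fact N * (\<Prod>k<N. exp (- 1) / l ^ k)) powr b)
    \<le> (\<integral>\<^sup>+ z. ennreal (gas_weight N b (\<lambda>w. real N * (l * (cmod w)^2)) z)
            * ennreal (exp (- b * (real N)^2 * linear_statistic N u z)) \<partial>lborel_power N)"
proof -
  interpret LP: product_sigma_finite "\<lambda>_. lborel :: complex measure" ..
  \<comment> \<open>The annulus q <= l |z|^2 <= 1 has area pi / (l (N + 1)), while q >= exp (-1 / N)
    keeps q^k above 1 / e for all k < N.\<close>
  define q where "q = real N / (real N + 1)"
  define T where "T = {q / l..1 / l}"
  define S where "S = {z. (cmod z)^2 \<in> T}"
  have [measurable]: "T \<in> sets borel" by (simp add: T_def)
  have [measurable]: "S \<in> sets borel" unfolding S_def by measurable
  have q: "0 < q" "q < 1" "1 - q = 1 / (real N + 1)" using N by (auto simp: q_def field_simps)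
  have mS: "emeasure lborel S = ennreal (pi / (l * (real N + 1)))"
  proof -
    have "T \<subseteq> {0..}"
      using l q by (auto simp: T_def intro: order_trans[OF divide_nonneg_pos[of q l]])
    then have "emeasure lborel S = ennreal pi * emeasure lborel T"
      unfolding S_def by (intro emeasure_radial_set) simp
    also have "emeasure lborel T = ennreal ((1 - q) / l)"
      using l q(1,2) by (simp add: T_def divide_right_mono diff_divide_distrib)
    finally show ?thesis
      unfolding q(3) using l by (simp add: ennreal_mult'[symmetric] mult.commute)
  qed
  have pS: "pi / (l * (real N + 1)) > 0" using l by simp
  have S_fin: "emeasure lborel S \<noteq> 0" "emeasure lborel S \<noteq> \<infinity>" using pS by (auto simp: mS)
  define U where "U = uniform_measure lborel S"
  have sU[measurable_cong]: "sets U = sets borel" by (simp add: U_def)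
  interpret U: prob_space U
    unfolding U_def using S_fin by (intro prob_space_uniform_measure) auto
  interpret UP: product_prob_space "\<lambda>_. U" "{..<N}" ..
  have AE_S: "AE z in U. z \<in> S"
    unfolding U_def using S_fin by (intro AE_uniform_measureI) auto
  let ?D = "\<lambda>z. vandermonde_square N z"
  let ?I = "\<integral>\<^sup>+ z. ennreal (?D z powr b) \<partial>(\<Pi>\<^sub>M i\<in>{..<N}. U)"
  let ?U = "\<Pi>\<^sub>M i\<in>{..<N}. U"
  have bdd: "AE z in U. cmod z \<le> sqrt (1 / l)"
    using AE_S by eventually_elim (auto simp: S_def T_def intro: real_le_rsqrt)
  have D: "has_bochner_integral ?U ?D (fact N * (\<Prod>k<N. LINT z|U. (cmod z)\<^sup>2 ^ k))"
    by (rule vandermonde_second_moment[OF U.prob_space_axioms sU bdd])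
       (unfold U_def S_def, rule rotation_invariant_uniform_measure, measurable)
  have moment: "exp (- 1) / l ^ k \<le> (LINT z|U. (cmod z)\<^sup>2 ^ k)" if "k < N" for k
  proof -
    have "integrable U (\<lambda>z. (cmod z)\<^sup>2 ^ k)"
    proof (rule U.integrable_const_bound)
      show "AE z in U. norm ((cmod z)\<^sup>2 ^ k) \<le> (1 / l) ^ k"
        using AE_S by eventually_elim (auto simp: S_def T_def norm_power intro!: power_mono)
    qed simp
    moreover have "AE z in U. (q / l) ^ k \<le> (cmod z)\<^sup>2 ^ k"
      using AE_S by eventually_elim (use q l in \<open>auto simp: S_def T_def intro!: power_mono\<close>)
    ultimately have "(q / l) ^ k \<le> (LINT z|U. (cmod z)\<^sup>2 ^ k)"
      using integral_mono_AE[of U "\<lambda>_. (q / l) ^ k" "\<lambda>z. (cmod z)\<^sup>2 ^ k"] U.prob_space by simp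
    moreover have "exp (- 1) \<le> q ^ k"
    proof -
      have "1 / q = 1 + 1 / real N" using N by (simp add: q_def field_simps)
      also have "\<dots> \<le> exp (1 / real N)" by (rule exp_ge_add_one_self)
      finally have "exp (- (1 / real N)) \<le> q"
        using q by (simp add: exp_minus field_simps)
      then have "exp (- (1 / real N)) ^ k \<le> q ^ k" by (intro power_mono) auto
      moreover have "exp (- (1 / real N)) ^ k = exp (- (real k / real N))"
        by (simp add: exp_of_nat_mult[symmetric])
      moreover have "real k / real N \<le> 1" using that by simp
      then have "exp (- 1) \<le> exp (- (real k / real N))" by simp
      ultimately show ?thesis by linarith
    qed
    then have "exp (- 1) / l ^ k \<le> (q / l) ^ k"
      using l by (simp add: power_divide divide_right_mono)
    ultimately show ?thesis by linarith
  qed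
  have "(fact N * (\<Prod>k<N. exp (- 1) / l ^ k)) powr b \<le> (LINT z|?U. ?D z) powr b"
    unfolding has_bochner_integral_integral_eq[OF D] using b l moment
    by (intro powr_mono2 mult_left_mono prod_mono) (auto intro!: mult_nonneg_nonneg prod_nonneg)
  also have "ennreal \<dots> \<le> ?I"
    using D b by (intro UP.P.power_mean_le_nn_integral) (auto simp: has_bochner_integral_iff intro!: prod_nonneg)
  finally have main: "ennreal ((fact N * (\<Prod>k<N. exp (- 1) / l ^ k)) powr b)
      \<le> ?I"
    by (simp add: ennreal_leI)
  have [measurable]: "(\<lambda>z. ?D z powr b) \<in> borel_measurable (lborel_power N)"
    by (intro powr_real_measurable borel_measurable_prod borel_measurable_power borel_measurable_norm borel_measurable_diff) auto
  let ?w = "\<lambda>z. \<Prod>i<N. indicator S (z i) / emeasure lborel S"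
  have dens: "?I
    = (\<integral>\<^sup>+ z. ?w z * ennreal (?D z powr b) \<partial>lborel_power N)"
    unfolding U_def using S_fin by (subst PiM_uniform_measure, simp_all) (subst nn_integral_density, auto)
  define v where "v = pi / (l * (real N + 1))"
  have v: "v > 0" "emeasure lborel S = ennreal v" using pS mS by (auto simp: v_def)
  \<comment> \<open>The factor \<open>v ^ N\<close> cancels the density (1 / v)^N of the uniform law
    on the N-fold product of the annulus.\<close>
  define e where "e = exp (- b * (real N)^2 * a) * v ^ N"
  let ?V = "\<lambda>w. real N * (l * (cmod w)^2)"
  have pointwise: "ennreal e * (?w z * ennreal (?D z powr b))
      \<le> ennreal (gas_weight N b ?V z) * ennreal (exp (- b * (real N)^2 * linear_statistic N u z))" for z
  proof (cases "\<forall>i<N. z i \<in> S")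
    case True
    have "(\<Sum>i<N. l * (cmod (z i))^2 + u (z i)) \<le> (\<Sum>i<N. a)"
    proof (intro sum_mono a)
      fix i assume "i \<in> {..<N}"
      then have "q / l \<le> (cmod (z i))^2" "(cmod (z i))^2 \<le> 1 / l" using True by (auto simp: S_def T_def)
      then have "q \<le> l * (cmod (z i))^2" "l * (cmod (z i))^2 \<le> 1"
        using l by (auto simp: field_simps)
      then show "real N / (real N + 1) \<le> l * (cmod (z i))^2" "l * (cmod (z i))^2 \<le> 1"
        by (simp_all add: q_def)
    qed
    then have "b * real N * (\<Sum>i<N. l * (cmod (z i))^2 + u (z i)) \<le> b * real N * (\<Sum>i<N. a)"
      using b by (intro mult_left_mono) auto
    then have le: "- b * (real N)^2 * a \<le> - b * real N * (\<Sum>i<N. l * (cmod (z i))^2 + u (z i))"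
      by (simp add: power2_eq_square mult_ac)
    have "gas_weight N b ?V z * exp (- b * (real N)^2 * linear_statistic N u z)
        = ?D z powr b * (exp (\<Sum>i<N. - b * ?V (z i)) * exp (- b * real N * (\<Sum>i<N. u (z i))))"
      unfolding gas_weight_def prod_powr_eq_vandermonde_powr using N
      by (simp add: exp_sum linear_statistic_def power2_eq_square mult_ac)
    also have "\<dots> = ?D z powr b * exp (- b * real N * (\<Sum>i<N. l * (cmod (z i))^2 + u (z i)))"
      by (simp add: exp_add[symmetric] sum.distrib sum_distrib_left distrib_left mult_ac sum_negf)
    also have "\<dots> \<ge> ?D z powr b * exp (- b * (real N)^2 * a)"
      using le by (intro mult_left_mono) auto
    finally have "?D z powr b * exp (- b * (real N)^2 * a)
        \<le> gas_weight N b ?V z * exp (- b * (real N)^2 * linear_statistic N u z)" .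
    moreover have "?w z = ennreal ((1 / v) ^ N)"
      using True v by (simp add: divide_ennreal[symmetric] ennreal_power[symmetric] flip: ennreal_1)
    moreover have "e * ((1 / v) ^ N * ?D z powr b) = ?D z powr b * exp (- b * (real N)^2 * a)"
      using v by (simp add: e_def power_divide)
    moreover have "ennreal e * (ennreal ((1 / v) ^ N) * ennreal (?D z powr b)) = ennreal (e * ((1 / v) ^ N * ?D z powr b))"
      using v by (simp only: ennreal_mult'' zero_le_power powr_ge_zero mult_nonneg_nonneg divide_nonneg_pos less_imp_le zero_le_one)
    ultimately show ?thesis
      by (simp only: ennreal_mult''[symmetric] exp_ge_zero ennreal_leI)
  next
    case False
    then obtain i where "i < N" "z i \<notin> S" by auto
    then have "?w z = 0"
      by (intro prod_zero bexI[of _ i]) auto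
    then show ?thesis by (simp only: mult_zero_left mult_zero_right zero_le)
  qed
  have "ennreal e * ennreal ((fact N * (\<Prod>k<N. exp (- 1) / l ^ k)) powr b)
    \<le> ennreal e * (\<integral>\<^sup>+ z. ?w z * ennreal (?D z powr b) \<partial>lborel_power N)"
    using main dens by (intro mult_left_mono) auto
  also have "\<dots> = (\<integral>\<^sup>+ z. ennreal e * (?w z * ennreal (?D z powr b)) \<partial>lborel_power N)"
    by (rule nn_integral_cmult[symmetric]) (intro borel_measurable_times_ennreal borel_measurable_prod, auto)
  also have "\<dots> \<le> (\<integral>\<^sup>+ z. ennreal (gas_weight N b ?V z) * ennreal (exp (- b * (real N)^2 * linear_statistic N u z)) \<partial>lborel_power N)"
    by (intro nn_integral_mono pointwise)
  finally show ?thesis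
    using v by (simp add: e_def v_def ennreal_mult'[symmetric])
qed

section \<open>Test functions and weak gradients\<close>

lemma C_diff_imp_continuous: "C_diff k v \<Longrightarrow> continuous_on UNIV v"
  by (cases k) (auto simp: continuous_on_eq_continuous_at intro: differentiable_imp_continuous_within)

lemma C_diff_Suc_imp: "C_diff (Suc k) v \<Longrightarrow> C_diff k v"
proof (induction k arbitrary: v)
  case 0
  then show ?case by (auto simp: continuous_on_eq_continuous_at intro: differentiable_imp_continuous_within)
next
  case (Suc k)
  then show ?case by (metis C_diff.simps(2))
qed

lemma C_diff_SucI:
  assumes "\<And>z. (v has_derivative v' z) (at z)" "\<And>b. C_diff k (\<lambda>z. v' z b)"
  shows "C_diff (Suc k) v"
proof -
  have "frechet_derivative v (at z) = v' z" for z
    using frechet_derivative_at[OF assms(1)] by simp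
  then show ?thesis using assms by (auto simp: differentiable_def)
qed

lemma C_diff_has_derivative:
  "C_diff (Suc k) v \<Longrightarrow> (v has_derivative frechet_derivative v (at z)) (at z)"
  by (simp add: frechet_derivative_works)

lemma C_diff_const: "C_diff k (\<lambda>_. c)"
proof (induction k arbitrary: c)
  case (Suc k)
  show ?case by (rule C_diff_SucI[where v' = "\<lambda>_ _. 0"]) (auto intro: Suc)
qed simp

lemma C_diff_inner: "C_diff k (\<lambda>z. z \<bullet> c)"
proof (cases k)
  case (Suc k')
  have "((\<lambda>z. z \<bullet> c) has_derivative (\<lambda>h. h \<bullet> c)) (at z)" for z
    by (auto intro!: derivative_eq_intros)
  then show ?thesis unfolding Suc by (rule C_diff_SucI) (rule C_diff_const)
qed (simp add: continuous_intros)

lemma C_diff_add: "C_diff k v \<Longrightarrow> C_diff k w \<Longrightarrow> C_diff k (\<lambda>z. v z + w z)"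
proof (induction k arbitrary: v w)
  case (Suc k)
  show ?case
    by (rule C_diff_SucI[OF has_derivative_add[OF C_diff_has_derivative[OF Suc.prems(1)] C_diff_has_derivative[OF Suc.prems(2)]]])
       (use Suc in auto)
qed (simp add: continuous_intros)

lemma C_diff_mult: "C_diff k v \<Longrightarrow> C_diff k w \<Longrightarrow> C_diff k (\<lambda>z. v z * w z)"
proof (induction k arbitrary: v w)
  case (Suc k)
  show ?case
    by (rule C_diff_SucI[OF has_derivative_mult[OF C_diff_has_derivative[OF Suc.prems(1)] C_diff_has_derivative[OF Suc.prems(2)]]])
       (use Suc.prems C_diff_Suc_imp[OF Suc.prems(1)] C_diff_Suc_imp[OF Suc.prems(2)] in \<open>auto intro!: C_diff_add Suc.IH\<close>)
qed (simp add: continuous_intros)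

text \<open>The outer function comes with all its derivatives as a sequence \<open>D\<close>, so
  that the chain rule stays within the family and the induction can pass from \<open>n\<close> to
  \<open>Suc n\<close>.\<close>

lemma C_diff_compose:
  assumes D: "\<And>n x. (D n has_real_derivative D (Suc n) x) (at x)"
  shows "C_diff k q \<Longrightarrow> C_diff k (\<lambda>z. D n (q z))"
proof (induction k arbitrary: n)
  case 0
  have "continuous_on UNIV (D n)"
    using D by (auto simp: continuous_on_eq_continuous_at intro: DERIV_isCont)
  then show ?case using 0 by (auto intro: continuous_on_compose2)
next
  case (Suc k)
  have "((\<lambda>z. D n (q z)) has_derivative (\<lambda>b. D (Suc n) (q z) * frechet_derivative q (at z) b)) (at z)" for z
    using has_derivative_compose[OF C_diff_has_derivative[OF Suc.prems] D[THEN has_field_derivative_imp_has_derivative]]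
    by (simp add: mult.commute)
  then show ?case
    by (rule C_diff_SucI) (use Suc.prems C_diff_Suc_imp[OF Suc.prems] in \<open>auto intro!: C_diff_mult Suc.IH\<close>)
qed

lemma test_functionsI:
  assumes "\<And>k. C_diff k v" "\<And>z. v z \<noteq> 0 \<Longrightarrow> z \<in> C" "compact C"
  shows "v \<in> test_functions"
proof -
  have "closure {z. v z \<noteq> 0} \<subseteq> C"
    by (intro closure_minimal compact_imp_closed assms(3)) (use assms(2) in auto)
  then have "compact (C \<inter> closure {z. v z \<noteq> 0})"
    by (intro compact_Int_closed assms) auto
  moreover have "C \<inter> closure {z. v z \<noteq> 0} = closure {z. v z \<noteq> 0}"
    using \<open>closure _ \<subseteq> C\<close> by auto
  ultimately show ?thesis using assms(1) by (simp add: test_functions_def)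
qed

section \<open>The smooth function exp (-1 / x) and its derivatives\<close>

primrec flat_poly :: "nat \<Rightarrow> real poly" where
  "flat_poly 0 = 1"
| "flat_poly (Suc n) = [:0, 0, 1:] * (flat_poly n - pderiv (flat_poly n))"

text \<open>The derivatives of the smooth function that is \<open>exp (- 1 / x)\<close> for \<open>x > 0\<close> and \<open>0\<close> elsewhere.\<close>

definition flat_deriv :: "nat \<Rightarrow> real \<Rightarrow> real" where
  "flat_deriv n x = (if x > 0 then poly (flat_poly n) (1 / x) * exp (- (1 / x)) else 0)"

lemma tendsto_poly_exp_neg: "((\<lambda>y. poly p y * exp (- y)) \<longlongrightarrow> (0::real)) at_top"
proof -
  have "((\<lambda>y. \<Sum>i\<le>degree p. coeff p i * (y ^ i / exp y)) \<longlongrightarrow> (\<Sum>i\<le>degree p. coeff p i * 0)) at_top"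
    by (intro tendsto_intros tendsto_power_div_exp_0)
  then show ?thesis
    by (simp add: poly_altdef sum_distrib_right exp_minus divide_inverse mult.assoc)
qed

lemma flat_deriv_has_derivative: "(flat_deriv n has_real_derivative flat_deriv (Suc n) x) (at x)"
proof -
  consider "x < 0" | "x = 0" | "x > 0" by linarith
  then show ?thesis
  proof cases
    case 1
    have "((\<lambda>_. 0) has_real_derivative 0) (at x)" by simp
    then have "(flat_deriv n has_real_derivative 0) (at x)"
      by (rule DERIV_cong_ev[THEN iffD1, rotated 3])
         (use 1 eventually_nhds_in_open[of "{..<0}" x] in \<open>auto simp: flat_deriv_def elim!: eventually_mono\<close>)
    then show ?thesis using 1 by (simp add: flat_deriv_def)
  next
    case 3
    \<comment> \<open>P(1/x) exp(-1/x) has derivative x^(-2) (P - P')(1/x) exp(-1/x), which is the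
      recursion of \<open>flat_poly\<close>.\<close>
    have "((\<lambda>x. poly (flat_poly n) (1 / x) * exp (- (1 / x))) has_real_derivative flat_deriv (Suc n) x) (at x)"
    proof -
      have "((\<lambda>x. poly (flat_poly n) (1 / x)) has_real_derivative poly (pderiv (flat_poly n)) (1 / x) * (- 1 / x^2)) (at x)"
        by (rule DERIV_chain2[OF poly_DERIV])
           (use 3 in \<open>auto intro!: derivative_eq_intros simp: power2_eq_square\<close>)
      moreover have "((\<lambda>x. exp (- (1 / x))) has_real_derivative exp (- (1 / x)) * (1 / x^2)) (at x)"
        using 3 by (auto intro!: derivative_eq_intros simp: power2_eq_square)
      ultimately show ?thesis
        by (rule DERIV_mult[THEN DERIV_cong])
           (use 3 in \<open>simp add: flat_deriv_def power2_eq_square field_simps\<close>)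
    qed
    then show ?thesis
      by (rule DERIV_cong_ev[THEN iffD1, rotated 3])
         (use 3 eventually_nhds_in_open[of "{0<..}" x] in \<open>auto simp: flat_deriv_def elim!: eventually_mono\<close>)
  next
    case 2
    \<comment> \<open>With y = 1 / h the difference quotient at 0 from the right is y P(y) exp(-y);
      \<open>pCons 0\<close> supplies the factor y.\<close>
    have "((\<lambda>y. poly (pCons 0 (flat_poly n)) y * exp (- y)) \<longlongrightarrow> 0) at_top"
      by (rule tendsto_poly_exp_neg)
    then have "((\<lambda>h. poly (pCons 0 (flat_poly n)) (inverse h) * exp (- inverse h)) \<longlongrightarrow> 0) (at_right 0)"
      by (rule filterlim_compose[OF _ filterlim_inverse_at_top_right])
    then have R: "((\<lambda>h. flat_deriv n h / h) \<longlongrightarrow> 0) (at_right 0)"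
      by (rule Lim_transform_eventually)
         (auto simp: flat_deriv_def divide_inverse mult_ac eventually_at_right_less intro: eventually_mono[OF eventually_at_right_less])
    have L: "((\<lambda>h. flat_deriv n h / h) \<longlongrightarrow> 0) (at_left 0)"
      by (rule Lim_transform_eventually[OF tendsto_const])
         (auto simp: flat_deriv_def eventually_at_filter)
    have "((\<lambda>h. flat_deriv n h / h) \<longlongrightarrow> 0) (at 0)"
      using L R by (simp add: filterlim_split_at)
    then show ?thesis using 2 by (simp add: has_field_derivative_iff flat_deriv_def)
  qed
qed

lemma flat_deriv_0: "flat_deriv 0 x = (if x > 0 then exp (- (1 / x)) else 0)"
  by (simp add: flat_deriv_def)

lemma flat_deriv_1: "flat_deriv 1 x = (if x > 0 then exp (- (1 / x)) / x^2 else 0)"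
  by (simp add: flat_deriv_def power2_eq_square)

lemmas C_diff_flat = C_diff_compose[of flat_deriv, OF flat_deriv_has_derivative]

section \<open>Integration by parts for test functions\<close>

lemma integrable_bounded_support:
  fixes f :: "complex \<Rightarrow> real"
  assumes [measurable]: "f \<in> borel_measurable borel" and "\<And>z. \<bar>f z\<bar> \<le> B" "\<And>z. cmod z > R \<Longrightarrow> f z = 0"
  shows "integrable lborel f"
proof (rule Bochner_Integration.integrable_bound[of lborel "\<lambda>z. B * indicator (cball 0 R) z"])
  show "integrable lborel (\<lambda>z. B * indicator (cball (0::complex) R) z)"
    using emeasure_lborel_cball_finite[of "0::complex" R] by (intro integrable_mult_right integrable_real_indicator) auto
  show "AE z in lborel. norm (f z) \<le> norm (B * indicator (cball 0 R) z)"
    using assms(2,3) by (auto simp: indicator_def not_le intro!: AE_I2 order_trans[OF assms(2)])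
qed simp

lemma test_function_bounds:
  assumes "v \<in> test_functions"
  obtains B R where "\<And>z. \<bar>v z\<bar> \<le> B" "\<And>z. cmod z > R \<Longrightarrow> v z = 0"
proof -
  define C where "C = closure {z. v z \<noteq> 0}"
  have C: "compact C" "continuous_on UNIV v"
    using assms C_diff_imp_continuous by (auto simp: test_functions_def C_def)
  obtain R where R: "\<And>z. z \<in> C \<Longrightarrow> cmod z \<le> R"
    using compact_imp_bounded[OF C(1)] by (auto simp: bounded_iff)
  have "compact (v ` C)"
    using C by (intro compact_continuous_image) (auto intro: continuous_on_subset)
  then obtain B where B: "\<And>z. z \<in> C \<Longrightarrow> \<bar>v z\<bar> \<le> B"
    using compact_imp_bounded[of "v ` C"] unfolding bounded_iff by auto
  have out: "v z = 0" if "z \<notin> C" for z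
    using that closure_subset[of "{z. v z \<noteq> 0}"] by (auto simp: C_def)
  show ?thesis
  proof (rule that[of "max B 0" R])
    show "\<bar>v z\<bar> \<le> max B 0" for z using B[of z] out[of z] by (cases "z \<in> C") auto
    show "cmod z > R \<Longrightarrow> v z = 0" for z using R[of z] out[of z] by auto
  qed
qed

lemma test_function_derivative:
  assumes "v \<in> test_functions"
  shows "(\<lambda>z. frechet_derivative v (at z) b) \<in> test_functions"
proof -
  define C where "C = closure {z. v z \<noteq> 0}"
  have C: "compact C" using assms by (simp add: test_functions_def C_def)
  have "C_diff (Suc k) v" for k using assms unfolding test_functions_def by blast
  then have "C_diff k (\<lambda>z. frechet_derivative v (at z) b)" for k by simp
  then show ?thesis
  proof (rule test_functionsI[OF _ _ C])
    fix z assume nz: "frechet_derivative v (at z) b \<noteq> 0"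
    show "z \<in> C"
    proof (rule ccontr)
      assume z: "z \<notin> C"
      have "((\<lambda>_. 0) has_derivative (\<lambda>_. 0)) (at z)" by simp
      then have "(v has_derivative (\<lambda>_. 0)) (at z)"
      proof (rule has_derivative_transform_within_open[where s = "- C"])
        show "0 = v w" if "w \<in> - C" for w
          using that closure_subset[of "{z. v z \<noteq> 0}"] by (auto simp: C_def)
      qed (use z compact_imp_closed[OF C] in auto)
      then have "frechet_derivative v (at z) = (\<lambda>_. 0)"
        by (rule frechet_derivative_at[symmetric])
      then show False using nz by simp
    qed
  qed
qed

lemma test_function_measurable [measurable_dest]:
  "v \<in> test_functions \<Longrightarrow> v \<in> borel_measurable borel"
  using C_diff_imp_continuous by (auto simp: test_functions_def intro: borel_measurable_continuous_onI)

lemma test_function_integrable: "v \<in> test_functions \<Longrightarrow> integrable lborel v"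
  by (metis integrable_bounded_support test_function_bounds test_function_measurable)

lemma test_function_has_derivative:
  "v \<in> test_functions \<Longrightarrow> (v has_derivative frechet_derivative v (at z)) (at z)"
  unfolding test_functions_def using C_diff_has_derivative[of 0 v z] by blast

lemma test_function_mult:
  assumes "v \<in> test_functions" "w \<in> test_functions"
  shows "(\<lambda>z. v z * w z) \<in> test_functions"
proof (rule test_functionsI)
  show "C_diff k (\<lambda>z. v z * w z)" for k
    using assms unfolding test_functions_def by (blast intro: C_diff_mult)
  show "compact (closure {z. v z \<noteq> 0})" using assms by (simp add: test_functions_def)
  show "z \<in> closure {z. v z \<noteq> 0}" if "v z * w z \<noteq> 0" for z
    using that closure_subset[of "{z. v z \<noteq> 0}"] by auto
qed

text \<open>Difference quotients integrate to \<open>0\<close> by translation invariance.\<close>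

lemma integral_test_function_derivative:
  assumes f: "f \<in> test_functions"
  shows "(LINT z|lborel. frechet_derivative f (at z) b) = 0"
proof -
  let ?D = "\<lambda>z. frechet_derivative f (at z) b"
  have [measurable]: "f \<in> borel_measurable borel" using f by measurable
  obtain B where B: "\<And>z. \<bar>?D z\<bar> \<le> B" using test_function_bounds[OF test_function_derivative[OF f]] by metis
  obtain R where R: "\<And>z. cmod z > R \<Longrightarrow> f z = 0" using test_function_bounds[OF f] by metis
  define t where "t n = inverse (real (Suc n))" for n
  have t: "0 < t n" "t n \<le> 1" for n by (auto simp: t_def field_simps)
  define d where "d n z = (f (z + t n *\<^sub>R b) - f z) / t n" for n z
  have line: "((\<lambda>s. f (z + s *\<^sub>R b)) has_real_derivative ?D (z + s *\<^sub>R b)) (at s)" for z s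
  proof -
    have "((\<lambda>s. z + s *\<^sub>R b) has_derivative (\<lambda>s. s *\<^sub>R b)) (at s)"
      by (auto intro!: derivative_eq_intros)
    from has_derivative_compose[OF this test_function_has_derivative[OF f]]
    have "((\<lambda>s. f (z + s *\<^sub>R b)) has_derivative (\<lambda>h. frechet_derivative f (at (z + s *\<^sub>R b)) (h *\<^sub>R b))) (at s)" .
    moreover have "(\<lambda>h. frechet_derivative f (at (z + s *\<^sub>R b)) (h *\<^sub>R b)) = (*) (?D (z + s *\<^sub>R b))"
      using linear_cmul[OF has_derivative_linear[OF test_function_has_derivative[OF f]]]
      by (simp add: fun_eq_iff mult.commute)
    ultimately show ?thesis
      by (simp add: has_field_derivative_def)
  qed
  have d_bound: "\<bar>d n z\<bar> \<le> B" for n z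
  proof -
    obtain s where "f (z + t n *\<^sub>R b) - f (z + 0 *\<^sub>R b) = (t n - 0) * ?D (z + s *\<^sub>R b)"
      using MVT2[of 0 "t n" "\<lambda>s. f (z + s *\<^sub>R b)" "\<lambda>s. ?D (z + s *\<^sub>R b)"] t line by blast
    then have "d n z = ?D (z + s *\<^sub>R b)" using t[of n] by (simp add: d_def)
    then show ?thesis using B by simp
  qed
  have d_lim: "(\<lambda>n. d n z) \<longlonglongrightarrow> ?D z" for z
  proof -
    have "((\<lambda>s. (f (z + s *\<^sub>R b) - f z) / s) \<longlongrightarrow> ?D z) (at 0)"
      using line[of z 0] by (simp add: has_field_derivative_iff)
    moreover have "filterlim t (at 0) sequentially"
      unfolding t_def[abs_def] filterlim_at using LIMSEQ_inverse_real_of_nat by simp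
    ultimately show ?thesis unfolding d_def by (rule filterlim_compose)
  qed
  \<comment> \<open>The shifts are no longer than |b|, as \<open>t n\<close> is at most 1, so all
    difference quotients vanish outside one ball of radius R + |b|.\<close>
  have "(\<lambda>n. LINT z|lborel. d n z) \<longlonglongrightarrow> (LINT z|lborel. ?D z)"
  proof (rule integral_dominated_convergence[where w = "\<lambda>z. B * indicator (cball (0::complex) (R + cmod b)) z"])
    show "?D \<in> borel_measurable lborel" using test_function_measurable[OF test_function_derivative[OF f]] by simp
    show "d n \<in> borel_measurable lborel" for n by (simp add: d_def[abs_def])
    show "integrable lborel (\<lambda>z. B * indicator (cball (0::complex) (R + cmod b)) z)"
      using emeasure_lborel_cball_finite[of "0::complex" "R + cmod b"] by (intro integrable_mult_right integrable_real_indicator) auto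
    show "AE z in lborel. norm (d n z) \<le> B * indicator (cball (0::complex) (R + cmod b)) z" for n
    proof (intro AE_I2)
      fix z
      show "norm (d n z) \<le> B * indicator (cball (0::complex) (R + cmod b)) z"
      proof (cases "cmod z \<le> R + cmod b")
        case False
        have "cmod z \<le> cmod (z + t n *\<^sub>R b) + cmod (t n *\<^sub>R b)"
          using norm_triangle_ineq4[of "z + t n *\<^sub>R b" "t n *\<^sub>R b"] by simp
        moreover have "cmod (t n *\<^sub>R b) \<le> cmod b" using t[of n] by (simp add: mult_left_le_one_le)
        ultimately have "cmod (z + t n *\<^sub>R b) > R" "cmod z > R" using False norm_ge_zero[of b] by linarith+
        then show ?thesis using R False by (simp add: d_def)
      qed (use d_bound in simp)
    qed
  qed (use d_lim in simp)
  moreover have "(LINT z|lborel. d n z) = 0" for n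
  proof -
    have T: "(\<lambda>z. z + t n *\<^sub>R b) \<in> lborel \<rightarrow>\<^sub>M borel" by simp
    have inv: "distr lborel borel (\<lambda>z. z + t n *\<^sub>R b) = lborel"
    proof -
      have "(\<lambda>z. z + t n *\<^sub>R b) = (+) (t n *\<^sub>R b)" by (simp add: fun_eq_iff)
      then show ?thesis by (simp add: lborel_distr_plus)
    qed
    have "integrable (distr lborel borel (\<lambda>z. z + t n *\<^sub>R b)) f"
      unfolding inv by (rule test_function_integrable[OF f])
    note integrable_distr[OF T this]
    moreover have "(LINT z|lborel. f (z + t n *\<^sub>R b)) = (LINT z|lborel. f z)"
      using integral_distr[OF T, of f] unfolding inv by simp
    ultimately show ?thesis using test_function_integrable[OF f] by (simp add: d_def)
  qed
  ultimately show ?thesis by (simp add: LIMSEQ_const_iff)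
qed

lemma test_function_integration_by_parts:
  assumes v: "v \<in> test_functions" and w: "w \<in> test_functions"
  shows "(LINT z|lborel. v z * frechet_derivative w (at z) b) = - (LINT z|lborel. frechet_derivative v (at z) b * w z)"
proof -
  have "frechet_derivative (\<lambda>z. v z * w z) (at z) b = v z * frechet_derivative w (at z) b + frechet_derivative v (at z) b * w z" for z
    using frechet_derivative_at[OF has_derivative_mult[OF test_function_has_derivative[OF v] test_function_has_derivative[OF w]], symmetric]
    by simp
  moreover have "integrable lborel (\<lambda>z. v z * frechet_derivative w (at z) b)" "integrable lborel (\<lambda>z. frechet_derivative v (at z) b * w z)"
    by (intro test_function_integrable test_function_mult test_function_derivative v w)+
  ultimately show ?thesis
    using integral_test_function_derivative[OF test_function_mult[OF v w], of b] by simp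
qed

section \<open>Uniqueness of weak gradients\<close>

definition box_bump :: "complex \<Rightarrow> complex \<Rightarrow> nat \<Rightarrow> complex \<Rightarrow> real" where
  "box_bump l u n z =
     flat_deriv 0 (real (Suc n) * ((z \<bullet> 1 - l \<bullet> 1) * (u \<bullet> 1 - z \<bullet> 1)))
     * flat_deriv 0 (real (Suc n) * ((z \<bullet> \<i> - l \<bullet> \<i>) * (u \<bullet> \<i> - z \<bullet> \<i>)))"

lemma flat_deriv_0_bounds: "0 \<le> flat_deriv 0 x" "flat_deriv 0 x \<le> 1"
  by (auto simp: flat_deriv_0)

lemma tendsto_flat_deriv_0:
  "(\<lambda>n. flat_deriv 0 (real (Suc n) * x)) \<longlonglongrightarrow> (if x > 0 then 1 else 0)"
proof (cases "x > 0")
  case True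
  have "(\<lambda>n. exp (- (inverse (real (Suc n)) * (1 / x)))) \<longlonglongrightarrow> exp (- (0 * (1 / x)))"
    by (intro tendsto_intros LIMSEQ_inverse_real_of_nat)
  moreover have "flat_deriv 0 (real (Suc n) * x) = exp (- (inverse (real (Suc n)) * (1 / x)))" for n
    using True by (simp add: flat_deriv_0 divide_inverse mult.commute del: of_nat_Suc)
  ultimately show ?thesis using True by simp
next
  case False
  then show ?thesis by (simp add: flat_deriv_0 zero_less_mult_iff)
qed

lemma product_pos_iff_between: "(a::real) \<le> b \<Longrightarrow> (x - a) * (b - x) > 0 \<longleftrightarrow> a < x \<and> x < b"
  by (auto simp: zero_less_mult_iff)

lemma C_diff_diff: "C_diff k v \<Longrightarrow> C_diff k w \<Longrightarrow> C_diff k (\<lambda>z. v z - w z)"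
  using C_diff_add[OF _ C_diff_mult[OF C_diff_const[of k "-1"]], of v w] by simp

text \<open>In each coordinate the quadratic factor is positive exactly between the edges, and exp
  (-1 / (n x)) tends to 1 for x > 0. The order of the edges matters: with reversed edges the factor
  is positive between them although the box is empty.\<close>

lemma box_bump_properties:
  assumes "\<And>b. b \<in> Basis \<Longrightarrow> l \<bullet> b \<le> u \<bullet> b"
  shows "box_bump l u n \<in> test_functions"
    and "0 \<le> box_bump l u n z" "box_bump l u n z \<le> 1"
    and "z \<notin> box l u \<Longrightarrow> box_bump l u n z = 0"
    and "(\<lambda>n. box_bump l u n z) \<longlonglongrightarrow> indicator (box l u) z"
proof -
  let ?x = "\<lambda>z. (z \<bullet> 1 - l \<bullet> 1) * (u \<bullet> 1 - z \<bullet> 1)" and ?y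
      = "\<lambda>z. (z \<bullet> \<i> - l \<bullet> \<i>) * (u \<bullet> \<i> - z \<bullet> \<i>)"
  have le: "l \<bullet> 1 \<le> u \<bullet> 1" "l \<bullet> \<i> \<le> u \<bullet> \<i>" by (rule assms, simp add: Basis_complex_def)+
  have box: "z \<in> box l u \<longleftrightarrow> ?x z > 0 \<and> ?y z > 0" for z
    unfolding product_pos_iff_between[OF le(1)] product_pos_iff_between[OF le(2)]
    by (auto simp: mem_box Basis_complex_def)
  show out: "z \<notin> box l u \<Longrightarrow> box_bump l u n z = 0" for z n
    unfolding box box_bump_def by (auto simp: flat_deriv_0 zero_less_mult_iff)
  show "box_bump l u n \<in> test_functions"
    unfolding box_bump_def
  proof (rule test_functionsI)
    show "C_diff k (\<lambda>z. flat_deriv 0 (real (Suc n) * ?x z)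
       * flat_deriv 0 (real (Suc n) * ?y z))" for k
      by (intro C_diff_mult C_diff_flat C_diff_diff C_diff_const C_diff_inner)
    show "z \<in> cbox l u"
      if "flat_deriv 0 (real (Suc n) * ?x z)
       * flat_deriv 0 (real (Suc n) * ?y z) \<noteq> 0" for z
      using that out[of z n] box_subset_cbox[of l u] unfolding box_bump_def by blast
  qed (rule compact_cbox)
  show "0 \<le> box_bump l u n z" "box_bump l u n z \<le> 1"
    using flat_deriv_0_bounds by (auto simp: box_bump_def mult_le_one)
  show "(\<lambda>n. box_bump l u n z) \<longlonglongrightarrow> indicator (box l u) z"
    using tendsto_mult[OF tendsto_flat_deriv_0[of "?x z"] tendsto_flat_deriv_0[of "?y z"]]
    unfolding box_bump_def indicator_def box by (auto split: if_splits)
qed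

text \<open>The positive and the negative part of \<open>w\<close> are densities of measures that
  agree on all boxes, hence everywhere. So the two parts coincide almost everywhere, and as one of
  them is always 0, both are.\<close>

lemma AE_zero_of_box_integrals:
  fixes w :: "'a::euclidean_space \<Rightarrow> real"
  assumes [measurable]: "w \<in> borel_measurable borel"
    and int: "\<And>l u. set_integrable lborel (box l u) w"
    and zero: "\<And>l u. (\<And>b. b \<in> Basis \<Longrightarrow> l \<bullet> b
        \<le> u \<bullet> b) \<Longrightarrow> (LINT z:box l u|lborel. w z) = 0"
  shows "AE z in lborel. w z = 0"
proof -
  define P where "P = density lborel (\<lambda>z. ennreal (w z))"
  define Q where "Q = density lborel (\<lambda>z. ennreal (- w z))"
  have i: "integrable lborel (\<lambda>z. indicator (box l u) z * w z)" for l u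
    using int[of l u] by (simp add: set_integrable_def)
  have density: "emeasure (density lborel (\<lambda>z. ennreal (f z))) (box l u)
      = ennreal (LINT z|lborel. max 0 (indicator (box l u) z * f z))"
    if [measurable]: "f \<in> borel_measurable borel"
      and "integrable lborel (\<lambda>z. indicator (box l u) z * f z)" for f :: "'a \<Rightarrow> real" and l u
  proof -
    have "emeasure (density lborel (\<lambda>z. ennreal (f z))) (box l u)
        = (\<integral>\<^sup>+ z. ennreal (max 0 (indicator (box l u) z * f z)) \<partial>lborel)"
      by (subst emeasure_density)
        (auto intro!: nn_integral_cong split: split_indicator simp: max_def ennreal_neg)
    also have "\<dots> = ennreal (LINT z|lborel. max 0 (indicator (box l u) z * f z))"
      using that(2) by (intro nn_integral_eq_integral) auto
    finally show ?thesis .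
  qed
  have P: "emeasure P (box l u) = ennreal (LINT z|lborel. max 0 (indicator (box l u) z * w z))" for l u
    unfolding P_def by (rule density[OF _ i]) simp
  have Q: "emeasure Q (box l u) = ennreal (LINT z|lborel. max 0 (indicator (box l u) z * - w z))" for l u
    unfolding Q_def by (rule density) (use i[of l u] in simp_all)
  have eq: "emeasure P (box l u) = emeasure Q (box l u)" for l u :: 'a
  proof (cases "\<forall>b\<in>Basis. l \<bullet> b \<le> u \<bullet> b")
    case True
    have "(LINT z|lborel. max 0 (indicator (box l u) z * w z)) - (LINT z|lborel. max 0 (indicator (box l u) z * - w z))
       = (LINT z|lborel. max 0 (indicator (box l u) z * w z) - max 0 (indicator (box l u) z * - w z))"
      using i[of l u] by (intro Bochner_Integration.integral_diff[symmetric]) auto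
    also have "\<dots> = (LINT z|lborel. indicator (box l u) z * w z)"
      by (intro Bochner_Integration.integral_cong) auto
    also have "\<dots> = 0"
      using zero[of l u] True by (simp add: set_lebesgue_integral_def)
    finally show ?thesis unfolding P Q by simp
  next
    case False
    then have "box l u = {}" by (auto simp: box_eq_empty not_le intro: less_imp_le)
    then show ?thesis by simp
  qed
  have "P = Q"
  proof (rule measure_eqI_generator_eq)
    let ?E = "range (\<lambda>(a, b). box a b::'a set)"
    show "Int_stable ?E" by (auto simp: Int_stable_def box_Int_box)
    show "?E \<subseteq> Pow UNIV" "sets P = sigma_sets UNIV ?E" "sets Q = sigma_sets UNIV ?E"
      by (simp_all add: borel_eq_box P_def Q_def)
    let ?A = "\<lambda>n::nat. box (- (real n *\<^sub>R One)) (real n *\<^sub>R One) :: 'a set"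
    show "range ?A \<subseteq> ?E" "(\<Union>i. ?A i) = UNIV" unfolding UN_box_eq_UNIV by auto
    show "emeasure P (?A i) \<noteq> \<infinity>" for i unfolding P by simp
    show "emeasure P X = emeasure Q X" if "X \<in> ?E" for X using that eq by auto
  qed
  then have "AE z in lborel. ennreal (w z) = ennreal (- w z)"
    unfolding P_def Q_def by (intro sigma_finite_measure.density_unique[OF sigma_finite_lborel]) auto
  then show ?thesis
  proof eventually_elim
    case (elim z)
    then show ?case by (cases "w z \<ge> 0") (auto simp: ennreal_neg ennreal_eq_0_iff dest: sym)
  qed
qed

lemma square_integrable_mult_integrable:
  fixes f g :: "'a \<Rightarrow> real"
  assumes [measurable]: "f \<in> borel_measurable M" "g \<in> borel_measurable M"
    and "integrable M (\<lambda>x. (f x)^2)" "integrable M (\<lambda>x. (g x)^2)"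
  shows "integrable M (\<lambda>x. f x * g x)"
proof (rule Bochner_Integration.integrable_bound[of M "\<lambda>x. (f x)^2 + (g x)^2"])
  show "AE x in M. norm (f x * g x) \<le> norm ((f x)^2 + (g x)^2)"
  proof (intro AE_I2)
    fix x
    have "2 * (\<bar>f x\<bar> * \<bar>g x\<bar>) \<le> (f x)^2 + (g x)^2"
      using sum_squares_bound[of "\<bar>f x\<bar>" "\<bar>g x\<bar>"] by simp
    moreover have "0 \<le> \<bar>f x\<bar> * \<bar>g x\<bar>" by simp
    ultimately have "\<bar>f x\<bar> * \<bar>g x\<bar> \<le> (f x)^2 + (g x)^2" by linarith
    then show "norm (f x * g x) \<le> norm ((f x)^2 + (g x)^2)" by (simp add: abs_mult)
  qed
qed (use assms in auto)

lemma L2_inner_integrable: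
  fixes g :: "complex \<Rightarrow> complex"
  assumes [measurable]: "g \<in> borel_measurable borel" and "integrable lborel (\<lambda>z. (norm (g z))^2)"
    and b: "b \<in> Basis"
  shows "integrable lborel (\<lambda>z. (g z \<bullet> b)^2)"
proof (rule Bochner_Integration.integrable_bound[OF assms(2)])
  show "AE z in lborel. norm ((g z \<bullet> b)^2) \<le> norm ((norm (g z))^2)"
    using Basis_le_norm[OF b] by (auto intro!: AE_I2 power_mono simp: abs_le_square_iff[symmetric])
qed simp

text \<open>Testing the difference of the gradients against bumps that converge to the indicator of
  a box shows that its components have integral 0 over every box.\<close>

lemma L2_weak_gradient_unique:
  assumes g: "L2_weak_gradient u g" and h: "L2_weak_gradient u h"
  shows "AE z in lborel. g z = h z"
proof -
  have [measurable]: "g \<in> borel_measurable borel" "h \<in> borel_measurable borel"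
    using g h by (auto simp: L2_weak_gradient_def)
  have comp: "AE z in lborel. (g z - h z) \<bullet> b = 0" if b: "b \<in> Basis" for b
  proof (rule AE_zero_of_box_integrals)
    have sq: "integrable lborel (\<lambda>z. (g z \<bullet> b)^2)" "integrable lborel (\<lambda>z. (h z \<bullet> b)^2)"
      using g h b by (auto simp: L2_weak_gradient_def intro: L2_inner_integrable)
    have mult: "integrable lborel (\<lambda>z. (g z \<bullet> b) * v z)" "integrable lborel (\<lambda>z. (h z \<bullet> b) * v z)"
      if [measurable]: "v \<in> borel_measurable borel" and "integrable lborel (\<lambda>z. (v z)^2)" for v
      using sq that by (auto intro: square_integrable_mult_integrable)
    have box_int: "integrable lborel (\<lambda>z. (indicator (box l u) z)^2 :: real)" for l u :: complex
    proof -
      have "(\<lambda>z. (indicator (box l u) z)^2 :: real) = indicator (box l u)"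
        by (auto simp: indicator_def)
      then show ?thesis using emeasure_lborel_box_finite[of l u] by (simp add: integrable_real_indicator)
    qed
    show int: "set_integrable lborel (box l u) (\<lambda>z. (g z - h z) \<bullet> b)" for l u
      using mult[OF _ box_int[of l u]] by (auto simp: set_integrable_def inner_diff_left mult.commute right_diff_distrib)
    fix l u :: complex assume le: "\<And>b. b \<in> Basis \<Longrightarrow> l \<bullet> b \<le> u \<bullet> b"
    note bump = box_bump_properties[OF le]
    have [measurable]: "box_bump l u n \<in> borel_measurable borel" for n
      using bump(1) by measurable
    have "(LINT z|lborel. ((g z - h z) \<bullet> b) * box_bump l u n z) = 0" for n
    proof -
      have "integrable lborel (\<lambda>z. (box_bump l u n z)^2)"
        unfolding power2_eq_square by (intro test_function_integrable test_function_mult bump(1) le)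
      then have "(LINT z|lborel. ((g z - h z) \<bullet> b) * box_bump l u n z)
        = (LINT z|lborel. (g z \<bullet> b) * box_bump l u n z) - (LINT z|lborel. (h z \<bullet> b) * box_bump l u n z)"
        by (simp add: inner_diff_left left_diff_distrib mult)
      also have "\<dots> = 0"
        using g h b bump(1) by (auto simp: L2_weak_gradient_def)
      finally show ?thesis .
    qed
    moreover have "(\<lambda>n. LINT z|lborel. ((g z - h z) \<bullet> b) * box_bump l u n z)
      \<longlonglongrightarrow> (LINT z|lborel. ((g z - h z) \<bullet> b) * indicator (box l u) z)"
    proof (rule integral_dominated_convergence[where w = "\<lambda>z. \<bar>((g z - h z) \<bullet> b) * indicator (box l u) z\<bar>"])
      show "integrable lborel (\<lambda>z. \<bar>((g z - h z) \<bullet> b) * indicator (box l u) z\<bar>)"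
        using int[of l u] by (auto simp: set_integrable_def mult.commute)
      show "AE z in lborel. (\<lambda>n. ((g z - h z) \<bullet> b) * box_bump l u n z)
          \<longlonglongrightarrow> ((g z - h z) \<bullet> b) * indicator (box l u) z"
        by (intro AE_I2 tendsto_intros bump(5) le)
      show "AE z in lborel. norm (((g z - h z) \<bullet> b) * box_bump l u n z)
          \<le> \<bar>((g z - h z) \<bullet> b) * indicator (box l u) z\<bar>" for n
      proof (intro AE_I2)
        fix z
        have "\<bar>box_bump l u n z\<bar> \<le> \<bar>indicator (box l u) z\<bar>"
          using bump(2,3)[of n z] bump(4)[of z n] by (auto simp: indicator_def)
        then show "norm (((g z - h z) \<bullet> b) * box_bump l u n z) \<le> \<bar>((g z - h z) \<bullet> b) * indicator (box l u) z\<bar>"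
          by (simp add: abs_mult mult_left_mono)
      qed
    qed simp_all
    ultimately have "(LINT z|lborel. ((g z - h z) \<bullet> b) * indicator (box l u) z) = 0"
      by (simp add: LIMSEQ_const_iff)
    then show "(LINT z:box l u|lborel. (g z - h z) \<bullet> b) = 0"
      by (simp add: set_lebesgue_integral_def mult.commute)
  qed simp
  have "AE z in lborel. \<forall>b\<in>Basis. (g z - h z) \<bullet> b = 0"
    using comp by (intro AE_finite_allI) auto
  then show ?thesis
  proof eventually_elim
    case (elim z)
    then have "g z - h z = 0" using euclidean_eqI[of "g z - h z" 0] by auto
    then show ?case by simp
  qed
qed

text \<open>Replaces the arbitrary choice made by \<open>weak_gradient\<close> with an explicitly
  known gradient in the integrals of \<open>H1_tendsto\<close>.\<close>

lemma weak_gradient_AE: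
  assumes "L2_weak_gradient u g"
  shows "weak_gradient u \<in> borel_measurable borel" "AE z in lborel. weak_gradient u z = g z"
proof -
  have "L2_weak_gradient u (weak_gradient u)"
    unfolding weak_gradient_def using assms someI_ex[of "L2_weak_gradient u"] by blast
  then show "weak_gradient u \<in> borel_measurable borel" "AE z in lborel. weak_gradient u z = g z"
    using L2_weak_gradient_unique[OF _ assms] by (auto simp: L2_weak_gradient_def)
qed

section \<open>Limits of test functions in the H1-topology\<close>

lemma integrable_indicator_cball: "integrable lborel (\<lambda>z. c * indicator (cball (0::complex) R) z :: real)"
  using emeasure_lborel_cball_finite[of "0::complex" R]
  by (intro integrable_mult_right integrable_real_indicator) auto

lemma bounded_imp_L2loc:
  assumes [measurable]: "u \<in> borel_measurable borel" and "\<And>z. \<bar>u z\<bar> \<le> B"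
  shows "u \<in> L2loc"
  unfolding L2loc_def
proof (safe intro!: assms(1))
  fix K :: "complex set" assume "compact K"
  then obtain R where R: "K \<subseteq> cball 0 R" using compact_imp_bounded[of K] unfolding bounded_iff by (auto simp: subset_iff)
  have [measurable]: "K \<in> sets borel" using \<open>compact K\<close> by (simp add: borel_compact)
  show "set_integrable lborel K (\<lambda>z. (u z)^2)"
    unfolding set_integrable_def
  proof (rule integrable_bounded_support)
    show "\<bar>indicator K z *\<^sub>R (u z)^2\<bar> \<le> B^2" for z
      using assms(2)[of z] power_mono[OF assms(2)[of z], of 2] by (auto simp: indicator_def)
    show "indicator K z *\<^sub>R (u z)^2 = 0" if "cmod z > R" for z
      using that R by (auto simp: indicator_def)
  qed measurable
qed

text \<open>Pointwise convergence with uniform bounds, and a common bounded support of the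
  gradients, let dominated convergence prove that the limit \<open>u\<close> lies in
  \<open>H1\<close> and that \<open>X\<close> converges to it there. This fixes the value at
  \<open>u\<close> of every continuous extension. \<open>G\<close> and \<open>g\<close> are the
  gradients of the \<open>X n\<close> and the weak gradient of \<open>u\<close>.\<close>

locale H1_approximation =
  fixes X :: "nat \<Rightarrow> complex \<Rightarrow> real" and G :: "nat \<Rightarrow> complex \<Rightarrow> complex"
    and u :: "complex \<Rightarrow> real" and g :: "complex \<Rightarrow> complex" and B R :: real
  assumes X: "\<And>n. X n \<in> test_functions"
    and XG: "\<And>n z b. frechet_derivative (X n) (at z) b = G n z \<bullet> b"
    and G_measurable: "\<And>n. G n \<in> borel_measurable borel"
    and X_bound: "\<And>n z. \<bar>X n z\<bar> \<le> B" and G_bound: "\<And>n z. cmod (G n z) \<le> B"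
    and G_support: "\<And>n z. cmod z > R \<Longrightarrow> G n z = 0"
    and X_lim: "\<And>z. (\<lambda>n. X n z) \<longlonglongrightarrow> u z" and G_lim: "\<And>z. (\<lambda>n. G n z) \<longlonglongrightarrow> g z"
begin

lemma measurables [measurable]:
  "X n \<in> borel_measurable borel" "G n \<in> borel_measurable borel"
  "u \<in> borel_measurable borel" "g \<in> borel_measurable borel"
proof -
  show X': "X n \<in> borel_measurable borel" for n using X by measurable
  show "G n \<in> borel_measurable borel" by (rule G_measurable)
  show "u \<in> borel_measurable borel" by (rule borel_measurable_LIMSEQ_metric[OF X' X_lim])
  show "g \<in> borel_measurable borel" by (rule borel_measurable_LIMSEQ_metric[OF G_measurable G_lim])
qed

lemma limit_bounds: "\<bar>u z\<bar> \<le> B" "cmod (g z) \<le> B" "cmod z > R \<Longrightarrow> g z = 0"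
proof -
  show "\<bar>u z\<bar> \<le> B" by (rule LIMSEQ_le_const2[OF tendsto_rabs[OF X_lim]]) (use X_bound in auto)
  show "cmod (g z) \<le> B" by (rule LIMSEQ_le_const2[OF tendsto_norm[OF G_lim]]) (use G_bound in auto)
  show "cmod z > R \<Longrightarrow> g z = 0" using G_lim[of z] G_support[of z] by (simp add: LIMSEQ_const_iff)
qed

lemma weak_gradient_X: "L2_weak_gradient (X n) (G n)"
  unfolding L2_weak_gradient_def
proof (intro conjI ballI)
  show "integrable lborel (\<lambda>z. (norm (G n z))^2)"
    by (rule integrable_bounded_support[where B = "B^2" and R = R])
       (use G_bound G_support in \<open>auto intro: power_mono\<close>)
  fix v :: "complex \<Rightarrow> real" and b :: complex assume "v \<in> test_functions"
  then show "(LINT z|lborel. X n z * frechet_derivative v (at z) b) = - (LINT z|lborel. (G n z \<bullet> b) * v z)"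
    using test_function_integration_by_parts[OF X] by (simp add: XG)
qed measurable

lemma weak_gradient_u: "L2_weak_gradient u g"
  unfolding L2_weak_gradient_def
proof (intro conjI ballI)
  show "integrable lborel (\<lambda>z. (norm (g z))^2)"
    by (rule integrable_bounded_support[where B = "B^2" and R = R])
       (use limit_bounds in \<open>auto intro: power_mono\<close>)
  fix v :: "complex \<Rightarrow> real" and b :: complex assume v: "v \<in> test_functions" and b: "b \<in> Basis"
  let ?D = "\<lambda>z. frechet_derivative v (at z) b"
  have [measurable]: "v \<in> borel_measurable borel" "?D \<in> borel_measurable borel"
    using v test_function_derivative[OF v] by (auto intro: test_function_measurable)
  have "(\<lambda>n. LINT z|lborel. X n z * ?D z) \<longlonglongrightarrow> (LINT z|lborel. u z * ?D z)"
  proof (rule integral_dominated_convergence[where w = "\<lambda>z. B * \<bar>?D z\<bar>"])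
    show "integrable lborel (\<lambda>z. B * \<bar>?D z\<bar>)"
      by (intro integrable_mult_right integrable_abs test_function_integrable test_function_derivative v)
    show "AE z in lborel. (\<lambda>n. X n z * ?D z) \<longlonglongrightarrow> u z * ?D z"
      by (intro AE_I2 tendsto_intros X_lim)
    show "AE z in lborel. norm (X n z * ?D z) \<le> B * \<bar>?D z\<bar>" for n
      by (intro AE_I2) (auto simp: abs_mult intro!: mult_right_mono X_bound)
  qed simp_all
  moreover have "(\<lambda>n. - (LINT z|lborel. (G n z \<bullet> b) * v z)) \<longlonglongrightarrow> - (LINT z|lborel. (g z \<bullet> b) * v z)"
  proof (intro tendsto_minus integral_dominated_convergence[where w = "\<lambda>z. B * \<bar>v z\<bar>"])
    show "integrable lborel (\<lambda>z. B * \<bar>v z\<bar>)"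
      by (intro integrable_mult_right integrable_abs test_function_integrable v)
    show "AE z in lborel. (\<lambda>n. (G n z \<bullet> b) * v z) \<longlonglongrightarrow> (g z \<bullet> b) * v z"
      by (intro AE_I2 tendsto_intros G_lim)
    show "AE z in lborel. norm ((G n z \<bullet> b) * v z) \<le> B * \<bar>v z\<bar>" for n
      using Basis_le_norm[OF b] G_bound
      by (intro AE_I2) (auto simp: abs_mult intro!: mult_right_mono intro: order_trans)
  qed simp_all
  moreover have "(LINT z|lborel. X n z * ?D z) = - (LINT z|lborel. (G n z \<bullet> b) * v z)" for n
    using weak_gradient_X[of n] v b by (auto simp: L2_weak_gradient_def)
  ultimately show "(LINT z|lborel. u z * ?D z) = - (LINT z|lborel. (g z \<bullet> b) * v z)"
    using LIMSEQ_unique by auto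
qed measurable

lemma in_H1: "X n \<in> H1" "u \<in> H1"
  unfolding H1_def using weak_gradient_X weak_gradient_u
  by (auto intro!: bounded_imp_L2loc[where B = B] X_bound limit_bounds)

lemma H1_tendsto: "H1_tendsto X u"
  unfolding H1_tendsto_def
proof (intro conjI allI impI)
  fix K :: "complex set" assume "compact K"
  then obtain r where r: "K \<subseteq> cball 0 r" using compact_imp_bounded[of K] unfolding bounded_iff by (auto simp: subset_iff)
  have [measurable]: "K \<in> sets borel" using \<open>compact K\<close> by (simp add: borel_compact)
  have "(\<lambda>n. LINT z|lborel. indicator K z *\<^sub>R (X n z - u z)^2) \<longlonglongrightarrow> (LINT z|(lborel::complex measure). 0)"
  proof (rule integral_dominated_convergence[where w = "\<lambda>z. (2 * B)^2 * indicator (cball (0::complex) r) z"])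
    show "AE z in lborel. (\<lambda>n. indicator K z *\<^sub>R (X n z - u z)^2) \<longlonglongrightarrow> 0"
    proof (intro AE_I2)
      fix z
      have "(\<lambda>n. indicator K z *\<^sub>R (X n z - u z)^2) \<longlonglongrightarrow> indicator K z *\<^sub>R (u z - u z)^2"
        by (intro tendsto_intros X_lim)
      then show "(\<lambda>n. indicator K z *\<^sub>R (X n z - u z)^2) \<longlonglongrightarrow> 0" by simp
    qed
    show "integrable lborel (\<lambda>z. (2 * B)^2 * indicator (cball (0::complex) r) z)"
      by (rule integrable_indicator_cball)
    show "AE z in lborel. norm (indicator K z *\<^sub>R (X n z - u z)^2) \<le> (2 * B)^2 * indicator (cball (0::complex) r) z" for n
    proof (intro AE_I2)
      fix z
      have "\<bar>X n z - u z\<bar> \<le> 2 * B" using X_bound[of n z] limit_bounds(1)[of z] by linarith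
      from power_mono[OF this abs_ge_zero, of 2]
      have "(X n z - u z)^2 \<le> (2 * B)^2" by (simp only: power2_abs)
      then show "norm (indicator K z *\<^sub>R (X n z - u z)^2) \<le> (2 * B)^2 * indicator (cball (0::complex) r) z"
        using r by (auto simp: indicator_def)
    qed
  qed simp_all
  then show "(\<lambda>n. LINT z:K|lborel. (X n z - u z)^2) \<longlonglongrightarrow> 0"
    by (simp add: set_lebesgue_integral_def)
next
  note [measurable] = weak_gradient_AE(1)[OF weak_gradient_X] weak_gradient_AE(1)[OF weak_gradient_u]
  have "(\<lambda>n. LINT z|lborel. (norm (weak_gradient (X n) z - weak_gradient u z))^2)
    = (\<lambda>n. LINT z|lborel. (norm (G n z - g z))^2)"
  proof
    fix n
    have "AE z in lborel. (norm (weak_gradient (X n) z - weak_gradient u z))^2 = (norm (G n z - g z))^2"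
      using weak_gradient_AE(2)[OF weak_gradient_X[of n]] weak_gradient_AE(2)[OF weak_gradient_u]
      by eventually_elim simp
    then show "(LINT z|lborel. (norm (weak_gradient (X n) z - weak_gradient u z))^2) = (LINT z|lborel. (norm (G n z - g z))^2)"
      by (intro integral_cong_AE) auto
  qed
  moreover have "(\<lambda>n. LINT z|lborel. (norm (G n z - g z))^2) \<longlonglongrightarrow> (LINT z|(lborel::complex measure). 0)"
  proof (rule integral_dominated_convergence[where w = "\<lambda>z. (2 * B)^2 * indicator (cball (0::complex) R) z"])
    show "AE z in lborel. (\<lambda>n. (norm (G n z - g z))^2) \<longlonglongrightarrow> 0"
    proof (intro AE_I2)
      fix z
      have "(\<lambda>n. (norm (G n z - g z))^2) \<longlonglongrightarrow> (norm (g z - g z))^2"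
        by (intro tendsto_intros G_lim)
      then show "(\<lambda>n. (norm (G n z - g z))^2) \<longlonglongrightarrow> 0" by simp
    qed
    show "integrable lborel (\<lambda>z. (2 * B)^2 * indicator (cball (0::complex) R) z)"
      by (rule integrable_indicator_cball)
    show "AE z in lborel. norm ((norm (G n z - g z))^2) \<le> (2 * B)^2 * indicator (cball (0::complex) R) z" for n
    proof (intro AE_I2)
      fix z
      have "cmod (G n z - g z) \<le> 2 * B"
        using norm_triangle_ineq4[of "G n z" "g z"] G_bound[of n z] limit_bounds(2)[of z] by linarith
      then have "(cmod (G n z - g z))^2 \<le> (2 * B)^2" by (intro power_mono) auto
      then show "norm ((norm (G n z - g z))^2) \<le> (2 * B)^2 * indicator (cball (0::complex) R) z"
        using G_support[of z n] limit_bounds(3)[of z] by (cases "cmod z > R") (auto simp: indicator_def)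
    qed
  qed simp_all
  ultimately show "(\<lambda>n. LINT z|lborel. (norm (weak_gradient (X n) z - weak_gradient u z))^2) \<longlonglongrightarrow> 0" by simp
qed

text \<open>An extension agrees with the integral on the test functions \<open>X n\<close>; along
  them it tends to its value at \<open>u\<close> by continuity, and the integrals tend to the
  integral of \<open>u\<close> by dominated convergence.\<close>

lemma pairing_eq:
  assumes \<mu>: "\<mu> \<in> prob_measures" and L: "continuous_extension \<mu> L"
  shows "pairing u \<mu> = (LINT z|\<mu>. u z)"
proof -
  interpret prob_space \<mu> using \<mu> by (simp add: prob_measures_def)
  have [measurable_cong]: "sets \<mu> = sets borel" using \<mu> by (simp add: prob_measures_def)
  have lim: "(\<lambda>n. LINT z|\<mu>. X n z) \<longlonglongrightarrow> (LINT z|\<mu>. u z)"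
    by (rule integral_dominated_convergence[where w = "\<lambda>_. B"]) (use X_lim X_bound in auto)
  have "L' u = (LINT z|\<mu>. u z)" if "continuous_extension \<mu> L'" for L'
  proof -
    have "(\<lambda>n. L' (X n)) \<longlonglongrightarrow> L' u"
      using that in_H1 H1_tendsto by (auto simp: continuous_extension_def)
    moreover have "L' (X n) = (LINT z|\<mu>. X n z)" for n
      using that X by (auto simp: continuous_extension_def)
    ultimately show ?thesis using lim LIMSEQ_unique by auto
  qed
  then show ?thesis
    unfolding pairing_def using L by (intro the_equality) blast+
qed

text \<open>Without a continuous extension the description in \<open>pairing\<close> is of an
  unsatisfiable property, so its value is one fixed real, the same for all such measures.\<close>

lemma pairing_cases:
  assumes "\<mu> \<in> prob_measures"
  shows "pairing u \<mu> = (LINT z|\<mu>. u z) \<or> pairing u \<mu> = (THE c. False)"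
proof (cases "\<exists>L. continuous_extension \<mu> L")
  case True
  then show ?thesis using pairing_eq[OF assms] by auto
next
  case False
  then show ?thesis by (simp add: pairing_def)
qed

end

section \<open>The perturbation u\<close>

text \<open>The first summand turns the potential \<open>l * |z|\<^sup>2\<close> into its maximum with \<open>1\<close>. The second one is
  smooth and at least \<open>K\<close> for \<open>K \<le> 0\<close>, with equality on the circle \<open>l * |z|\<^sup>2 = 1\<close>; it has the effect
  of adding the constant \<open>K\<close>, while keeping the support compact.\<close>

definition well :: "real \<Rightarrow> real \<Rightarrow> complex \<Rightarrow> real" where
  "well l K z = max 0 (1 - l * (cmod z)^2) + K * (exp 1 * flat_deriv 0 (1 - (1 - l * (cmod z)^2)^2))"

text \<open>Bounds on w exp(-w) and w^2 exp(-w) for w = 1 / y. The second bound is invariant under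
  scaling of the argument, so it controls the gradients of the approximations uniformly in
  n.\<close>

lemma flat_deriv_bounds: "\<bar>flat_deriv 0 y\<bar> \<le> 1" "\<bar>y * flat_deriv 1 y\<bar> \<le> 1" "\<bar>flat_deriv 1 y\<bar> \<le> 2"
proof -
  show "\<bar>flat_deriv 0 y\<bar> \<le> 1" by (simp add: flat_deriv_0)
  have *: "w * exp (- w) \<le> 1" "w^2 * exp (- w) \<le> 2" if "w > 0" for w :: real
  proof -
    have "w \<le> exp w" using exp_ge_add_one_self[of w] by linarith
    then show "w * exp (- w) \<le> 1" by (simp add: exp_minus field_simps)
    have "1 + w + w^2 / 2 \<le> exp w" by (rule exp_lower_Taylor_quadratic) (use that in simp)
    then have "w^2 \<le> 2 * exp w" using that by linarith
    then show "w^2 * exp (- w) \<le> 2" by (simp add: exp_minus field_simps)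
  qed
  show "\<bar>y * flat_deriv 1 y\<bar> \<le> 1"
    using *(1)[of "1 / y"] unfolding flat_deriv_1 by (auto simp: power2_eq_square)
  show "\<bar>flat_deriv 1 y\<bar> \<le> 2"
    using *(2)[of "1 / y"] unfolding flat_deriv_1 by (auto simp: power_divide)
qed

text \<open>\<open>max 0 q\<close> is the limit of the smooth functions \<open>q * exp (- 1 / (n * q))\<close>.\<close>

lemma H1_approximation_well:
  assumes l: "l > 0"
  shows "\<exists>X G g B R. H1_approximation X G (well l K) g B R"
proof -
  \<comment> \<open>Written in coordinates so that it is visibly a polynomial, hence smooth.\<close>
  define q where "q z = 1 - l * ((z \<bullet> 1) * (z \<bullet> 1) + (z \<bullet> \<i>) * (z \<bullet> \<i>))" for z :: complex
  have q: "q z = 1 - l * (cmod z)^2" for z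
    unfolding q_def cmod_power2 by (simp add: power2_eq_square)
  define X where "X n z = q z * flat_deriv 0 (real (Suc n) * q z) + K * exp 1 * flat_deriv 0 (1 - q z * q z)" for n z
  \<comment> \<open>The derivative of \<open>X n\<close> with respect to \<open>q\<close>; the
    gradient of \<open>q\<close> is -2 l z.\<close>
  define c where "c n z = flat_deriv 0 (real (Suc n) * q z) + real (Suc n) * q z * flat_deriv 1 (real (Suc n) * q z)
    + K * exp 1 * (flat_deriv 1 (1 - q z * q z) * (- 2 * q z))" for n z
  define c' where "c' z = (if q z > 0 then 1 else 0) + K * exp 1 * (flat_deriv 1 (1 - q z * q z) * (- 2 * q z))" for z
  define G where "G n z = (c n z * (- 2 * l)) *\<^sub>R z" for n z
  define g where "g z = (c' z * (- 2 * l)) *\<^sub>R z" for z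
  \<comment> \<open>Beyond this radius q < -1, so q and 1 - q^2 are both negative and every flat
    term vanishes.\<close>
  define R where "R = sqrt (2 / l)"
  \<comment> \<open>The two terms from q exp(-1 / (n q)) contribute at most 1 each; in the last one
    \<open>flat_deriv 1\<close> is at most 2 and |2 q| at most 2.\<close>
  define C where "C = 2 + \<bar>K\<bar> * exp 1 * 4"
  have R: "R \<ge> 0" using l by (simp add: R_def)
  have out: "q z < - 1" if "cmod z > R" for z
  proof -
    have "2 / l < (cmod z)^2"
      using that l unfolding R_def by (metis norm_ge_zero real_sqrt_less_iff real_sqrt_unique)
    then show ?thesis using l by (simp add: q field_simps)
  qed
  have "\<bar>q z\<bar> \<le> 1" if "\<not> cmod z > R" for z
  proof -
    have "(cmod z)^2 \<le> R^2" using that R by (intro power_mono) auto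
    then have "l * (cmod z)^2 \<le> 2" using l by (simp add: R_def field_simps)
    moreover have "0 \<le> l * (cmod z)^2" using l by simp
    ultimately show ?thesis unfolding q by linarith
  qed
  note inside = this
  have q1: "q z \<le> 1" for z using l by (simp add: q)
  have zero: "X n z = 0" "c n z = 0" if "cmod z > R" for n z
  proof -
    have "q z < -1" by (rule out[OF that])
    then have "real (Suc n) * q z < 0" "1 - q z * q z < 0"
      using mult_strict_mono[of 1 "- q z" 1 "- q z"] by (auto simp: mult_pos_neg)
    then show "X n z = 0" "c n z = 0" by (auto simp: X_def c_def flat_deriv_0 flat_deriv_1 simp del: of_nat_Suc One_nat_def)
  qed
  have Xb: "\<bar>X n z\<bar> \<le> C" for n z
  proof (cases "cmod z > R")
    case True
    then show ?thesis using zero by (simp add: C_def)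
  next
    case False
    have "\<bar>X n z\<bar> \<le> \<bar>q z * flat_deriv 0 (real (Suc n) * q z)\<bar>
        + \<bar>K\<bar> * exp 1 * \<bar>flat_deriv 0 (1 - q z * q z)\<bar>"
      unfolding X_def by (rule order_trans[OF abs_triangle_ineq]) (simp add: abs_mult)
    also have "\<dots> \<le> 1 * 1 + \<bar>K\<bar> * exp 1 * 1"
      using inside[OF False] flat_deriv_bounds(1) unfolding abs_mult
      by (intro add_mono mult_mono) auto
    also have "\<dots> \<le> C" by (simp add: C_def)
    finally show ?thesis .
  qed
  have cb: "\<bar>c n z\<bar> \<le> C" for n z
  proof (cases "cmod z > R")
    case True
    then show ?thesis using zero by (simp add: C_def)
  next
    case False
    have "\<bar>c n z\<bar> \<le> \<bar>flat_deriv 0 (real (Suc n) * q z)\<bar> + \<bar>real (Suc n) * q z * flat_deriv 1 (real (Suc n) * q z)\<bar>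
        + \<bar>K\<bar> * exp 1 * (\<bar>flat_deriv 1 (1 - q z * q z)\<bar> * (2 * \<bar>q z\<bar>))"
      unfolding c_def
      by (rule order_trans[OF abs_triangle_ineq], rule add_mono, rule abs_triangle_ineq) (simp add: abs_mult)
    also have "\<dots> \<le> 1 + 1 + \<bar>K\<bar> * exp 1 * (2 * (2 * 1))"
      using inside[OF False] flat_deriv_bounds
      by (intro add_mono mult_mono mult_nonneg_nonneg) auto
    finally show ?thesis by (simp add: C_def)
  qed
  have C0: "C \<ge> 0" by (simp add: C_def)
  have Gb: "cmod (G n z) \<le> C * (2 * l) * R" for n z
  proof (cases "cmod z > R")
    case True
    then show ?thesis using zero C0 R l by (simp add: G_def)
  next
    case False
    then show ?thesis
      using cb[of n z] l C0 by (auto simp: G_def abs_mult intro!: mult_mono)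
  qed
  have Cq: "C_diff k q" for k
    unfolding q_def[abs_def] by (intro C_diff_diff C_diff_mult C_diff_add C_diff_const C_diff_inner)
  have Xt: "X n \<in> test_functions" for n
  proof (rule test_functionsI)
    show "C_diff k (X n)" for k
      unfolding X_def by (intro C_diff_add C_diff_mult C_diff_flat C_diff_diff C_diff_const Cq)
    show "z \<in> cball 0 R" if "X n z \<noteq> 0" for z
    proof -
      have "\<not> R < cmod z" using that zero(1) by blast
      then show ?thesis by simp
    qed
  qed simp
  have dq: "(q has_derivative (\<lambda>b. - 2 * l * (z \<bullet> b))) (at z)" for z
    unfolding q_def[abs_def]
    by (auto intro!: derivative_eq_intros simp: fun_eq_iff inner_complex_def algebra_simps)
  have deriv: "(X n has_derivative (\<lambda>b. G n z \<bullet> b)) (at z)" for n z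
  proof -
    have "((\<lambda>x. x * flat_deriv 0 (real (Suc n) * x) + K * exp 1 * flat_deriv 0 (1 - x * x)) has_real_derivative c n z) (at (q z))"
      unfolding c_def
      by (rule derivative_eq_intros refl DERIV_chain2[OF flat_deriv_has_derivative])+ (simp add: algebra_simps)
    then have "((\<lambda>z. q z * flat_deriv 0 (real (Suc n) * q z) + K * exp 1 * flat_deriv 0 (1 - q z * q z))
      has_derivative (\<lambda>b. c n z * (- 2 * l * (z \<bullet> b)))) (at z)"
      using has_derivative_compose[OF dq] unfolding has_field_derivative_def by blast
    then show ?thesis by (simp add: X_def[abs_def] G_def mult.assoc)
  qed
  have XG: "frechet_derivative (X n) (at z) b = G n z \<bullet> b" for n z b
    using frechet_derivative_at[OF deriv[of n z]] by metis
  have Xlim: "(\<lambda>n. X n z) \<longlonglongrightarrow> well l K z" for z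
  proof -
    have "(\<lambda>n. X n z) \<longlonglongrightarrow> q z * (if q z > 0 then 1 else 0) + K * exp 1 * flat_deriv 0 (1 - q z * q z)"
      unfolding X_def by (intro tendsto_intros tendsto_flat_deriv_0)
    also have "q z * (if q z > 0 then 1 else 0) + K * exp 1 * flat_deriv 0 (1 - q z * q z) = well l K z"
      by (simp add: well_def q power2_eq_square max_def)
    finally show ?thesis .
  qed
  have ylim: "(\<lambda>n. real (Suc n) * y * flat_deriv 1 (real (Suc n) * y)) \<longlonglongrightarrow> 0" for y
  proof (cases "y > 0")
    case True
    have "(\<lambda>n. exp (- (inverse (real (Suc n)) * (1 / y))) * (inverse (real (Suc n)) * (1 / y)))
        \<longlonglongrightarrow> exp (- (0 * (1 / y))) * (0 * (1 / y))"
      by (intro tendsto_intros LIMSEQ_inverse_real_of_nat)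
    moreover have "real (Suc n) * y * flat_deriv 1 (real (Suc n) * y)
      = exp (- (inverse (real (Suc n)) * (1 / y))) * (inverse (real (Suc n)) * (1 / y))" for n
      unfolding flat_deriv_1 using True by (simp add: power2_eq_square divide_inverse mult_ac del: of_nat_Suc)
    ultimately show ?thesis by simp
  next
    case False
    then have "\<not> real (Suc n) * y > 0" for n by (simp add: zero_less_mult_iff del: of_nat_Suc)
    then show ?thesis by (simp add: flat_deriv_1 del: of_nat_Suc One_nat_def)
  qed
  have Glim: "(\<lambda>n. G n z) \<longlonglongrightarrow> g z" for z
  proof -
    have "(\<lambda>n. c n z) \<longlonglongrightarrow> (if q z > 0 then 1 else 0) + 0 + K * exp 1 * (flat_deriv 1 (1 - q z * q z) * (- 2 * q z))"
      unfolding c_def by (intro tendsto_add tendsto_const ylim tendsto_flat_deriv_0)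
    then have "(\<lambda>n. c n z) \<longlonglongrightarrow> c' z" by (simp add: c'_def)
    then show ?thesis unfolding G_def g_def by (intro tendsto_intros)
  qed
  have fm: "flat_deriv k \<in> borel_measurable borel" for k
    using flat_deriv_has_derivative[of k]
    by (intro borel_measurable_continuous_onI) (auto simp: continuous_on_eq_continuous_at intro: DERIV_isCont)
  have [measurable]: "q \<in> borel_measurable borel" unfolding q_def[abs_def] by measurable
  have Gm: "G n \<in> borel_measurable borel" for n
    unfolding G_def[abs_def] c_def[abs_def]
    by (intro borel_measurable_scaleR borel_measurable_times borel_measurable_add measurable_compose[OF _ fm]) measurable
  have "H1_approximation X G (well l K) g (max C (C * (2 * l) * R)) R"
  proof
    show "\<bar>X n z\<bar> \<le> max C (C * (2 * l) * R)" for n z using Xb[of n z] by linarith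
    show "cmod (G n z) \<le> max C (C * (2 * l) * R)" for n z using Gb[of n z] by linarith
    show "G n z = 0" if "cmod z > R" for n z using zero(2)[OF that] by (simp add: G_def)
  qed (intro Xt XG Gm Xlim Glim)+
  then show ?thesis by blast
qed

lemma well_ge:
  assumes l: "l > 0" and K: "K \<le> 0"
  shows "max 0 (1 - l * (cmod z)^2) + K \<le> well l K z"
proof -
  let ?q = "1 - l * (cmod z)^2"
  have "exp 1 * flat_deriv 0 (1 - ?q^2) \<le> 1"
  proof (cases "1 - ?q^2 > 0")
    case True
    then have "1 \<le> 1 / (1 - ?q^2)" by (simp add: field_simps)
    then have "exp (1 - 1 / (1 - ?q^2)) \<le> 1" by simp
    then show ?thesis using True by (simp add: flat_deriv_0 exp_diff exp_minus field_simps)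
  qed (simp add: flat_deriv_0)
  then show ?thesis
    using K mult_left_mono_neg[of "exp 1 * flat_deriv 0 (1 - ?q^2)" 1 K] by (simp add: well_def)
qed

text \<open>Inside the circle the maximum of potential and 1 is exactly 1. The smooth summand is
  even in q = 1 - l |z|^2, so it differs from K only by O(q^2) = O(N^(-2)). Multiplied by b N^2 and
  averaged over the particles, this error stays bounded.\<close>

lemma well_le_on_annulus:
  assumes l: "l > 0" and K: "K \<le> 0" and N: "N > 0"
    and z: "real N / (real N + 1) \<le> l * (cmod z)^2" "l * (cmod z)^2 \<le> 1"
  shows "l * (cmod z)^2 + well l K z \<le> 1 + K - 2 * K / (real N)^2"
proof -
  define q where "q = 1 - l * (cmod z)^2"
  have "q \<le> 1 - real N / (real N + 1)" "0 \<le> q" using z by (auto simp: q_def)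
  moreover have "1 - real N / (real N + 1) = 1 / (real N + 1)" by (simp add: field_simps)
  ultimately have q: "0 \<le> q" "q \<le> 1 / (real N + 1)" by auto
  have "1 / (real N + 1) \<le> 1 / 2" using N by (intro divide_left_mono) auto
  then have "q \<le> 1 / 2" using q by linarith
  then have "q^2 \<le> (1 / 2)^2" using q by (intro power_mono) auto
  then have q2: "q^2 \<le> 1 / 2" by (simp add: power2_eq_square)
  have "q^2 \<le> (1 / real N)^2"
    using q N by (intro power_mono order_trans[OF q(2)] divide_left_mono) auto
  then have qN: "q^2 \<le> 1 / (real N)^2" by (simp add: power_divide)
  \<comment> \<open>1 / (1 - x) <= 1 + 2 x for 0 <= x <= 1 / 2, with x = q^2.\<close>
  have "1 / (1 - q^2) \<le> 1 + 2 * q^2"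
  proof -
    have "0 \<le> q^2 * (1 - 2 * q^2)" using q2 by (intro mult_nonneg_nonneg) auto
    then have "1 \<le> (1 + 2 * q^2) * (1 - q^2)" by (simp add: algebra_simps)
    then show ?thesis using q2 by (simp add: divide_le_eq)
  qed
  then have "- 2 * q^2 \<le> 1 - 1 / (1 - q^2)" by linarith
  then have "1 - 2 * q^2 \<le> exp (1 - 1 / (1 - q^2))"
    using exp_ge_add_one_self[of "1 - 1 / (1 - q^2)"] by linarith
  also have "\<dots> = exp 1 * flat_deriv 0 (1 - q^2)"
  proof -
    have "flat_deriv 0 (1 - q^2) = exp (- (1 / (1 - q^2)))" using q2 by (simp add: flat_deriv_0)
    then show ?thesis by (simp only: mult_exp_exp) simp
  qed
  finally have "K * (exp 1 * flat_deriv 0 (1 - q^2)) \<le> K * (1 - 2 * q^2)"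
    using K by (intro mult_left_mono_neg) auto
  also have "\<dots> \<le> K - 2 * K / (real N)^2"
    using mult_left_mono[OF qN, of "- 2 * K"] K by (simp add: algebra_simps)
  finally show ?thesis
    using q(1) unfolding well_def q_def[symmetric] by (simp add: q_def)
qed

section \<open>Logarithmic energy\<close>

lemma prob_measuresD:
  assumes "\<mu> \<in> prob_measures"
  shows "prob_space \<mu>" "sets \<mu> = sets borel"
  using assms by (auto simp: prob_measures_def)

lemma psi0_measurable [measurable]: "psi0 \<in> borel_measurable borel"
  unfolding psi0_def[abs_def] by measurable

lemma psi0_nonneg: "0 \<le> psi0 z"
  by (simp add: psi0_def)

text \<open>Rests on (1 + a^2)(1 + b^2) - (a + b)^2 = (1 - a b)^2.\<close>

lemma cmod_diff_square_le: "(cmod (z - w))^2 \<le> (1 + (cmod z)^2) * (1 + (cmod w)^2)"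
proof -
  have "(cmod (z - w))^2 \<le> (cmod z + cmod w)^2"
    by (intro power_mono norm_triangle_ineq4) auto
  also have "\<dots> \<le> (1 + (cmod z)^2) * (1 + (cmod w)^2)"
    using zero_le_power2[of "1 - cmod z * cmod w"]
    by (simp add: power2_eq_square algebra_simps)
  finally show ?thesis .
qed

text \<open>Off the diagonal this is minus the interaction integrand of \<open>energy\<close>. On
  the diagonal \<open>ln 0 = 0\<close> makes it finite where the energy needs infinity, so the
  diagonal is handled separately below.\<close>

definition log_kernel :: "complex \<times> complex \<Rightarrow> real" where
  "log_kernel p = psi0 (fst p) + psi0 (snd p) - ln ((cmod (fst p - snd p))^2)"

lemma log_kernel_measurable [measurable]: "log_kernel \<in> borel_measurable (borel \<Otimes>\<^sub>M borel)"
  unfolding log_kernel_def[abs_def] by measurable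

lemma log_kernel_ge_0: "0 \<le> log_kernel p"
proof (cases "fst p = snd p")
  case True
  then show ?thesis using psi0_nonneg by (simp add: log_kernel_def)
next
  case False
  have "ln ((cmod (fst p - snd p))^2) \<le> ln ((1 + (cmod (fst p))^2) * (1 + (cmod (snd p))^2))"
    using False cmod_diff_square_le by (intro ln_mono) auto
  also have "\<dots> = psi0 (fst p) + psi0 (snd p)"
    unfolding psi0_def by (intro ln_mult_pos) (auto intro!: add_pos_nonneg)
  finally show ?thesis by (simp add: log_kernel_def)
qed

lemma e2ennreal_ereal: "e2ennreal (ereal x) = ennreal x"
  by (simp add: ennreal.abs_eq max_def zero_ereal_def)

lemma ereal_integral_real:
  assumes "integrable M f"
  shows "ereal_integral M (\<lambda>x. ereal (f x)) = ereal (\<integral>x. f x \<partial>M)"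
proof -
  have "(\<integral>\<^sup>+ x. ennreal (f x) \<partial>M) \<noteq> \<infinity>" "(\<integral>\<^sup>+ x. ennreal (- f x) \<partial>M) \<noteq> \<infinity>"
    using assms by (auto simp: real_integrable_def)
  then show ?thesis
    unfolding ereal_integral_def real_lebesgue_integral_def[OF assms]
    by (cases "\<integral>\<^sup>+ x. ennreal (f x) \<partial>M"; cases "\<integral>\<^sup>+ x. ennreal (- f x) \<partial>M") (auto simp: e2ennreal_ereal)
qed

lemma ereal_integral_elog_kernel:
  "ereal_integral M (\<lambda>(z, w). elog (ennreal ((cmod (z - w))^2)) - ereal (psi0 z) - ereal (psi0 w))
    = - enn2ereal (\<integral>\<^sup>+ p. (if fst p = snd p then \<infinity> else ennreal (log_kernel p)) \<partial>M)"
proof -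
  let ?k = "\<lambda>(z, w). elog (ennreal ((cmod (z - w))^2)) - ereal (psi0 z) - ereal (psi0 w)"
  have k: "?k p = (if fst p = snd p then - \<infinity> else ereal (- log_kernel p))" for p
    by (auto simp: case_prod_beta log_kernel_def elog_def ennreal_eq_0_iff)
  have "e2ennreal (?k p) = 0" for p
    unfolding k using log_kernel_ge_0[of p] by (simp add: e2ennreal_ereal ennreal_neg e2ennreal_neg)
  moreover have "e2ennreal (- ?k p) = (if fst p = snd p then \<infinity> else ennreal (log_kernel p))" for p
    unfolding k by (simp add: e2ennreal_ereal)
  ultimately show ?thesis
    unfolding ereal_integral_def by (simp add: zero_ennreal.rep_eq)
qed

lemma energy_eq:
  assumes ne: "AE p in \<mu> \<Otimes>\<^sub>M \<mu>. fst p \<noteq> snd p"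
    and k: "integrable (\<mu> \<Otimes>\<^sub>M \<mu>) log_kernel" and \<phi>: "integrable \<mu> (\<lambda>z. \<phi> z - psi0 z)"
  shows "energy \<phi> \<mu> = ereal (1 / 2 * (\<integral>p. log_kernel p \<partial>(\<mu> \<Otimes>\<^sub>M \<mu>))
      + (\<integral>z. \<phi> z - psi0 z \<partial>\<mu>))"
proof -
  have "(\<integral>\<^sup>+ p. (if fst p = snd p then \<infinity> else ennreal (log_kernel p)) \<partial>(\<mu> \<Otimes>\<^sub>M \<mu>))
      = (\<integral>\<^sup>+ p. ennreal (log_kernel p) \<partial>(\<mu> \<Otimes>\<^sub>M \<mu>))"
    by (rule nn_integral_cong_AE) (use ne in eventually_elim, auto)
  also have "\<dots> = ennreal (\<integral>p. log_kernel p \<partial>(\<mu> \<Otimes>\<^sub>M \<mu>))"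
    using k log_kernel_ge_0 by (intro nn_integral_eq_integral) auto
  finally show ?thesis
    unfolding energy_def ereal_integral_elog_kernel ereal_integral_real[OF \<phi>]
    using log_kernel_ge_0 by (simp add: enn2ereal_ennreal integral_nonneg_AE)
qed

lemma (in prob_space) distr_pair_snd: "distr (M \<Otimes>\<^sub>M M) M snd = M"
proof (rule measure_eqI)
  fix A assume "A \<in> sets (distr (M \<Otimes>\<^sub>M M) M snd)"
  then have A: "A \<in> sets M" by simp
  then have "snd -` A \<inter> space (M \<Otimes>\<^sub>M M) = space M \<times> A"
    using sets.sets_into_space[OF A] by (auto simp: space_pair_measure)
  then show "emeasure (distr (M \<Otimes>\<^sub>M M) M snd) A = emeasure M A"
    using A by (simp add: emeasure_distr emeasure_pair_measure_Times emeasure_space_1)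
qed simp

lemma (in prob_space) integral_pair_fst:
  fixes f :: "'a \<Rightarrow> real"
  assumes "integrable M f"
  shows "integrable (M \<Otimes>\<^sub>M M) (\<lambda>p. f (fst p))" "(\<integral>p. f (fst p) \<partial>(M \<Otimes>\<^sub>M M))
      = (\<integral>z. f z \<partial>M)"
  using integrable_distr[OF measurable_fst, of M M f] integral_distr[OF measurable_fst, of f M M] assms
  by (simp_all add: distr_pair_fst)

lemma (in prob_space) integral_pair_snd:
  fixes f :: "'a \<Rightarrow> real"
  assumes "integrable M f"
  shows "integrable (M \<Otimes>\<^sub>M M) (\<lambda>p. f (snd p))" "(\<integral>p. f (snd p) \<partial>(M \<Otimes>\<^sub>M M))
      = (\<integral>z. f z \<partial>M)"
  using integrable_distr[OF measurable_snd, of M M f] integral_distr[OF measurable_snd, of f M M] assms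
  by (simp_all add: distr_pair_snd)

text \<open>Up to the additive constant \<open>ln l\<close> this is the logarithmic potential of the
  uniform measure on the circle l |z|^2 = 1. It grows like \<open>psi0\<close> up to a bounded
  error, so it can replace \<open>psi0\<close> as the weight that makes the kernel
  integrable.\<close>

definition log_max :: "real \<Rightarrow> complex \<Rightarrow> real" where
  "log_max l z = ln (max (l * (cmod z)^2) 1)"

lemma log_max_measurable [measurable]: "log_max l \<in> borel_measurable borel"
  unfolding log_max_def[abs_def] by measurable

lemma log_max_psi0_bounded:
  assumes "l > 0"
  obtains c where "\<And>z. \<bar>log_max l z - psi0 z\<bar> \<le> c"
proof -
  have "\<bar>log_max l z - psi0 z\<bar> \<le> ln (max l 1) + ln (2 / min l 1)" for z
  proof -
    let ?s = "(cmod z)^2"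
    have "max (l * ?s) 1 \<le> max l 1 * (1 + ?s)"
    proof -
      have "l * ?s \<le> max l 1 * ?s" "0 \<le> max l 1 * ?s" by (auto intro: mult_right_mono)
      then show ?thesis unfolding distrib_left by (intro max.boundedI) linarith+
    qed
    then have "log_max l z \<le> ln (max l 1 * (1 + ?s))" unfolding log_max_def by (intro ln_mono) auto
    also have "\<dots> = ln (max l 1) + psi0 z"
      unfolding psi0_def by (intro ln_mult_pos) (auto intro: add_pos_nonneg)
    finally have 1: "log_max l z \<le> ln (max l 1) + psi0 z" .
    have "min l 1 * (1 + ?s) \<le> l * ?s + 1"
    proof -
      have "min l 1 * ?s \<le> l * ?s" by (intro mult_right_mono) auto
      then show ?thesis unfolding distrib_left by linarith
    qed
    also have "\<dots> \<le> 2 * max (l * ?s) 1" by (simp add: max_def)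
    finally have "1 + ?s \<le> 2 / min l 1 * max (l * ?s) 1"
      using assms by (simp add: field_simps)
    then have "psi0 z \<le> ln (2 / min l 1 * max (l * ?s) 1)"
      unfolding psi0_def using assms by (intro ln_mono) (auto intro!: add_pos_nonneg)
    also have "\<dots> = ln (2 / min l 1) + log_max l z"
      unfolding log_max_def using assms by (intro ln_mult_pos) auto
    finally have 2: "psi0 z \<le> ln (2 / min l 1) + log_max l z" .
    have "0 \<le> ln (max l 1)" by simp
    moreover have "0 \<le> ln (2 / min l 1)" using assms by (intro ln_ge_zero) (simp add: field_simps)
    ultimately show ?thesis using 1 2 by linarith
  qed
  then show ?thesis by (rule that)
qed

lemma distr_PiM_pair:
  assumes \<mu>: "prob_space \<mu>" and ij: "i < N" "j < N" "i \<noteq> j"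
  shows "distr (\<Pi>\<^sub>M k\<in>{..<N}. \<mu>) (\<mu> \<Otimes>\<^sub>M \<mu>) (\<lambda>z. (z i, z j)) = \<mu> \<Otimes>\<^sub>M \<mu>"
proof -
  let ?P = "\<Pi>\<^sub>M k\<in>{..<N}. \<mu>"
  interpret prob_space \<mu> by fact
  interpret P: product_prob_space "\<lambda>_. \<mu>" "{..<N}" ..
  have ij': "i \<in> {..<N}" "j \<in> {..<N}" using ij by auto
  show ?thesis
  proof (rule pair_measure_eqI[symmetric])
    fix A B assume AB: "A \<in> sets \<mu>" "B \<in> sets \<mu>"
    have "emeasure (distr ?P (\<mu> \<Otimes>\<^sub>M \<mu>) (\<lambda>z. (z i, z j))) (A \<times> B)
      = emeasure ?P ((\<lambda>z. (z i, z j)) -` (A \<times> B) \<inter> space ?P)"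
      using ij' AB by (intro emeasure_distr measurable_Pair measurable_component_singleton) auto
    also have "(\<lambda>z. (z i, z j)) -` (A \<times> B) \<inter> space ?P
      = {z \<in> space ?P. \<forall>k\<in>{i, j}. z k \<in> (if k = i then A else B)}"
      using ij by auto
    also have "emeasure ?P \<dots> = (\<Prod>k\<in>{i, j}. emeasure \<mu> (if k = i then A else B))"
      using ij' AB by (intro P.emeasure_PiM_Collect) auto
    also have "\<dots> = emeasure \<mu> A * emeasure \<mu> B" using ij by simp
    finally show "emeasure \<mu> A * emeasure \<mu> B
        = emeasure (distr ?P (\<mu> \<Otimes>\<^sub>M \<mu>) (\<lambda>z. (z i, z j))) (A \<times> B)" ..
  qed (simp_all add: sigma_finite_measure_axioms)
qed

lemma sum_pairs_const: "(\<Sum>j<N. \<Sum>i<j. c) = real (N * (N - 1)) / 2 * (c::real)"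
proof (induction N)
  case (Suc N)
  then show ?case by (cases N) (auto simp: algebra_simps)
qed simp

lemma sum_pairs_add: "(\<Sum>j<N. \<Sum>i<j. f i + f j) = real (N - 1) * (\<Sum>i<N. f i :: real)"
proof (induction N)
  case (Suc N)
  then show ?case by (cases N) (auto simp: algebra_simps sum.distrib)
qed simp

text \<open>Pointwise form of the positive definiteness of the logarithmic kernel: Hadamard's inequality
  bounds the weighted Vandermonde determinant of \<open>N\<close> points.\<close>

lemma weighted_log_vandermonde_le:
  assumes l: "l > 0" and N: "N > 0" and ne: "\<And>i j. i < j \<Longrightarrow> j < N \<Longrightarrow> z i \<noteq> z j"
  shows "(\<Sum>j<N. \<Sum>i<j. ln ((cmod (z i - z j))^2) - log_max l (z i) - log_max l (z j))
    \<le> real N * ln (real N) - real (N * (N - 1)) / 2 * ln l"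
proof -
  let ?m = "\<lambda>z. max (l * (cmod z)^2) 1"
  let ?R = "(\<Prod>i<N. real N * ?m (z i) ^ (N - 1)) * (\<Prod>k<N. 1 / l ^ k)"
  \<comment> \<open>With weights 1 / l^k the k-th summand is (l |z|^2)^k, at most the power N - 1 of
    max (l |z|^2) 1. Each point also lies in N - 1 pairs, so this power is absorbed by the
    \<open>log_max\<close> terms.\<close>
  have "vandermonde_square N z \<le> (\<Prod>i<N. \<Sum>k<N. (cmod (z i))\<^sup>2 ^ k / (1 / l ^ k)) * (\<Prod>k<N. 1 / l ^ k)"
    by (rule weighted_vandermonde_bound) (use l in auto)
  also have "\<dots> \<le> ?R"
  proof (intro mult_right_mono prod_mono conjI)
    fix i
    have "(\<Sum>k<N. (cmod (z i))\<^sup>2 ^ k / (1 / l ^ k)) \<le> (\<Sum>k<N. ?m (z i) ^ (N - 1))"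
    proof (rule sum_mono)
      fix k assume k: "k \<in> {..<N}"
      have "(cmod (z i))\<^sup>2 ^ k / (1 / l ^ k) = (l * (cmod (z i))^2) ^ k" by (simp add: power_mult_distrib)
      also have "\<dots> \<le> ?m (z i) ^ k" using l by (intro power_mono) auto
      also have "\<dots> \<le> ?m (z i) ^ (N - 1)" using k by (intro power_increasing) auto
      finally show "(cmod (z i))\<^sup>2 ^ k / (1 / l ^ k) \<le> ?m (z i) ^ (N - 1)" .
    qed
    then show "(\<Sum>k<N. (cmod (z i))\<^sup>2 ^ k / (1 / l ^ k)) \<le> real N * ?m (z i) ^ (N - 1)" by simp
  qed (use l in \<open>auto intro!: sum_nonneg prod_nonneg\<close>)
  finally have le: "vandermonde_square N z \<le> ?R" .
  have pos: "0 < vandermonde_square N z"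
    using ne by (intro prod_pos) auto
  have "(\<Sum>j<N. \<Sum>i<j. ln ((cmod (z i - z j))^2)) = ln (vandermonde_square N z)"
  proof -
    have "(\<Sum>i<j. ln ((cmod (z i - z j))^2)) = ln (\<Prod>i<j. (cmod (z i - z j))^2)" if "j < N" for j
      using ne that by (intro ln_prod[symmetric]) auto
    moreover have "(\<Sum>j<N. ln (\<Prod>i<j. (cmod (z i - z j))^2)) = ln (vandermonde_square N z)"
      using ne by (intro ln_prod[symmetric] prod_pos) auto
    ultimately show ?thesis by simp
  qed
  also have "\<dots> \<le> ln ?R"
    by (rule ln_mono[OF le pos])
  also have "\<dots> = (\<Sum>i<N. ln (real N) + real (N - 1) * log_max l (z i)) - (\<Sum>k<N. real k * ln l)"
  proof -
    have "ln ?R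
      = (\<Sum>i<N. ln (real N * ?m (z i) ^ (N - 1))) + (\<Sum>k<N. ln (1 / l ^ k))"
      using l N by (subst ln_mult_pos) (auto simp: ln_prod intro!: prod_pos)
    moreover have "ln (real N * ?m (z i) ^ (N - 1)) = ln (real N) + real (N - 1) * log_max l (z i)" for i
      using N by (subst ln_mult_pos) (auto simp: log_max_def ln_realpow)
    moreover have "ln (1 / l ^ k) = - (real k * ln l)" for k
      using l by (simp add: ln_div ln_realpow)
    ultimately show ?thesis by (simp add: sum_negf)
  qed
  also have "(\<Sum>i<N. ln (real N) + real (N - 1) * log_max l (z i))
      = real N * ln (real N) + (\<Sum>j<N. \<Sum>i<j. log_max l (z i) + log_max l (z j))"
    unfolding sum_pairs_add by (simp add: sum.distrib sum_distrib_left)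
  also have "(\<Sum>k<N. real k * ln l) = real (N * (N - 1)) / 2 * ln l"
    using sum_pairs_const[of "ln l" N] by simp
  finally show ?thesis
    by (simp add: sum_subtractf sum.distrib algebra_simps)
qed

text \<open>Any two coordinates of N independent points have joint law mu x mu, so the mean of the
  pair sum is N (N - 1) / 2 times the integral. Division turns the error N ln N into 2 ln N / (N -
  1), which tends to 0.\<close>

lemma log_energy_le:
  assumes l: "l > 0" and \<mu>: "prob_space \<mu>" and sets_\<mu>[measurable_cong]: "sets \<mu> = sets borel"
    and ne: "AE p in \<mu> \<Otimes>\<^sub>M \<mu>. fst p \<noteq> snd p"
    and int: "integrable (\<mu> \<Otimes>\<^sub>M \<mu>) (\<lambda>p. ln ((cmod (fst p - snd p))^2) - log_max l (fst p) - log_max l (snd p))"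
  shows "(\<integral>p. ln ((cmod (fst p - snd p))^2) - log_max l (fst p) - log_max l (snd p) \<partial>(\<mu> \<Otimes>\<^sub>M \<mu>)) \<le> - ln l"
proof -
  interpret prob_space \<mu> by fact
  let ?f = "\<lambda>p. ln ((cmod (fst p - snd p))^2) - log_max l (fst p) - log_max l (snd p)"
  let ?I = "\<integral>p. ?f p \<partial>(\<mu> \<Otimes>\<^sub>M \<mu>)"
  have bound: "?I \<le> 2 * ln (real N) / real (N - 1) - ln l" if N: "N \<ge> 2" for N
  proof -
    interpret P: product_prob_space "\<lambda>_. \<mu>" "{..<N}" ..
    let ?P = "\<Pi>\<^sub>M k\<in>{..<N}. \<mu>"
    have pm: "(\<lambda>z. (z i, z j)) \<in> ?P \<rightarrow>\<^sub>M \<mu> \<Otimes>\<^sub>M \<mu>" if "i < N" "j < N" for i j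
      using that by (intro measurable_Pair measurable_component_singleton) auto
    have pair: "integrable ?P (\<lambda>z. ?f (z i, z j))" "(\<integral>z. ?f (z i, z j) \<partial>?P) = ?I" "AE z in ?P. z i \<noteq> z j"
      if "i < j" "j < N" for i j
    proof -
      have d: "distr ?P (\<mu> \<Otimes>\<^sub>M \<mu>) (\<lambda>z. (z i, z j)) = \<mu> \<Otimes>\<^sub>M \<mu>"
        using that by (intro distr_PiM_pair[OF \<mu>]) auto
      have m: "(\<lambda>z. (z i, z j)) \<in> ?P \<rightarrow>\<^sub>M \<mu> \<Otimes>\<^sub>M \<mu>" using that by (intro pm) auto
      show "integrable ?P (\<lambda>z. ?f (z i, z j))"
        by (rule integrable_distr[OF m]) (use int in \<open>simp add: d\<close>)
      show "(\<integral>z. ?f (z i, z j) \<partial>?P) = ?I"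
        using integral_distr[OF m, of ?f] by (simp add: d)
      have "AE p in distr ?P (\<mu> \<Otimes>\<^sub>M \<mu>) (\<lambda>z. (z i, z j)). fst p \<noteq> snd p"
        unfolding d by (rule ne)
      from AE_distrD[OF m this] show "AE z in ?P. z i \<noteq> z j" by simp
    qed
    have "real (N * (N - 1)) / 2 * ?I = (\<integral>z. (\<Sum>j<N. \<Sum>i<j. ?f (z i, z j)) \<partial>?P)"
      unfolding sum_pairs_const[symmetric] using pair
      by (subst Bochner_Integration.integral_sum, force)
         (intro sum.cong refl, subst Bochner_Integration.integral_sum, auto)
    also have "\<dots> \<le> (\<integral>z. real N * ln (real N) - real (N * (N - 1)) / 2 * ln l \<partial>?P)"
    proof (rule integral_mono_AE)
      show "integrable ?P (\<lambda>z. \<Sum>j<N. \<Sum>i<j. ?f (z i, z j))"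
        using pair by (intro Bochner_Integration.integrable_sum) auto
      have "AE z in ?P. \<forall>j\<in>{..<N}. \<forall>i\<in>{..<j}. z i \<noteq> z j"
        using pair(3) by (intro AE_finite_allI) auto
      then show "AE z in ?P. (\<Sum>j<N. \<Sum>i<j. ?f (z i, z j)) \<le> real N * ln (real N) - real (N * (N - 1)) / 2 * ln l"
      proof eventually_elim
        case (elim z)
        then show ?case using weighted_log_vandermonde_le[OF l, of N z] N by auto
      qed
    qed simp
    also have "\<dots> = real N * ln (real N) - real (N * (N - 1)) / 2 * ln l"
      by (simp add: P.P.prob_space)
    finally have "real (N * (N - 1)) / 2 * ?I \<le> real N * ln (real N) - real (N * (N - 1)) / 2 * ln l" .
    moreover have "real (N * (N - 1)) / 2 * ?I = real N * (real (N - 1) * ?I) / 2"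
      "real (N * (N - 1)) / 2 * ln l = real N * (real (N - 1) * ln l) / 2"
      by simp_all
    ultimately have "real N * (real (N - 1) * ?I) \<le> real N * (2 * ln (real N) - real (N - 1) * ln l)"
      unfolding right_diff_distrib by linarith
    then have "real (N - 1) * ?I \<le> 2 * ln (real N) - real (N - 1) * ln l" using N by simp
    then show ?thesis using N by (simp add: field_simps)
  qed
  have "(\<lambda>n. 4 * (ln (real n) / real n) - ln l) \<longlonglongrightarrow> 4 * 0 - ln l"
    by (intro tendsto_intros lim_ln_over_n)
  moreover have "?I \<le> 4 * (ln (real N) / real N) - ln l" if N: "N \<ge> 2" for N
  proof -
    have "real (N - 1) \<ge> real N / 2" "real N / 2 > 0" using N by auto
    then have "2 * ln (real N) / real (N - 1) \<le> 2 * ln (real N) / (real N / 2)"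
      using N by (intro divide_left_mono) auto
    then show ?thesis using bound[OF N] by simp
  qed
  ultimately have "?I \<le> 4 * 0 - ln l"
    by (intro LIMSEQ_le_const) auto
  then show ?thesis by simp
qed

text \<open>The bound is the energy of the uniform measure on the circle l |z|^2 = 1 in the
  potential max (l |z|^2) 1: interaction (ln l) / 2 plus potential 1. It follows from
  \<open>log_energy_le\<close> and ln x <= x - 1, by which this potential is at least 1 +
  \<open>log_max\<close>.\<close>

lemma energy_ge:
  assumes l: "l > 0" and \<mu>: "\<mu> \<in> prob_measures"
  shows "ereal (1 + ln l / 2) \<le> energy (\<lambda>z. l * (cmod z)^2) \<mu> + ereal (LINT z|\<mu>. max 0 (1 - l * (cmod z)^2))"
proof (cases "energy (\<lambda>z. l * (cmod z)^2) \<mu> = \<infinity>")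
  case False
  let ?M = "\<mu> \<Otimes>\<^sub>M \<mu>"
  note [measurable_cong] = prob_measuresD(2)[OF \<mu>]
  interpret prob_space \<mu> by (rule prob_measuresD[OF \<mu>])
  interpret PP: pair_prob_space \<mu> \<mu> ..
  obtain c where c: "\<And>z. \<bar>log_max l z - psi0 z\<bar> \<le> c" using log_max_psi0_bounded[OF l] by metis
  have c0: "c \<ge> 0" using c[of 0] by linarith
  let ?k = "\<lambda>p. if fst p = snd p then \<infinity> else ennreal (log_kernel p)"
  let ?h = "\<lambda>z. l * (cmod z)^2 - psi0 z"
  define A where "A = (\<integral>\<^sup>+ p. ?k p \<partial>?M)"
  define P where "P = (\<integral>\<^sup>+ z. ennreal (?h z) \<partial>\<mu>)"
  define Q where "Q = (\<integral>\<^sup>+ z. ennreal (- ?h z) \<partial>\<mu>)"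
  have h_ge: "log_max l z - psi0 z \<le> ?h z" for z
  proof -
    have "log_max l z \<le> l * (cmod z)^2"
    proof (cases "l * (cmod z)^2 \<le> 1")
      case True
      then show ?thesis using l by (simp add: log_max_def max_def)
    next
      case False
      then show ?thesis using ln_le_minus_one[of "l * (cmod z)^2"] by (simp add: log_max_def max_def)
    qed
    then show ?thesis by simp
  qed
  \<comment> \<open>The potential term is bounded below, so no infinity - infinity can occur and a
    finite energy makes both \<open>A\<close> and \<open>P\<close> finite.\<close>
  have "Q \<le> (\<integral>\<^sup>+ z. ennreal c \<partial>\<mu>)"
    unfolding Q_def using h_ge c
    by (intro nn_integral_mono ennreal_leI) (smt (verit))
  then have "Q \<le> ennreal c" by (simp add: emeasure_space_1)
  then have Q: "Q \<noteq> \<infinity>" by (auto simp: top_unique)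
  have en: "energy (\<lambda>z. l * (cmod z)^2) \<mu> = ereal (1 / 2) * enn2ereal A + (enn2ereal P - enn2ereal Q)"
  proof -
    have "ereal (- 1 / 2) * - x = ereal (1 / 2) * x" for x by (cases x) auto
    then show ?thesis
      unfolding energy_def ereal_integral_elog_kernel A_def[symmetric]
      unfolding ereal_integral_def P_def Q_def
      by (simp add: e2ennreal_ereal)
  qed
  have "A \<noteq> \<infinity>" "P \<noteq> \<infinity>"
    using False Q unfolding en
    by (cases A; cases P; cases Q; simp)+
  have [measurable]: "{p \<in> space ?M. fst p = snd p} \<in> sets ?M"
    by measurable
  have km: "?k \<in> borel_measurable ?M" by measurable
  \<comment> \<open>Finite interaction energy makes the diagonal a null set, after which the
    real-valued kernel may be used.\<close>
  have "AE p in ?M. ?k p \<noteq> \<infinity>"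
    by (rule nn_integral_noteq_infinite[OF km]) (use \<open>A \<noteq> \<infinity>\<close> in \<open>simp add: A_def\<close>)
  then have ne: "AE p in ?M. fst p \<noteq> snd p"
    by eventually_elim auto
  have "(\<integral>\<^sup>+ p. ennreal (log_kernel p) \<partial>?M) = A"
    unfolding A_def by (rule nn_integral_cong_AE) (use ne in eventually_elim, auto)
  then have k: "integrable ?M log_kernel"
    using \<open>A \<noteq> \<infinity>\<close> log_kernel_ge_0 by (intro integrableI_nonneg) (auto simp: less_top)
  have \<phi>: "integrable \<mu> ?h"
    using \<open>P \<noteq> \<infinity>\<close> Q by (simp add: real_integrable_def P_def Q_def)
  define d where "d z = log_max l z - psi0 z" for z
  have [measurable]: "d \<in> borel_measurable borel" by (simp add: d_def[abs_def])
  have d: "integrable \<mu> d"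
    by (rule integrable_const_bound[of _ c]) (use c in \<open>auto simp: d_def\<close>)
  note d1 = integral_pair_fst[OF d] and d2 = integral_pair_snd[OF d]
  have f: "ln ((cmod (fst p - snd p))^2) - log_max l (fst p) - log_max l (snd p) = - log_kernel p - d (fst p) - d (snd p)" for p
    by (simp add: log_kernel_def d_def)
  have "(\<integral>p. - log_kernel p - d (fst p) - d (snd p) \<partial>?M) \<le> - ln l"
    unfolding f[symmetric]
    by (rule log_energy_le[OF l prob_space_axioms prob_measuresD(2)[OF \<mu>] ne]) (unfold f, use k d1 d2 in auto)
  then have E: "(\<integral>p. log_kernel p \<partial>?M) \<ge> ln l - 2 * (\<integral>z. d z \<partial>\<mu>)"
    using k d1 d2 by simp
  have u: "integrable \<mu> (\<lambda>z. max 0 (1 - l * (cmod z)^2))"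
    by (rule integrable_const_bound[of _ 1]) (use l in auto)
  have "(\<integral>z. 1 + d z \<partial>\<mu>) \<le> (\<integral>z. ?h z + max 0 (1 - l * (cmod z)^2) \<partial>\<mu>)"
  proof (rule integral_mono)
    show "1 + d z \<le> ?h z + max 0 (1 - l * (cmod z)^2)" for z
      using ln_le_minus_one[of "max (l * (cmod z)^2) 1"] by (auto simp: d_def log_max_def max_def)
  qed (use d \<phi> u in auto)
  then have "1 + (\<integral>z. d z \<partial>\<mu>) \<le> (\<integral>z. ?h z \<partial>\<mu>)
      + (\<integral>z. max 0 (1 - l * (cmod z)^2) \<partial>\<mu>)"
    using d \<phi> u by (simp add: prob_space)
  with E show ?thesis
    unfolding energy_eq[OF ne k \<phi>] by simp
qed simp

section \<open>The energy of the uniform measure on a disc\<close>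

lemma power_diff_ge:
  fixes a b :: real
  assumes "0 \<le> b" "b \<le> a"
  shows "a ^ n * (a^2 - b^2) \<le> a ^ (n + 2) - b ^ (n + 2)"
proof -
  have "b ^ n * b^2 \<le> a ^ n * b^2" using assms by (intro mult_right_mono power_mono) auto
  then show ?thesis unfolding power_add right_diff_distrib by linarith
qed

text \<open>Quantitative form of the fact that \<open>1 / n * log (|z^n - w^n|)\<close> tends to \<open>log (max |z| |w|)\<close>.\<close>

lemma ln_cmod_power_diff_ge:
  assumes n: "n \<ge> 2" and ne: "cmod z \<noteq> cmod w"
    and z: "(cmod z)^2 \<le> \<rho>" and w: "(cmod w)^2 \<le> \<rho>"
  shows "real n * ln (max ((cmod z)^2) ((cmod w)^2)) - 4 * (\<rho> / \<bar>(cmod w)^2 - (cmod z)^2\<bar>) powr (1 / 2)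
    \<le> ln ((cmod (z ^ n - w ^ n))^2)"
proof -
  have main: "real n * ln (a^2) - 4 * (\<rho> / (a^2 - b^2)) powr (1 / 2) \<le> ln (x^2)"
    if ab: "0 \<le> b" "b < a" "a^2 \<le> \<rho>" and x: "a ^ n - b ^ n \<le> x" for a b x
  proof -
    obtain m where m: "n = m + 2" using n by (metis add.commute le_Suc_ex)
    have a: "a > 0" using ab by linarith
    have d: "a^2 - b^2 > 0" using ab by (simp add: power_strict_mono)
    have \<rho>: "\<rho> > 0" using a ab by (smt (verit) zero_less_power)
    have "a ^ m * (a^2 - b^2) \<le> x"
      using power_diff_ge[of b a m] ab x by (simp add: m)
    moreover have "a ^ n * ((a^2 - b^2) / \<rho>) \<le> a ^ n * ((a^2 - b^2) / a^2)"
      using ab a d \<rho> by (intro mult_left_mono divide_left_mono) auto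
    moreover have "a ^ n * ((a^2 - b^2) / a^2) = a ^ m * (a^2 - b^2)"
      using a by (simp add: m power_add power2_eq_square)
    ultimately have le: "a ^ n * ((a^2 - b^2) / \<rho>) \<le> x" by linarith
    have pos: "a ^ n * ((a^2 - b^2) / \<rho>) > 0" using a d \<rho> by simp
    have "ln (a ^ n * ((a^2 - b^2) / \<rho>)) \<le> ln x" by (rule ln_mono[OF le pos])
    moreover have "ln (a ^ n * ((a^2 - b^2) / \<rho>)) = real n * ln a - ln (\<rho> / (a^2 - b^2))"
      using a d \<rho> by (subst ln_mult_pos) (auto simp: ln_realpow ln_div)
    \<comment> \<open>From ln y <= y - 1 at the square root. The logarithm is traded for a power
      whose singularity at equal radii is integrable.\<close>
    moreover have "ln (\<rho> / (a^2 - b^2)) \<le> 2 * (\<rho> / (a^2 - b^2)) powr (1 / 2)"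
    proof -
      have "ln ((\<rho> / (a^2 - b^2)) powr (1 / 2)) \<le> (\<rho> / (a^2 - b^2)) powr (1 / 2) - 1"
        using d \<rho> by (intro ln_le_minus_one) simp
      then show ?thesis using d \<rho> by (simp add: ln_powr)
    qed
    moreover have "ln (a^2) = 2 * ln a" "ln (x^2) = 2 * ln x"
      using a pos le by (auto simp: ln_realpow)
    ultimately show ?thesis by (simp add: mult.left_commute)
  qed
  consider "cmod w < cmod z" | "cmod z < cmod w" using ne by linarith
  then show ?thesis
  proof cases
    case 1
    have "(cmod z) ^ n - (cmod w) ^ n \<le> cmod (z ^ n - w ^ n)"
      using norm_triangle_ineq2[of "z ^ n" "w ^ n"] by (simp add: norm_power)
    from main[OF norm_ge_zero 1 z this] show ?thesis
      using 1 by (simp add: max_def abs_if power_strict_mono)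
  next
    case 2
    have "(cmod w) ^ n - (cmod z) ^ n \<le> cmod (z ^ n - w ^ n)"
      using norm_triangle_ineq2[of "w ^ n" "z ^ n"] by (simp add: norm_power norm_minus_commute)
    note * = main[OF norm_ge_zero 2 w this]
    show ?thesis
    proof -
      have "(cmod z)^2 < (cmod w)^2" using 2 by (simp add: power_strict_mono)
      with * 2 show ?thesis by (simp add: max_def abs_if)
    qed
  qed
qed

text \<open>After a shift by \<open>a\<close>, the integrals on both sides of the singularity are
  dominated by that of y^(-1/2) over (0, rho].\<close>

lemma nn_integral_inverse_sqrt_dist:
  assumes \<rho>: "\<rho> > 0" and a: "0 \<le> a" "a \<le> \<rho>"
  shows "(\<integral>\<^sup>+ s. ennreal ((\<rho> / \<bar>s - a\<bar>) powr (1 / 2)) * indicator {0..\<rho>} s \<partial>lborel) < \<infinity>"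
proof -
  let ?f = "\<lambda>y. ennreal ((\<rho> / \<bar>y\<bar>) powr (1 / 2))"
  let ?I = "\<integral>\<^sup>+ y. ?f y * indicator {0..\<rho>} y \<partial>lborel"
  let ?I' = "\<integral>\<^sup>+ y. ?f y * indicator {0..\<rho>} (- y) \<partial>lborel"
  have fin: "?I < \<infinity>"
  proof -
    have "((\<lambda>y. \<rho> powr (1 / 2) * y powr (- 1 / 2)) has_integral (\<rho> powr (1 / 2) * (\<rho> powr (- 1 / 2
        + 1) / (- 1 / 2 + 1)))) {0..\<rho>}"
      using has_integral_powr_from_0[of "- 1 / 2" \<rho>] \<rho> by (intro has_integral_mult_right) auto
    from nn_integral_has_integral_lebesgue[OF _ this]
    have "(\<integral>\<^sup>+ y. ennreal (indicator {0..\<rho>} y * (\<rho> powr (1 / 2) * y powr (- 1 / 2))) \<partial>lborel) < \<infinity>"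
      by simp
    moreover have "?f y * indicator {0..\<rho>} y = ennreal (indicator {0..\<rho>} y * (\<rho> powr (1 / 2) * y powr (- 1 / 2)))" for y
    proof (cases "y \<in> {0..\<rho>}")
      case True
      then have "(\<rho> / \<bar>y\<bar>) powr (1 / 2) = \<rho> powr (1 / 2) * inverse (y powr (1 / 2))"
        using \<rho> by (simp only: abs_of_nonneg atLeastAtMost_iff powr_divide less_imp_le divide_inverse[of "\<rho> powr _"])
      also have "inverse (y powr (1 / 2)) = y powr (- 1 / 2)" using powr_minus[of y "1 / 2"] by simp
      finally show ?thesis using True by simp
    qed simp
    ultimately show ?thesis by simp
  qed
  have "(\<integral>\<^sup>+ s. ?f (s - a) * indicator {0..\<rho>} s \<partial>lborel)
      = (\<integral>\<^sup>+ y. ?f y * indicator {0..\<rho>} (a + y) \<partial>lborel)"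
    by (subst nn_integral_real_affine[of _ 1 a]) auto
  also have "\<dots> \<le> (\<integral>\<^sup>+ y. ?f y * indicator {0..\<rho>} y + ?f y * indicator {0..\<rho>} (- y) \<partial>lborel)"
    using a by (intro nn_integral_mono) (auto simp: indicator_def)
  also have "\<dots> = ?I + ?I'"
    by (rule nn_integral_add) auto
  also have "?I' = ?I"
    by (subst nn_integral_real_affine[of _ "- 1" 0]) auto
  finally show ?thesis using fin by (auto simp: less_top[symmetric] top_unique)
qed

text \<open>The radial average that replaces log |z - w|^2 in the limit n -> infinity, with a =
  |z|^2; the offset \<open>c\<close> keeps the integrand nonnegative.\<close>

lemma nn_integral_log_max:
  assumes a: "0 < a" "a \<le> \<rho>" and c: "ln \<rho> \<le> c"
  shows "(\<integral>\<^sup>+ s. ennreal (c - ln (max a s)) * indicator {0..\<rho>} s \<partial>lborel) = ennreal (\<rho> * (c - ln \<rho> + 1) - a)"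
proof -
  let ?J = "c * \<rho> - (\<rho> * ln \<rho> - \<rho>) - (c * a - (a * ln a - a))"
  let ?I1 = "\<integral>\<^sup>+ s. ennreal (c - ln a) * indicator {0..<a} s \<partial>lborel"
  let ?I2 = "\<integral>\<^sup>+ s. ennreal (c - ln s) * indicator {a..\<rho>} s \<partial>lborel"
  have le: "ln x \<le> c" if "0 < x" "x \<le> \<rho>" for x using ln_mono[OF that(2,1)] c by linarith
  have "(\<integral>\<^sup>+ s. ennreal (c - ln (max a s)) * indicator {0..\<rho>} s \<partial>lborel)
    = (\<integral>\<^sup>+ s. ennreal (c - ln a) * indicator {0..<a} s + ennreal (c - ln s) * indicator {a..\<rho>} s \<partial>lborel)"
    using a by (intro nn_integral_cong) (auto simp: indicator_def max_def)
  also have "\<dots> = ?I1 + ?I2"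
    by (rule nn_integral_add) auto
  also have "?I1 = ennreal ((c - ln a) * a)"
    using a le[of a] by (simp add: nn_integral_cmult_indicator ennreal_mult'')
  also have "?I2
      = ennreal ?J"
  proof (rule nn_integral_FTC_Icc)
    fix x assume "x \<in> {a..\<rho>}"
    then have x: "0 < x" "x \<le> \<rho>" using a by auto
    then show "((\<lambda>x. c * x - (x * ln x - x)) has_real_derivative c - ln x) (at x)"
      by (auto intro!: derivative_eq_intros)
    show "0 \<le> c - ln x" using le[OF x] by simp
  qed (use a in auto)
  also have "ennreal ((c - ln a) * a) + ennreal ?J
      = ennreal (((c - ln a) * a) + ?J)"
  proof (rule ennreal_plus[symmetric])
    show "0 \<le> (c - ln a) * a" using a le[of a] by simp
    have "a * ln \<rho> - a * ln a \<le> \<rho> - a"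
      using ln_le_minus_one[of "\<rho> / a"] a by (simp add: ln_div field_simps)
    moreover have "0 \<le> (\<rho> - a) * (c - ln \<rho>)" using a c by simp
    ultimately show "0 \<le> ?J"
      by (simp add: algebra_simps)
  qed
  finally show ?thesis by (simp add: algebra_simps)
qed

text \<open>For rho = 1 / l, \<open>U\<close> is the circular law, which serves as trial measure for
  the potential l |z|^2.\<close>

locale disc =
  fixes \<rho> :: real and S :: "complex set" and U :: "complex measure"
  assumes \<rho>: "\<rho> > 0"
  defines "S \<equiv> {z. (cmod z)^2 \<in> {0..\<rho>}}" and "U \<equiv> uniform_measure lborel S"
begin

lemma S_measurable [measurable]: "S \<in> sets borel"
  unfolding S_def by measurable

lemma emeasure_S: "emeasure lborel S = ennreal (pi * \<rho>)"
  unfolding S_def using \<rho> by (subst emeasure_radial_set) (auto simp: ennreal_mult'[symmetric])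

lemma sets_U [measurable_cong]: "sets U = sets borel"
  by (simp add: U_def)

lemma prob_U: "prob_space U"
  unfolding U_def using \<rho> by (intro prob_space_uniform_measure) (auto simp: emeasure_S)

sublocale prob_space U by (rule prob_U)
sublocale PP: pair_prob_space U U ..

lemma U_in_prob_measures: "U \<in> prob_measures"
  by (simp add: prob_measures_def prob_U sets_U)

lemma AE_U: "(AE z in U. P z) \<longleftrightarrow> (AE z in lborel. z \<in> S \<longrightarrow> P z)"
  unfolding U_def using \<rho> by (intro AE_uniform_measure) (auto simp: emeasure_S)

lemma AE_S: "AE z in U. (cmod z)^2 \<le> \<rho>"
  unfolding AE_U by (auto simp: S_def)

lemma AE_notin_finite: "finite A \<Longrightarrow> AE z in U. z \<notin> A"
  unfolding AE_U using AE_not_in[OF finite_imp_null_set_lborel, of A] by auto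

lemma AE_neq: "AE w in U. w \<noteq> z"
  using AE_notin_finite[of "{z}"] by simp

lemma rotation_invariant_U: "rotation_invariant U"
  unfolding U_def S_def by (rule rotation_invariant_uniform_measure) simp

lemma nn_integral_U_radial:
  assumes [measurable]: "h \<in> borel_measurable borel"
  shows "(\<integral>\<^sup>+ z. h ((cmod z)^2) \<partial>U)
      = ennreal (1 / \<rho>) * (\<integral>\<^sup>+ s. h s * indicator {0..\<rho>} s \<partial>lborel)"
proof -
  have "(\<integral>\<^sup>+ z. h ((cmod z)^2) \<partial>U)
      = (\<integral>\<^sup>+ z. h ((cmod z)^2) * indicator S z \<partial>lborel) / ennreal (pi * \<rho>)"
    unfolding U_def by (subst nn_integral_uniform_measure) (auto simp: emeasure_S)
  also have "(\<integral>\<^sup>+ z. h ((cmod z)^2) * indicator S z \<partial>lborel)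
      = (\<integral>\<^sup>+ z. h ((cmod z)^2) * indicator {0..\<rho>} ((cmod z)^2) \<partial>(lborel :: complex measure))"
    by (intro nn_integral_cong) (simp add: S_def indicator_def)
  also have "\<dots> = ennreal pi * (\<integral>\<^sup>+ x. h x * indicator {0..\<rho>} x * indicator {0..} x \<partial>lborel)"
    by (rule nn_integral_radial) simp
  also have "(\<integral>\<^sup>+ x. h x * indicator {0..\<rho>} x * indicator {0..} x \<partial>lborel)
      = (\<integral>\<^sup>+ x. h x * indicator {0..\<rho>} x \<partial>lborel)"
    by (intro nn_integral_cong) (auto simp: indicator_def)
  also have "ennreal pi * I / ennreal (pi * \<rho>) = ennreal (1 / \<rho>) * I" for I
  proof -
    have "ennreal pi * I / ennreal (pi * \<rho>) = ennreal pi / ennreal (pi * \<rho>) * I"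
      by (simp add: divide_ennreal_def mult_ac)
    also have "ennreal pi / ennreal (pi * \<rho>) = ennreal (1 / \<rho>)"
      using \<rho> by (subst divide_ennreal) auto
    finally show ?thesis .
  qed
  finally show ?thesis .
qed

lemma AE_cmod_neq: "AE w in U. (cmod w)^2 \<noteq> a"
proof -
  have "(\<integral>\<^sup>+ z. indicator {a} ((cmod z)^2) \<partial>U)
      = ennreal (1 / \<rho>) * (\<integral>\<^sup>+ s. indicator {a} s * indicator {0..\<rho>} s \<partial>lborel)"
    by (rule nn_integral_U_radial) simp
  also have "(\<integral>\<^sup>+ s. indicator {a} s * indicator {0..\<rho>} s \<partial>lborel)
      \<le> (\<integral>\<^sup>+ s. indicator {a} s \<partial>(lborel :: real measure))"
    by (intro nn_integral_mono) (auto simp: indicator_def)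
  finally have "(\<integral>\<^sup>+ z. indicator {a} ((cmod z)^2) \<partial>U) = 0" by (simp add: mult_left_mono)
  then have "AE z in U. indicator {a} ((cmod z)^2) = (0 :: ennreal)"
    by (subst (asm) nn_integral_0_iff_AE) auto
  then show ?thesis by eventually_elim (auto simp: indicator_def)
qed

text \<open>On the disc |z^n - w^n|^2 is at most 4 rho^n, hence at most (4 rho)^n for n > 0. So the
  offset n c makes the integrand of \<open>F n\<close> nonnegative (almost everywhere), and being
  linear in n it respects the doubling of n.\<close>

definition c :: real where "c = ln (4 * \<rho>)"

definition F :: "nat \<Rightarrow> complex \<Rightarrow> ennreal" where
  "F n z = (\<integral>\<^sup>+ w. ennreal (real n * c - ln ((cmod (z ^ n - w ^ n))^2)) \<partial>U)"

lemma ln_power_diff_le: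
  assumes n: "n > 0" and z: "(cmod z)^2 \<le> \<rho>" and w: "(cmod w)^2 \<le> \<rho>" and x: "cmod x \<le> cmod z ^ n + cmod w ^ n" "x \<noteq> 0"
  shows "ln ((cmod x)^2) \<le> real n * c"
proof -
  have "(cmod x)^2 \<le> (2 * sqrt \<rho> ^ n)^2"
  proof (intro power_mono)
    have "cmod z ^ n \<le> sqrt \<rho> ^ n" "cmod w ^ n \<le> sqrt \<rho> ^ n"
      using z w by (auto intro!: power_mono real_le_rsqrt)
    then show "cmod x \<le> 2 * sqrt \<rho> ^ n" using x by linarith
  qed simp
  also have "\<dots> = 4 * \<rho> ^ n"
    using \<rho> by (simp add: power_mult_distrib power_mult[symmetric] mult.commute[of n 2] power_mult real_sqrt_pow2_iff)
  also have "\<dots> \<le> (4 * \<rho>) ^ n"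
    using \<rho> n self_le_power[of 4 n] by (simp add: power_mult_distrib)
  finally have "(cmod x)^2 \<le> (4 * \<rho>) ^ n" .
  then have "ln ((cmod x)^2) \<le> ln ((4 * \<rho>) ^ n)" using x by (intro ln_mono) auto
  also have "ln ((4 * \<rho>) ^ n) = real n * c"
    unfolding c_def using \<rho> by (intro ln_realpow)
  finally show ?thesis .
qed

text \<open>Since \<open>z^(2n) - w^(2n) = (z^n - w^n) (z^n + w^n)\<close> and rotation by a root of \<open>-1\<close> exchanges
  the two factors, the mean of \<open>log |z^n - w^n| / n\<close> is unchanged under doubling of \<open>n\<close>. In the
  limit this gives the logarithmic potential of the disc.\<close>

lemma F_double:
  assumes n: "n > 0" and z: "(cmod z)^2 \<le> \<rho>"
  shows "F (2 * n) z = 2 * F n z"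
proof -
  define \<zeta> where "\<zeta> = cis (pi / real n)"
  have \<zeta>: "cmod \<zeta> = 1" by (simp add: \<zeta>_def)
  have \<zeta>n: "\<zeta> ^ n = - 1" unfolding \<zeta>_def Complex.DeMoivre using n by simp
  let ?f = "\<lambda>w. ennreal (real n * c - ln ((cmod (z ^ n - w ^ n))^2))"
  let ?g = "\<lambda>w. ennreal (real n * c - ln ((cmod (z ^ n + w ^ n))^2))"
  have [measurable]: "?f \<in> borel_measurable borel" "?g \<in> borel_measurable borel" by measurable
  have "(\<integral>\<^sup>+ w. ?f w \<partial>U) = (\<integral>\<^sup>+ w. ?f w \<partial>(distr U borel ((*) \<zeta>)))"
    using rotation_invariant_U \<zeta> by (simp add: rotation_invariant_def)
  also have "\<dots> = (\<integral>\<^sup>+ w. ?f (\<zeta> * w) \<partial>U)"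
    by (subst nn_integral_distr) auto
  also have "\<dots> = (\<integral>\<^sup>+ w. ?g w \<partial>U)"
    by (simp add: power_mult_distrib \<zeta>n)
  finally have fg: "(\<integral>\<^sup>+ w. ?g w \<partial>U) = F n z" by (simp add: F_def)
  have "finite {w :: complex. w ^ n = z ^ n}" "finite {w :: complex. w ^ n = - (z ^ n)}"
    using n by (auto intro: finite_nth_roots)
  from AE_notin_finite[OF this(1)] AE_notin_finite[OF this(2)] AE_S
  have "AE w in U. ennreal (real (2 * n) * c - ln ((cmod (z ^ (2 * n) - w ^ (2 * n)))^2)) = ?f w + ?g w"
  proof eventually_elim
    case (elim w)
    then have ne: "z ^ n - w ^ n \<noteq> 0" "z ^ n + w ^ n \<noteq> 0"
      by (auto simp: add_eq_0_iff) 
    have "z ^ (2 * n) - w ^ (2 * n) = (z ^ n - w ^ n) * (z ^ n + w ^ n)"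
      by (simp add: power_mult[symmetric] mult.commute[of 2] power_mult power2_eq_square algebra_simps)
    then have "ln ((cmod (z ^ (2 * n) - w ^ (2 * n)))^2) = ln ((cmod (z ^ n - w ^ n))^2) + ln ((cmod (z ^ n + w ^ n))^2)"
      using ne by (simp add: norm_mult power_mult_distrib ln_mult_pos)
    moreover have "ln ((cmod (z ^ n - w ^ n))^2) \<le> real n * c"
      by (rule ln_power_diff_le[OF n z elim(3) _ ne(1)]) (metis norm_power norm_triangle_ineq4)
    moreover have "ln ((cmod (z ^ n + w ^ n))^2) \<le> real n * c"
      by (rule ln_power_diff_le[OF n z elim(3) _ ne(2)]) (metis norm_power norm_triangle_ineq)
    ultimately show ?case by (subst ennreal_plus[symmetric]) (auto simp: algebra_simps)
  qed
  then have "F (2 * n) z = (\<integral>\<^sup>+ w. ?f w + ?g w \<partial>U)"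
    unfolding F_def by (rule nn_integral_cong_AE)
  also have "\<dots> = (\<integral>\<^sup>+ w. ?f w \<partial>U) + (\<integral>\<^sup>+ w. ?g w \<partial>U)"
    by (rule nn_integral_add) auto
  also have "\<dots> = 2 * F n z" unfolding fg by (simp add: F_def mult_2)
  finally show ?thesis .
qed

lemma F_power2: "(cmod z)^2 \<le> \<rho> \<Longrightarrow> F (2 ^ k) z = ennreal (2 ^ k) * F 1 z"
proof (induction k)
  case (Suc k)
  have "F (2 ^ Suc k) z = 2 * F (2 ^ k) z" using F_double[of "2 ^ k" z] Suc.prems by simp
  also have "\<dots> = ennreal 2 * (ennreal (2 ^ k) * F 1 z)" using Suc by simp
  also have "\<dots> = ennreal (2 ^ Suc k) * F 1 z"
    by (simp only: mult.assoc[symmetric] ennreal_mult'[symmetric] zero_le_numeral power_Suc)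
  finally show ?case .
qed simp

text \<open>By doubling, \<open>F 1 z\<close> is 2^(-k) times \<open>F (2^k) z\<close>. For large
  powers |z^n - w^n| is governed by the larger modulus, up to an error whose integral does not
  depend on k and disappears after division by 2^k.\<close>

lemma F_1_le:
  assumes z: "z \<noteq> 0" "(cmod z)^2 \<le> \<rho>"
  shows "F 1 z \<le> ennreal (c - ln \<rho> + 1 - (cmod z)^2 / \<rho>)"
proof -
  define a where "a = (cmod z)^2"
  have a: "0 < a" "a \<le> \<rho>" using z by (auto simp: a_def)
  \<comment> \<open>The mean of c - ln (max a s) for s uniform on [0, rho], the law of |w|^2 under
    \<open>U\<close>.\<close>
  define p where "p = c - ln \<rho> + 1 - a / \<rho>"
  have c\<rho>: "ln \<rho> \<le> c" using \<rho> by (simp add: c_def)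
  have "a / \<rho> \<le> 1" using a \<rho> by simp
  then have p: "p \<ge> 0" using c\<rho> by (simp add: p_def)
  have le: "ln (max a s) \<le> c" if "s \<le> \<rho>" for s
  proof -
    have "ln (max a s) \<le> ln \<rho>" using that a by (intro ln_mono) (auto simp: max_def)
    then show ?thesis using c\<rho> by linarith
  qed
  let ?m = "\<lambda>w. c - ln (max a ((cmod w)^2))"
  have Pot: "(\<integral>\<^sup>+ w. ennreal (?m w) \<partial>U) = ennreal p"
  proof -
    have "(\<integral>\<^sup>+ w. ennreal (?m w) \<partial>U) = ennreal (1 / \<rho>) * ennreal (\<rho> * (c - ln \<rho> + 1) - a)"
      by (subst nn_integral_U_radial[of "\<lambda>s. ennreal (c - ln (max a s))"]) (auto simp: nn_integral_log_max[OF a c\<rho>])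
    also have "\<dots> = ennreal (1 / \<rho> * (\<rho> * (c - ln \<rho> + 1) - a))"
      using \<rho> by (subst ennreal_mult') auto
    also have "1 / \<rho> * (\<rho> * (c - ln \<rho> + 1) - a) = p"
      using \<rho> by (simp add: p_def field_simps)
    finally show ?thesis .
  qed
  let ?r = "\<lambda>w. (\<rho> / \<bar>(cmod w)^2 - a\<bar>) powr (1 / 2)"
  define R where "R = (\<integral>\<^sup>+ w. ennreal (4 * ?r w) \<partial>U)"
  have "R = (\<integral>\<^sup>+ w. ennreal 4 * ennreal (?r w) \<partial>U)"
    unfolding R_def by (simp add: ennreal_mult')
  also have "\<dots> = ennreal 4 * (\<integral>\<^sup>+ w. ennreal (?r w) \<partial>U)"
    by (rule nn_integral_cmult) measurable
  also have "(\<integral>\<^sup>+ w. ennreal (?r w) \<partial>U)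
      = ennreal (1 / \<rho>) * (\<integral>\<^sup>+ s. ennreal ((\<rho> / \<bar>s - a\<bar>) powr (1 / 2)) * indicator {0..\<rho>} s \<partial>lborel)"
    by (rule nn_integral_U_radial) measurable
  also have "ennreal 4 * \<dots> < \<infinity>"
    using nn_integral_inverse_sqrt_dist[OF \<rho>, of a] a by (auto simp: ennreal_mult_less_top)
  finally have "R < \<infinity>" .
  then obtain r where r: "R = ennreal r" "r \<ge> 0" by (cases R) auto
  have step: "ennreal (2 ^ k) * F 1 z \<le> ennreal (2 ^ k * p + r)" if k: "k \<ge> 1" for k
  proof -
    let ?n = "2 ^ k :: nat"
    have n2: "?n \<ge> 2" using k self_le_power[of 2 k] by simp
    have "ennreal (2 ^ k) * F 1 z = F ?n z" using z by (simp add: F_power2)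
    also have "\<dots> \<le> (\<integral>\<^sup>+ w. ennreal (2 ^ k) * ennreal (?m w)
        + ennreal (4 * ?r w) \<partial>U)"
      unfolding F_def
    proof (rule nn_integral_mono_AE)
      show "AE w in U. ennreal (real ?n * c - ln ((cmod (z ^ ?n - w ^ ?n))^2))
        \<le> ennreal (2 ^ k) * ennreal (?m w) + ennreal (4 * ?r w)"
        using AE_cmod_neq[of a] AE_S
      proof eventually_elim
        case (elim w)
        then have "cmod z \<noteq> cmod w" by (auto simp: a_def)
        from ln_cmod_power_diff_ge[OF n2 this z(2) elim(2)]
        have "real ?n * c - ln ((cmod (z ^ ?n - w ^ ?n))^2)
          \<le> 2 ^ k * (?m w) + 4 * ?r w"
          by (simp add: a_def right_diff_distrib)
        moreover have "ennreal (2 ^ k) * ennreal (?m w) + ennreal (4 * ?r w)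
          = ennreal (2 ^ k * (?m w) + 4 * ?r w)"
          using le[OF elim(2)] by (subst ennreal_plus) (auto simp: ennreal_mult')
        ultimately show ?case by (simp add: ennreal_leI)
      qed
    qed
    also have "\<dots> = (\<integral>\<^sup>+ w. ennreal (2 ^ k) * ennreal (?m w) \<partial>U) + R"
      unfolding R_def by (rule nn_integral_add) measurable
    also have "(\<integral>\<^sup>+ w. ennreal (2 ^ k) * ennreal (?m w) \<partial>U) = ennreal (2 ^ k) * ennreal p"
      unfolding Pot[symmetric] by (rule nn_integral_cmult) measurable
    also have "ennreal (2 ^ k) * ennreal p + R = ennreal (2 ^ k * p + r)"
      using p r by (simp add: ennreal_mult')
    finally show ?thesis .
  qed
  have "F 1 z \<noteq> \<infinity>" using step[of 1] by (auto simp: ennreal_mult_top top_unique)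
  then obtain f where f: "F 1 z = ennreal f" "f \<ge> 0" by (cases "F 1 z") auto
  have "f \<le> p + r * (1 / 2) ^ k" if "k \<ge> 1" for k
  proof -
    have "2 ^ k * f \<le> 2 ^ k * p + r"
      using step[OF that] f p r by (simp add: ennreal_mult'[symmetric] ennreal_le_iff del: ennreal_plus)
    then have "f \<le> (2 ^ k * p + r) / 2 ^ k" by (simp add: field_simps)
    then show ?thesis by (simp add: add_divide_distrib power_divide)
  qed
  moreover have "(\<lambda>k. p + r * (1 / 2) ^ k) \<longlonglongrightarrow> p + r * 0"
    by (intro tendsto_intros LIMSEQ_realpow_zero) auto
  ultimately have "f \<le> p + r * 0" by (intro LIMSEQ_le_const) auto
  then show ?thesis unfolding f p_def a_def by (simp add: ennreal_leI)
qed

lemma mean_square: "has_bochner_integral U (\<lambda>z. (cmod z)^2) (\<rho> / 2)"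
proof -
  have "(\<integral>\<^sup>+ z. ennreal ((cmod z)^2) \<partial>U)
      = ennreal (1 / \<rho>) * (\<integral>\<^sup>+ s. ennreal s * indicator {0..\<rho>} s \<partial>lborel)"
    by (rule nn_integral_U_radial) simp
  also have "(\<integral>\<^sup>+ s. ennreal s * indicator {0..\<rho>} s \<partial>lborel) = ennreal (\<rho>^2 / 2 - 0^2 / 2)"
    by (rule nn_integral_FTC_Icc) (use \<rho> in \<open>auto intro!: derivative_eq_intros\<close>)
  also have "ennreal (1 / \<rho>) * ennreal (\<rho>^2 / 2 - 0^2 / 2) = ennreal (\<rho> / 2)"
    using \<rho> by (simp add: ennreal_mult'[symmetric] power2_eq_square)
  finally show ?thesis
    using \<rho> by (intro has_bochner_integral_nn_integral) auto
qed

lemma AE_pair_neq: "AE p in U \<Otimes>\<^sub>M U. fst p \<noteq> snd p"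
proof (rule PP.AE_pair_measure)
  show "{p \<in> space (U \<Otimes>\<^sub>M U). fst p \<noteq> snd p} \<in> sets (U \<Otimes>\<^sub>M U)" by measurable
  show "AE z in U. AE w in U. fst (z, w) \<noteq> snd (z, w)"
  proof (rule AE_I2)
    fix z
    show "AE w in U. fst (z, w) \<noteq> snd (z, w)" using AE_neq[of z] by eventually_elim auto
  qed
qed

text \<open>Averages the bound on the potential \<open>F 1\<close> over the disc, where |z|^2 / rho
  has mean 1 / 2. Only this one-sided estimate is used, because an upper bound on the energy is
  wanted.\<close>

lemma log_energy:
  "integrable (U \<Otimes>\<^sub>M U) (\<lambda>p. ln ((cmod (fst p - snd p))^2))"
  "(\<integral>p. ln ((cmod (fst p - snd p))^2) \<partial>(U \<Otimes>\<^sub>M U)) \<ge> ln \<rho> - 1 / 2"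
proof -
  let ?h = "\<lambda>p. c - ln ((cmod (fst p - snd p))^2)"
  have nonneg: "AE p in U \<Otimes>\<^sub>M U. 0 \<le> ?h p"
  proof (rule PP.AE_pair_measure)
    show "{p \<in> space (U \<Otimes>\<^sub>M U). 0 \<le> ?h p} \<in> sets (U \<Otimes>\<^sub>M U)" by measurable
    show "AE z in U. AE w in U. 0 \<le> ?h (z, w)"
      using AE_S
    proof eventually_elim
      case (elim z)
      show ?case
        using AE_S AE_neq[of z]
      proof eventually_elim
        case (elim w)
        then show ?case
          using ln_power_diff_le[of 1 z w "z - w"] \<open>(cmod z)^2 \<le> \<rho>\<close> norm_triangle_ineq4[of z w] by auto
      qed
    qed
  qed
  have c\<rho>: "ln \<rho> \<le> c" using \<rho> by (simp add: c_def)
  have "(\<integral>\<^sup>+ p. ennreal (?h p) \<partial>(U \<Otimes>\<^sub>M U)) = (\<integral>\<^sup>+ z. F 1 z \<partial>U)"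
    unfolding F_def by (subst nn_integral_fst[symmetric]) auto
  also have "\<dots> \<le> (\<integral>\<^sup>+ z. ennreal (c - ln \<rho> + 1 - (cmod z)^2 / \<rho>) \<partial>U)"
  proof (rule nn_integral_mono_AE)
    show "AE z in U. F 1 z \<le> ennreal (c - ln \<rho> + 1 - (cmod z)^2 / \<rho>)"
      using AE_neq[of 0] AE_S by eventually_elim (rule F_1_le)
  qed
  also have "\<dots> = ennreal (\<integral>z. c - ln \<rho> + 1 - (cmod z)^2 / \<rho> \<partial>U)"
  proof (rule nn_integral_eq_integral)
    show "integrable U (\<lambda>z. c - ln \<rho> + 1 - (cmod z)^2 / \<rho>)"
      using mean_square by (auto simp: has_bochner_integral_iff)
    show "AE z in U. 0 \<le> c - ln \<rho> + 1 - (cmod z)^2 / \<rho>"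
      using AE_S
    proof eventually_elim
      case (elim z)
      then have "(cmod z)^2 / \<rho> \<le> 1" using \<rho> by simp
      then show ?case using c\<rho> by linarith
    qed
  qed
  also have "(\<integral>z. c - ln \<rho> + 1 - (cmod z)^2 / \<rho> \<partial>U) = c - ln \<rho> + 1 / 2"
    using mean_square \<rho> by (simp add: has_bochner_integral_iff prob_space)
  finally have le: "(\<integral>\<^sup>+ p. ennreal (?h p) \<partial>(U \<Otimes>\<^sub>M U)) \<le> ennreal (c - ln \<rho> + 1 / 2)" .
  then have h: "integrable (U \<Otimes>\<^sub>M U) ?h"
    using nonneg by (intro integrableI_nonneg) (auto intro: le_less_trans)
  have "integrable (U \<Otimes>\<^sub>M U) (\<lambda>p. c - ?h p)"
    by (intro Bochner_Integration.integrable_diff h) simp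
  moreover have "(\<lambda>p. c - ?h p) = (\<lambda>p. ln ((cmod (fst p - snd p))^2))" by (simp add: fun_eq_iff)
  ultimately show int: "integrable (U \<Otimes>\<^sub>M U) (\<lambda>p. ln ((cmod (fst p - snd p))^2))" by (simp only:)
  have "ennreal (\<integral>p. ?h p \<partial>(U \<Otimes>\<^sub>M U)) \<le> ennreal (c - ln \<rho> + 1 / 2)"
    using le nn_integral_eq_integral[OF h nonneg] by simp
  then have "(\<integral>p. ?h p \<partial>(U \<Otimes>\<^sub>M U)) \<le> c - ln \<rho> + 1 / 2"
    using c\<rho> by (subst (asm) ennreal_le_iff) auto
  then show "(\<integral>p. ln ((cmod (fst p - snd p))^2) \<partial>(U \<Otimes>\<^sub>M U)) \<ge> ln \<rho> - 1 / 2"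
    using int by (simp add: PP.prob_space)
qed

end

section \<open>The disc as trial measure for the free energy\<close>

context disc
begin

lemma psi0_integrable: "integrable U psi0"
proof (rule integrable_const_bound)
  show "AE z in U. norm (psi0 z) \<le> ln (1 + \<rho>)"
    using AE_S
  proof eventually_elim
    case (elim z)
    then have "psi0 z \<le> ln (1 + \<rho>)"
      unfolding psi0_def by (intro ln_mono) (auto intro: add_pos_nonneg)
    then show ?case using psi0_nonneg[of z] by simp
  qed
qed simp

text \<open>The \<open>psi0\<close> terms cancel. The interaction contributes at most (1 / 2 - ln
  rho) / 2 and the potential 1 / 2.\<close>

lemma energy_disc: "energy (\<lambda>z. 1 / \<rho> * (cmod z)^2) U \<le> ereal (3 / 4 - ln \<rho> / 2)"
proof -
  note p1 = integral_pair_fst[OF psi0_integrable] and p2 = integral_pair_snd[OF psi0_integrable]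
  have k: "integrable (U \<Otimes>\<^sub>M U) log_kernel"
    unfolding log_kernel_def[abs_def] by (intro Bochner_Integration.integrable_diff Bochner_Integration.integrable_add p1 p2 log_energy)
  have K: "(\<integral>p. log_kernel p \<partial>(U \<Otimes>\<^sub>M U)) = 2 * (\<integral>z. psi0 z \<partial>U)
      - (\<integral>p. ln ((cmod (fst p - snd p))^2) \<partial>(U \<Otimes>\<^sub>M U))"
    unfolding log_kernel_def[abs_def] using p1 p2 log_energy(1) by simp
  have sq: "integrable U (\<lambda>z. (cmod z)^2)" "(\<integral>z. (cmod z)^2 \<partial>U) = \<rho> / 2"
    using mean_square by (auto simp: has_bochner_integral_iff)
  have \<phi>: "integrable U (\<lambda>z. 1 / \<rho> * (cmod z)^2 - psi0 z)"
    by (intro Bochner_Integration.integrable_diff integrable_mult_right sq psi0_integrable)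
  have "(\<integral>z. 1 / \<rho> * (cmod z)^2 - psi0 z \<partial>U) = 1 / 2 - (\<integral>z. psi0 z \<partial>U)"
    using sq psi0_integrable \<rho> by (subst Bochner_Integration.integral_diff) auto
  then show ?thesis
    unfolding energy_eq[OF AE_pair_neq k \<phi>] K using log_energy(2) by (simp add: field_simps)
qed

lemma U_density: "U = density lborel (\<lambda>z. ennreal (indicator S z / (pi * \<rho>)))"
  unfolding U_def uniform_measure_def emeasure_S
  using \<rho> by (intro density_cong) (auto simp: indicator_def divide_ennreal[symmetric] ennreal_zero_divide)

lemma compact_S: "compact S"
proof -
  have "(cmod z)^2 \<le> \<rho> \<longleftrightarrow> cmod z \<le> sqrt \<rho>" for z
    using real_sqrt_le_iff[of "(cmod z)^2" \<rho>] unfolding real_sqrt_abs abs_norm_cancel ..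
  then have "S = cball 0 (sqrt \<rho>)"
    by (simp only: S_def set_eq_iff mem_Collect_eq mem_cball_0 atLeastAtMost_iff zero_le_power2 simp_thms)
  then show ?thesis by simp
qed

lemma L2loc_U:
  assumes v: "v \<in> L2loc"
  shows "integrable U (\<lambda>z. (v z)^2)" "integrable U v"
    "(LINT z|U. (v z)^2) = (LINT z:S|lborel. (v z)^2) / (pi * \<rho>)"
proof -
  have [measurable]: "v \<in> borel_measurable borel" using v by (simp add: L2loc_def)
  have S: "integrable lborel (\<lambda>z. indicator S z * (v z)^2)"
    using v compact_S by (auto simp: L2loc_def set_integrable_def)
  have d: "0 \<le> indicator S z / (pi * \<rho>)" for z using \<rho> by simp
  show sq: "integrable U (\<lambda>z. (v z)^2)"
    unfolding U_density using S d by (subst integrable_density) auto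
  show "integrable U v"
    by (rule square_integrable_imp_integrable[OF _ sq]) simp
  show "(LINT z|U. (v z)^2) = (LINT z:S|lborel. (v z)^2) / (pi * \<rho>)"
    unfolding U_density using d by (subst integral_density) (auto simp: set_lebesgue_integral_def)
qed

lemma L2loc_diff:
  assumes v: "v \<in> L2loc" and w: "w \<in> L2loc"
  shows "(\<lambda>z. v z - w z) \<in> L2loc"
  unfolding L2loc_def
proof (safe)
  have [measurable]: "v \<in> borel_measurable borel" "w \<in> borel_measurable borel"
    using v w by (auto simp: L2loc_def)
  show "(\<lambda>z. v z - w z) \<in> borel_measurable borel" by simp
  fix K :: "complex set" assume "compact K"
  then have [measurable]: "K \<in> sets borel" by (simp add: borel_compact)
  have i: "set_integrable lborel K (\<lambda>z. 2 * (v z)^2 + 2 * (w z)^2)"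
    using v w \<open>compact K\<close> by (intro set_integral_add set_integrable_mult_right) (auto simp: L2loc_def)
  show "set_integrable lborel K (\<lambda>z. (v z - w z)^2)"
  proof (rule set_integrable_bound[OF i])
    have "(v z - w z)^2 \<le> 2 * (v z)^2 + 2 * (w z)^2" for z
      using zero_le_power2[of "v z + w z"] by (simp add: power2_eq_square algebra_simps)
    then show "AE z\<in>K in lborel. norm ((v z - w z)^2) \<le> norm (2 * (v z)^2 + 2 * (w z)^2)"
      by (auto intro!: AE_I2)
    show "set_borel_measurable lborel K (\<lambda>z. (v z - w z)^2)"
      unfolding set_borel_measurable_def by measurable
  qed
qed

text \<open>\<open>U\<close> has a bounded density supported on the compact set \<open>S\<close>, so
  L2-convergence on \<open>S\<close> gives convergence of the means; nonnegativity of the variance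
  plays the part of Cauchy-Schwarz.\<close>

lemma continuous_extension_U: "continuous_extension U (\<lambda>v. LINT z|U. v z)"
  unfolding continuous_extension_def
proof (intro conjI allI impI ballI refl)
  fix X u assume "(\<forall>n. X n \<in> H1) \<and> u \<in> H1 \<and> H1_tendsto X u"
  then have L2: "X n \<in> L2loc" "u \<in> L2loc" and lim: "H1_tendsto X u" for n by (auto simp: H1_def)
  note D = L2loc_U[OF L2loc_diff[OF L2]]
  have "(\<lambda>n. LINT z:S|lborel. (X n z - u z)^2) \<longlonglongrightarrow> 0"
    using lim compact_S by (simp add: H1_tendsto_def)
  then have "(\<lambda>n. sqrt ((LINT z:S|lborel. (X n z - u z)^2) / (pi * \<rho>))) \<longlonglongrightarrow> sqrt (0 / (pi * \<rho>))"
    using \<rho> by (intro tendsto_intros) auto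
  then have to0: "(\<lambda>n. sqrt (LINT z|U. (X n z - u z)^2)) \<longlonglongrightarrow> 0" by (simp add: D(3))
  have "\<bar>(LINT z|U. X n z) - (LINT z|U. u z)\<bar> \<le> sqrt (LINT z|U. (X n z - u z)^2)" for n
  proof (rule real_le_rsqrt)
    have "(LINT z|U. X n z - u z)^2 \<le> (LINT z|U. (X n z - u z)^2)"
      using variance_positive[of "\<lambda>z. X n z - u z"] variance_eq[OF D(2) D(1), of n] by simp
    then show "\<bar>(LINT z|U. X n z) - (LINT z|U. u z)\<bar>^2 \<le> (LINT z|U. (X n z - u z)^2)"
      using L2loc_U(2)[OF L2(1)] L2loc_U(2)[OF L2(2)] by simp
  qed
  then have "(\<lambda>n. (LINT z|U. X n z) - (LINT z|U. u z)) \<longlonglongrightarrow> 0"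
    by (intro Lim_null_comparison[OF _ to0]) auto
  then show "(\<lambda>n. LINT z|U. X n z) \<longlonglongrightarrow> (LINT z|U. u z)" by (simp add: LIM_zero_iff)
qed

text \<open>Every extension vanishes at the test function 0, but without the existence of an
  extension the definite description would be a default value.\<close>

lemma pairing_0: "pairing (\<lambda>_. 0) U = 0"
  unfolding pairing_def
proof (rule the_equality)
  have "(\<lambda>_. 0) \<in> test_functions"
    by (rule test_functionsI[of _ "{}"]) (auto intro: C_diff_const)
  then show "c = 0" if "\<exists>L. continuous_extension U L \<and> L (\<lambda>_. 0) = c" for c
    using that by (auto simp: continuous_extension_def)
  show "\<exists>L. continuous_extension U L \<and> L (\<lambda>_. 0) = 0"
    using continuous_extension_U by (intro exI[of _ "\<lambda>v. LINT z|U. v z"]) simp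
qed

end

section \<open>Free energies\<close>

lemma free_energy_0_le:
  assumes l: "l > 0"
  shows "free_energy (\<lambda>z. l * (cmod z)^2) (\<lambda>_. 0) \<le> ereal (3 / 4 + ln l / 2)"
proof -
  interpret D: disc "1 / l" "{z. (cmod z)^2 \<in> {0..1 / l}}" "uniform_measure lborel {z. (cmod z)^2 \<in> {0..1 / l}}"
    by unfold_locales (use l in auto)
  let ?U = "uniform_measure lborel {z. (cmod z)^2 \<in> {0..1 / l}}"
  have e: "energy (\<lambda>z. l * (cmod z)^2) ?U \<le> ereal (3 / 4 + ln l / 2)"
    using D.energy_disc l by (simp add: ln_div)
  then have "?U \<in> finite_energy (\<lambda>z. l * (cmod z)^2)"
    using D.U_in_prob_measures by (auto simp: finite_energy_def)
  then have "free_energy (\<lambda>z. l * (cmod z)^2) (\<lambda>_. 0) \<le> perturbed_energy (\<lambda>z. l * (cmod z)^2) (\<lambda>_. 0) ?U"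
    unfolding free_energy_def by (rule INF_lower)
  also have "\<dots> = energy (\<lambda>z. l * (cmod z)^2) ?U"
    unfolding perturbed_energy_def D.pairing_0 by simp
  finally show ?thesis using e by (rule order_trans)
qed

text \<open>For a measure without continuous extension, \<open>pairing\<close> has the junk value \<open>THE c. False\<close>. There
  are no such measures of finite energy, but instead of proving this we take \<open>K\<close> so negative that they
  could not lower the free energy.\<close>

lemma free_energy_well_ge:
  assumes l: "l > 0" and K: "K \<le> 0" "K \<le> (THE c::real. False) - 1"
  shows "ereal (1 + ln l / 2 + K) \<le> free_energy (\<lambda>z. l * (cmod z)^2) (well l K)"
  unfolding free_energy_def
proof (rule INF_greatest)
  fix \<mu> assume "\<mu> \<in> finite_energy (\<lambda>z. l * (cmod z)^2)"
  then have \<mu>: "\<mu> \<in> prob_measures" by (simp add: finite_energy_def)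
  note [measurable_cong] = prob_measuresD(2)[OF \<mu>]
  interpret prob_space \<mu> by (rule prob_measuresD[OF \<mu>])
  let ?q = "\<lambda>z. max 0 (1 - l * (cmod z)^2)"
  let ?Q = "\<integral>z. ?q z \<partial>\<mu>"
  obtain X G g B R where "H1_approximation X G (well l K) g B R"
    using H1_approximation_well[OF l] by blast
  then interpret A: H1_approximation X G "well l K" g B R .
  have q: "integrable \<mu> ?q"
    by (rule integrable_const_bound[of _ 1]) (use l in auto)
  have w: "integrable \<mu> (well l K)"
    by (rule integrable_const_bound[of _ B]) (use A.limit_bounds in auto)
  have "?Q \<le> (\<integral>z. 1 \<partial>\<mu>)"
    by (rule integral_mono[OF q]) (use l in auto)
  then have q1: "?Q \<le> 1" by (simp add: prob_space)
  have "(\<integral>z. ?q z + K \<partial>\<mu>) \<le> (\<integral>z. well l K z \<partial>\<mu>)"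
    by (rule integral_mono) (use q w well_ge[OF l K(1)] in auto)
  then have "?Q + K \<le> (\<integral>z. well l K z \<partial>\<mu>)" using q by (simp add: prob_space)
  \<comment> \<open>In the default case the pairing is at least K + 1 by the choice of
    \<open>K\<close>, and \<open>?Q\<close> is at most 1.\<close>
  then have "?Q + K \<le> pairing (well l K) \<mu>"
    using A.pairing_cases[OF \<mu>] q1 K by auto
  moreover have "ereal (1 + ln l / 2) \<le> energy (\<lambda>z. l * (cmod z)^2) \<mu> + ereal ?Q"
    by (rule energy_ge[OF l \<mu>])
  ultimately show "ereal (1 + ln l / 2 + K) \<le> perturbed_energy (\<lambda>z. l * (cmod z)^2) (well l K) \<mu>"
    unfolding perturbed_energy_def by (cases "energy (\<lambda>z. l * (cmod z)^2) \<mu>") auto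
qed

section \<open>Asymptotics\<close>

text \<open>Accurate to second order at 0. At x = 1 / N it gives (N + 1/2) ln (1 + 1/N) >= 1, the
  induction step of Stirling's upper bound, for which the weaker 1 / (N + 1) would not
  suffice.\<close>

lemma ln_ge_pade: "x \<ge> 0 \<Longrightarrow> 2 * x / (2 + x) \<le> ln (1 + x :: real)"
proof -
  assume x: "x \<ge> 0"
  have "ln (1 + 0) - 2 * 0 / (2 + 0) \<le> ln (1 + x) - 2 * x / (2 + x)"
  proof (rule DERIV_nonneg_imp_nondecreasing[OF x])
    fix y :: real assume y: "0 \<le> y"
    have "((\<lambda>x. ln (1 + x) - 2 * x / (2 + x)) has_real_derivative 1 / (1 + y) - 4 / (2 + y)^2) (at y)"
      using y by (auto intro!: derivative_eq_intros simp: power2_eq_square field_simps)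
    moreover have "1 / (1 + y) - 4 / (2 + y)^2 = y^2 / ((1 + y) * (2 + y)^2)"
    proof -
      have "1 + y \<noteq> 0" "(2 + y)^2 \<noteq> 0" using y by auto
      then have "1 / (1 + y) - 4 / (2 + y)^2 = ((2 + y)^2 - 4 * (1 + y)) / ((1 + y) * (2 + y)^2)"
        by (simp add: diff_frac_eq)
      also have "(2 + y)^2 - 4 * (1 + y) = y^2" by (simp add: power2_eq_square algebra_simps)
      finally show ?thesis .
    qed
    moreover have "y^2 / ((1 + y) * (2 + y)^2) \<ge> 0" using y by simp
    ultimately show "\<exists>d. ((\<lambda>x. ln (1 + x) - 2 * x / (2 + x)) has_real_derivative d) (at y) \<and> 0 \<le> d"
      by metis
  qed
  then show ?thesis by simp
qed

lemma ln_Suc_diff_bounds: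
  assumes "N \<ge> 1"
  shows "2 / (2 * real N + 1) \<le> ln (real N + 1) - ln (real N)" "ln (real N + 1) - ln (real N) \<le> 1 / real N"
proof -
  have e: "ln (real N + 1) - ln (real N) = ln (1 + 1 / real N)"
  proof -
    have "1 + 1 / real N = (real N + 1) / real N" using assms by (simp add: field_simps)
    then show ?thesis using assms by (simp add: ln_div)
  qed
  show "2 / (2 * real N + 1) \<le> ln (real N + 1) - ln (real N)"
    unfolding e using ln_ge_pade[of "1 / real N"] assms by (simp add: field_simps)
  show "ln (real N + 1) - ln (real N) \<le> 1 / real N"
    unfolding e by (rule ln_add_one_self_le_self) simp
qed

text \<open>Stirling's upper bound. It has to be right up to O(1): an error of order ln N in each
  factorial would add up to order N ln N in the product of factorials.\<close>

lemma ln_fact_le: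
  "N \<ge> 1 \<Longrightarrow> ln (fact N :: real) \<le> real N * ln (real N) - real N + ln (real N) / 2 + 1"
proof (induction N rule: dec_induct)
  case (step N)
  have "1 \<le> (real N + 1 / 2) * (ln (real N + 1) - ln (real N))"
    using mult_left_mono[OF ln_Suc_diff_bounds(1)[OF step.hyps(1)], of "real N + 1 / 2"]
    by (simp add: field_simps)
  moreover have "ln (fact (Suc N) :: real) = ln (real N + 1) + ln (fact N)"
    by (simp add: ln_mult_pos add.commute)
  ultimately show ?case using step.IH by (simp add: algebra_simps)
qed simp

text \<open>\<open>fact N\<close> contributes N ln N; the sum contributes 3/4 N^2 and takes back N
  ln N / 2. The surviving half, times beta, competes with the entropy cost N ln N.\<close>

lemma superfactorial_bound:
  "N \<ge> 1 \<Longrightarrow> 3 / 4 * (real N)^2 + real N * ln (real N) / 2 - 9 / 4 * real N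
    \<le> ln (fact N) + (\<Sum>k<N. real k * ln (real N) - ln (fact k))"
proof (induction N rule: dec_induct)
  case (step N)
  have N: "N \<ge> 1" by fact
  define L where "L = ln (real N)"
  define M where "M = ln (real N + 1)"
  define Sf where "Sf = (\<Sum>k<N. ln (fact k :: real))"
  have s: "(\<Sum>k<n. real k * x) = real n * (real n - 1) / 2 * x" for n and x :: real
    by (induction n) (auto simp: field_simps)
  have IH: "3 / 4 * (real N)^2 + real N * L / 2 - 9 / 4 * real N \<le> ln (fact N) + (real N * (real N - 1) / 2 * L - Sf)"
    using step.IH by (simp add: sum_subtractf s L_def Sf_def)
  have bounds: "2 / (2 * real N + 1) \<le> M - L" "M - L \<le> 1 / real N"
    using ln_Suc_diff_bounds[OF N] by (auto simp: L_def M_def)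
  have "real N / 2 \<le> real N * (real N + 1) / 2 * (2 / (2 * real N + 1))"
    by (simp add: field_simps)
  also have "\<dots> \<le> real N * (real N + 1) / 2 * (M - L)"
    by (rule mult_left_mono[OF bounds(1)]) simp
  finally have 1: "real N / 2 \<le> real N * (real N + 1) / 2 * (M - L)" .
  have 2: "real N * (M - L) \<le> 1"
    using mult_left_mono[OF bounds(2), of "real N"] N by simp
  have 3: "ln (fact N) \<le> real N * L - real N + L / 2 + 1"
    using ln_fact_le[OF N] by (simp add: L_def)
  have 4: "L \<le> M" using bounds(1) by (smt (verit) divide_nonneg_nonneg of_nat_0_le_iff)
  define n where "n = real N"
  have "ln (fact (Suc N)) + (\<Sum>k<Suc N. real k * ln (real (Suc N)) - ln (fact k))
    = (M + ln (fact N)) + ((real N + 1) * real N / 2 * M - (Sf + ln (fact N)))"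
  proof -
    have "ln (fact (Suc N) :: real) = M + ln (fact N)"
      by (simp add: ln_mult_pos M_def add.commute)
    moreover have "(\<Sum>k<Suc N. ln (fact k :: real)) = Sf + ln (fact N)" by (simp add: Sf_def)
    ultimately show ?thesis
      unfolding sum_subtractf s by (simp add: M_def add.commute)
  qed
  also have "\<dots> = M + ((n * (n * M)) + n * M) / 2 - Sf"
    by (simp add: n_def field_simps)
  finally have lhs: "ln (fact (Suc N)) + (\<Sum>k<Suc N. real k * ln (real (Suc N)) - ln (fact k))
    = M + ((n * (n * M)) + n * M) / 2 - Sf" .
  have rhs: "3 / 4 * (real (Suc N))^2 + real (Suc N) * ln (real (Suc N)) / 2 - 9 / 4 * real (Suc N)
    = 3 / 4 * (n * n) + 3 / 2 * n + 3 / 4 + (n * M + M) / 2 - 9 / 4 * n - 9 / 4"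
    by (simp add: n_def M_def power2_eq_square field_simps)
  have "3 / 4 * (n * n) + n * L / 2 - 9 / 4 * n \<le> ln (fact N) + (n * (n * L) - n * L) / 2 - Sf"
    using IH by (simp add: n_def power2_eq_square field_simps)
  moreover have "n / 2 \<le> (n * (n * M) + n * M) / 2 - (n * (n * L) + n * L) / 2"
    using 1 by (simp add: n_def field_simps)
  moreover have "n * M - n * L \<le> 1" using 2 by (simp add: n_def right_diff_distrib)
  moreover have "ln (fact N) \<le> n * L - n + L / 2 + 1" using 3 by (simp add: n_def)
  \<comment> \<open>What remains is linear once products such as \<open>n * (n * M)\<close> are
    replaced by free variables. The constant 9/4 = 3/4 + 3/2 is just enough to close it.\<close>
  moreover have "x1 + nL / 2 - x2 \<le> fN + (nnL - nL) / 2 - S \<Longrightarrow> n / 2 \<le> (nnM + nM) / 2 - (nnL + nL) / 2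
      \<Longrightarrow> nM - nL \<le> 1 \<Longrightarrow> fN \<le> nL - n + L / 2 + 1 \<Longrightarrow> L \<le> M
      \<Longrightarrow> x1 + 3 / 2 * n + 3 / 4 + (nM + M) / 2 - x2 - 9 / 4 \<le> M + (nnM + nM) / 2 - S"
    for x1 x2 nL nM nnL nnM S fN :: real by (simp add: field_simps)
  ultimately show ?case unfolding lhs rhs using 4 by blast
qed simp

section \<open>The lower bound for the Laplace transform and the contradiction\<close>

lemma elog_mono_ennreal:
  assumes "ennreal x \<le> y" "x > 0"
  shows "ereal (ln x) \<le> elog y"
proof (cases y)
  case (real r)
  then have "x \<le> r" "r > 0" using assms by (auto simp: ennreal_le_iff2)
  then show ?thesis using real assms by (simp add: elog_def ennreal_eq_0_iff ln_mono)
next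
  case top
  then show ?thesis by (simp add: elog_def)
qed

text \<open>The bound for the annulus divided by the bound for the partition function. The
  coefficient of ln N / N is 1/2 from \<open>superfactorial_bound\<close> minus 1/b from the volume
  of the annulus; it is positive exactly for b > 2.\<close>

lemma laplace_lower_bound:
  assumes b: "b \<ge> 1" and l: "l > 0" and K: "K \<le> 0" and N: "N \<ge> 1"
  shows "ereal (- (1 / 4 + K) + 2 * K / (real N)^2 + ((1 / 2 - 1 / b) * ln (real N) - 1 / b - 13 / 4) / real N)
    \<le> ereal (1 / (b * (real N)^2)) *
      elog (\<integral>\<^sup>+ z. ennreal (exp (- b * (real N)^2 * linear_statistic N (well l K) z))
        \<partial>(coulomb_gas N b (\<lambda>w. real N * (l * (cmod w)^2))))"
proof -
  let ?V = "\<lambda>w :: complex. real N * (l * (cmod w)^2)"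
  let ?e = "\<lambda>z. ennreal (exp (- b * (real N)^2 * linear_statistic N (well l K) z))"
  define n where "n = real N"
  have n: "n \<ge> 1" using N by (simp add: n_def)
  let ?A = "\<Sum>k<N. ln (fact k) - real k * (ln n + ln l)"
  let ?B = "\<Sum>k<N. - 1 - real k * ln l"
  let ?C = "3 / 4 * n^2 + n * ln n / 2 - 9 / 4 * n - n"
  let ?F = "fact N * (\<Prod>k<N. exp (- 1) / l ^ k)"
  define a where "a = 1 + K - 2 * K / (real N)^2"
  define p where "p = exp (- b * n^2 * a) * (pi / (l * (n + 1))) ^ N * ?F powr b"
  define h where "h = (\<Prod>k<N. fact k / (n * l) ^ k)"
  define q where "q = h powr b * (pi / l) ^ N"
  define Z where "Z = partition_function N b ?V"
  define I where "I = (\<integral>\<^sup>+ z. ?e z \<partial>(coulomb_gas N b ?V))"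
  have P: "(\<Prod>k<N. exp (- 1) / l ^ k) > 0" and h: "h > 0"
    using l n by (auto simp: h_def intro!: prod_pos)
  have p: "p > 0" using l n P by (simp add: p_def)
  have q: "q > 0" using l h by (simp add: q_def)
  obtain X G g B R where "H1_approximation X G (well l K) g B R"
    using H1_approximation_well[OF l] by blast
  then interpret A: H1_approximation X G "well l K" g B R .
  have [measurable]: "(\<lambda>z. linear_statistic N (well l K) z) \<in> borel_measurable (lborel_power N)"
  proof -
    have "(\<lambda>z. well l K (z i)) \<in> borel_measurable (lborel_power N)" if "i \<in> {..<N}" for i
      using that by measurable
    then show ?thesis
      unfolding linear_statistic_def by (intro borel_measurable_times borel_measurable_sum) auto
  qed
  have [measurable]: "gas_weight N b ?V \<in> borel_measurable (lborel_power N)" by (rule gas_weight_measurable) measurable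
  have num: "ennreal p \<le> (\<integral>\<^sup>+ z. ennreal (gas_weight N b ?V z) * ?e z \<partial>lborel_power N)"
    unfolding p_def n_def
    by (rule gas_numerator_lower_bound[OF b l]) (use N well_le_on_annulus[OF l K, of N] in \<open>auto simp: a_def\<close>)
  have "Z \<le> ennreal q"
    unfolding Z_def q_def h_def n_def using partition_function_upper_bound[OF b l, of N] N by simp
  \<comment> \<open>Includes \<open>Z = 0\<close>, whose inverse is infinity.\<close>
  have Zq: "inverse (ennreal q) \<le> inverse Z"
  proof (cases Z)
    case (real r)
    then have r: "r \<le> q" using \<open>Z \<le> ennreal q\<close> q by (simp add: ennreal_le_iff)
    show ?thesis
    proof (cases "r = 0")
      case False
      then have "r > 0" using real by simp
      then show ?thesis using real r q by (simp add: inverse_ennreal ennreal_leI le_imp_inverse_le)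
    qed (simp add: real)
  qed (use \<open>Z \<le> ennreal q\<close> in \<open>simp add: top_unique\<close>)
  have "I = (\<integral>\<^sup>+ z. ennreal (gas_weight N b ?V z) / Z * ?e z \<partial>lborel_power N)"
    unfolding I_def coulomb_gas_def Z_def by (subst nn_integral_density) auto
  also have "\<dots> = (\<integral>\<^sup>+ z. (ennreal (gas_weight N b ?V z) * ?e z) * inverse Z \<partial>lborel_power N)"
    by (simp add: divide_ennreal_def mult_ac)
  also have "\<dots> = (\<integral>\<^sup>+ z. ennreal (gas_weight N b ?V z) * ?e z \<partial>lborel_power N) * inverse Z"
    by (rule nn_integral_multc) measurable
  also have "\<dots> \<ge> ennreal p * inverse (ennreal q)"
    by (intro mult_mono num Zq) auto
  also have "ennreal p * inverse (ennreal q) = ennreal (p / q)"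
    using p q by (simp add: inverse_ennreal ennreal_mult'[symmetric] divide_inverse)
  finally have "ereal (ln (p / q)) \<le> elog I"
    using p q by (intro elog_mono_ennreal) auto
  then have le: "ereal (1 / (b * n^2)) * ereal (ln (p / q)) \<le> ereal (1 / (b * n^2)) * elog I"
    using b n by (intro ereal_mult_left_mono) auto
  have lnp: "ln p = - b * n^2 * a + n * ln (pi / (l * (n + 1))) + b * (ln (fact N) + ?B)"
  proof -
    have "ln p = - b * n^2 * a + real N * ln (pi / (l * (n + 1))) + b * ln ?F"
      unfolding p_def using l n P by (simp add: ln_mult_pos ln_realpow ln_powr)
    also have "ln ?F = ln (fact N) + ?B"
      using l P by (subst ln_mult_pos) (auto simp: ln_prod ln_div ln_realpow)
    finally show ?thesis by (simp add: n_def)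
  qed
  have lnq: "ln q = b * ?A + n * ln (pi / l)"
  proof -
    have "ln q = b * ln h + real N * ln (pi / l)"
      unfolding q_def using l h by (simp add: ln_mult_pos ln_realpow ln_powr)
    also have "ln h = ?A"
      unfolding h_def using l n by (subst ln_prod) (auto simp: ln_div ln_realpow ln_mult_pos intro!: sum.cong)
    finally show ?thesis by (simp add: n_def)
  qed
  define T where "T = ln (fact N) + (\<Sum>k<N. real k * ln n - ln (fact k :: real))"
  have T: "3 / 4 * n^2 + n * ln n / 2 - 9 / 4 * n \<le> T"
    using superfactorial_bound[OF N] by (simp add: T_def n_def)
  have lnpi: "ln (pi / (l * (n + 1))) = ln (pi / l) - ln (n + 1)"
    using l n by (simp add: ln_div ln_mult_pos)
  \<comment> \<open>The powers of \<open>l\<close> are the same in numerator and denominator and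
    cancel. The term - n stems from the factors exp (-1) in the moments.\<close>
  have "ln (fact N) + ?B - ?A = T - n"
    unfolding T_def by (simp add: sum_subtractf sum_distrib_left[symmetric] sum_distrib_right[symmetric] distrib_left sum.distrib n_def sum_negf)
  then have "b * (ln (fact N) + ?B) - b * ?A = b * (T - n)"
    by (simp only: right_diff_distrib[symmetric])
  moreover have "n * ln (pi / (l * (n + 1))) = n * ln (pi / l) - n * ln (n + 1)"
    unfolding lnpi right_diff_distrib ..
  moreover have "ln (p / q) = ln p - ln q" using p q by (simp add: ln_div)
  ultimately have lnpq: "ln (p / q) = - b * n^2 * a - n * ln (n + 1) + b * (T - n)"
    unfolding lnp lnq by linarith
  have ln1: "ln (n + 1) \<le> ln n + 1"
  proof -
    have "ln (n + 1) - ln n \<le> 1 / n" using ln_Suc_diff_bounds(2)[OF N] by (simp add: n_def)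
    moreover have "1 / n \<le> 1" using n by simp
    ultimately show ?thesis by linarith
  qed
  have "b * ?C \<le> b * (T - n)"
    using T b by (intro mult_left_mono) auto
  moreover have "n * ln (n + 1) \<le> n * (ln n + 1)"
    using ln1 n by (intro mult_left_mono) auto
  ultimately have "- b * n^2 * a - n * (ln n + 1) + b * ?C \<le> ln (p / q)"
    unfolding lnpq by linarith
  then have "1 / (b * n^2) * (- b * n^2 * a - n * (ln n + 1) + b * ?C) \<le> 1 / (b * n^2) * ln (p / q)"
    using b n by (intro mult_left_mono) auto
  \<comment> \<open>1/4 is the constant 1 in \<open>a\<close> less 3/4. The 13/4 collects 9/4 from
    \<open>superfactorial_bound\<close> and 1 from the moments; - 1/b comes from ln (n + 1) <= ln n
    + 1.\<close>
  also have "1 / (b * n^2) * (- b * n^2 * a - n * (ln n + 1) + b * ?C)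
     = - (1 / 4 + K) + 2 * K / n^2 + ((1 / 2 - 1 / b) * ln n - 1 / b - 13 / 4) / n"
    using b n unfolding a_def n_def[symmetric] by (simp add: field_simps power2_eq_square)
  finally have "ereal (- (1 / 4 + K) + 2 * K / n^2 + ((1 / 2 - 1 / b) * ln n - 1 / b - 13 / 4) / n) \<le> ereal (1 / (b * n^2)) * ereal (ln (p / q))"
    by simp
  then show ?thesis using le unfolding I_def n_def by (rule order_trans)
qed

text \<open>\<open>d\<close> stands for the value of f, which for fixed u does not depend on N. As
  \<open>u\<close> is chosen before \<open>d\<close>, no information on the energy of its
  equilibrium measure enters.\<close>

lemma sharp_deviation_fails:
  assumes b: "b > 2" and l: "l > 0"
  defines "\<phi> \<equiv> \<lambda>z. l * (cmod z)^2"
  shows "\<exists>u\<in>H1. \<forall>d. \<not> (\<forall>\<^sub>F N in sequentially.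
    ereal (1 / (b * (real N)^2)) *
      elog (\<integral>\<^sup>+ z. ennreal (exp (- b * (real N)^2 * linear_statistic N u z))
        \<partial>(coulomb_gas N b (\<lambda>w. real N * \<phi> w)))
    \<le> - free_energy \<phi> u + free_energy \<phi> (\<lambda>_. 0) + ereal (1 / real N * d))"
proof -
  define K where "K = min 0 ((THE c::real. False) - 1)"
  have K: "K \<le> 0" "K \<le> (THE c::real. False) - 1" by (auto simp: K_def)
  let ?u = "well l K"
  obtain X G g B R where "H1_approximation X G ?u g B R"
    using H1_approximation_well[OF l] by blast
  then have u: "?u \<in> H1" by (rule H1_approximation.in_H1(2))
  have "- free_energy \<phi> ?u \<le> ereal (- (1 + ln l / 2 + K))"
    using free_energy_well_ge[OF l K]
    unfolding \<phi>_def by (simp only: ereal_minus_le_minus uminus_ereal.simps(1)[symmetric])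
  then have F: "- free_energy \<phi> ?u + free_energy \<phi> (\<lambda>_. 0)
      \<le> ereal (- (1 + ln l / 2 + K)) + ereal (3 / 4 + ln l / 2)"
    using free_energy_0_le[OF l] unfolding \<phi>_def by (rule add_mono)
  define \<delta> where "\<delta> = 1 / 2 - 1 / b"
  have \<delta>: "\<delta> > 0" using b by (simp add: \<delta>_def field_simps)
  let ?lhs = "\<lambda>N. ereal (1 / (b * (real N)^2)) *
    elog (\<integral>\<^sup>+ z. ennreal (exp (- b * (real N)^2 * linear_statistic N ?u z))
      \<partial>(coulomb_gas N b (\<lambda>w. real N * \<phi> w)))"
  let ?rhs = "\<lambda>d N. - free_energy \<phi> ?u + free_energy \<phi> (\<lambda>_. 0) + ereal (1 / real N * d)"
  have "\<not> (\<forall>\<^sub>F N in sequentially. ?lhs N \<le> ?rhs d N)" for d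
  proof
    assume d: "\<forall>\<^sub>F N in sequentially. ?lhs N \<le> ?rhs d N"
    have "filterlim (\<lambda>N. ln (real N)) at_top sequentially"
      by (intro filterlim_compose[OF ln_at_top] filterlim_real_sequentially)
    then have "\<forall>\<^sub>F N in sequentially. (d - 2 * K + 1 / b + 13 / 4) / \<delta> < ln (real N)"
      by (simp add: filterlim_at_top_dense)
    with d have "\<forall>\<^sub>F N :: nat in sequentially. False"
      using eventually_ge_at_top[of 1]
    proof eventually_elim
      case (elim N)
      have N: "real N \<ge> 1" using elim(3) by simp
      have "ereal (- (1 / 4 + K) + 2 * K / (real N)^2 + ((1 / 2 - 1 / b) * ln (real N) - 1 / b - 13 / 4) / real N)
        \<le> ?rhs d N"
        using laplace_lower_bound[of b l K N] b l K(1) elim(3)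
        by (intro order_trans[OF _ elim(1)]) (auto simp: \<phi>_def)
      \<comment> \<open>The two constants add up to - (1/4 + K), the leading term of the lower
        bound, so only terms of order ln N / N and smaller remain to be compared.\<close>
      also have "\<dots> \<le> ereal (- (1 + ln l / 2 + K)) + ereal (3 / 4 + ln l / 2) + ereal (1 / real N * d)"
        by (intro add_mono F order_refl)
      finally have "2 * K / (real N)^2 + (\<delta> * ln (real N) - 1 / b - 13 / 4) / real N \<le> d / real N"
        by (simp add: \<delta>_def)
      then have "(2 * K / (real N)^2 + (\<delta> * ln (real N) - 1 / b - 13 / 4) / real N) * real N \<le> d / real N * real N"
        using N by (intro mult_right_mono) auto
      then have "2 * K / real N + (\<delta> * ln (real N) - 1 / b - 13 / 4) \<le> d"
        using N by (simp add: distrib_right power2_eq_square)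
      moreover have "2 * K \<le> 2 * K / real N"
        using N mult_left_mono_neg[OF N K(1)] by (simp add: le_divide_eq)
      moreover have "d - 2 * K + 1 / b + 13 / 4 < \<delta> * ln (real N)"
        using elim(2) \<delta> by (simp add: divide_less_eq mult.commute)
      ultimately show False by linarith
    qed
    then show False by simp
  qed
  then show ?thesis using u by blast
qed

theorem proposition6p3:
  fixes \<beta> l :: real and \<phi> :: "complex \<Rightarrow> real"
  assumes "\<beta> > 2" and "l > 0" and "\<phi> = (\<lambda>z. l * (cmod z)\<^sup>2)"
  shows "\<not> (\<exists>f :: real \<Rightarrow> real. continuous_on UNIV f \<and> (\<forall>x. f x > 0) \<and>
    (\<forall>u\<in>H1. \<forall>\<^sub>F N in sequentially.
       ereal (1 / (\<beta> * (real N)\<^sup>2)) *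
         elog (\<integral>\<^sup>+ z. ennreal (exp (- \<beta> * (real N)\<^sup>2 * linear_statistic N u z))
                 \<partial>(coulomb_gas N \<beta> (\<lambda>w. real N * \<phi> w)))
       \<le> - free_energy \<phi> u + free_energy \<phi> (\<lambda>_. 0)
          + ereal (1 / real N * f (real_of_ereal (E0 (equilibrium_measure \<phi> u))))))"
  using sharp_deviation_fails[OF assms(1,2)] unfolding assms(3) by blast

end
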